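(* Let $(\mathcal{D},+)$ be a nonempty abelian semigroup. With the coaction $\delta$, $(\mathcal{H}_{\mathcal{G}(\mathcal{D})},m,\Delta)$ and $(\mathcal{H}_{\mathcal{G}(\mathcal{D})},m,\delta)$ are in cointeraction. Moreover, let $\mathcal{F}^{(\mathcal{D})}:\mathcal{H}_{\mathcal{G}(\mathcal{D})}\to\mathcal{H}_{\mathcal{G}}$ be the linear forgetful map sending a $\mathcal{D}$-decorated graph $(G,d_G)$ to $G$. Then $\mathcal{F}^{(\mathcal{D})}$ is a surjective Hopf algebra morphism from $(\mathcal{H}_{\mathcal{G}(\mathcal{D})},m,\Delta)$ to $(\mathcal{H}_{\mathcal{G}},m,\Delta)$ and a bialgebra morphism from $(\mathcal{H}_{\mathcal{G}(\mathcal{D})},m,\delta)$ to $(\mathcal{H}_{\mathcal{G}},m,\delta)$.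
   Context: A graph is a pair $G=(V(G),E(G))$ with $V(G)$ a finite set and $E(G)$ a set of $2$-element subsets of $V(G)$; graphs are considered up to isomorphism. The empty graph is denoted $1$ and is considered as non connected. For $I\subseteq V(G)$, $G_{|I}$ is the induced subgraph on $I$. For an equivalence relation $\sim$ on $V(G)$: $G/\sim$ is the graph with vertex set $V(G)/\sim$ and with an edge between two distinct classes if and only if some edge of $G$ joins an element of one to an element of the other; $G|\sim$ is the graph with $V(G|\sim)=V(G)$ and $E(G|\sim)=\{\{x,y\}\in E(G): x\sim y\}$; one writes $\sim\triangleleft G$ if $G_{|c}$ is connected for every class $c$ of $\sim$. A $\mathcal{D}$-decorated graph is a pair $(G,d_G)$ with $G$ a graph and $d_G:V(G)\to\mathcal{D}$ a map; isomorphisms preserve decorations. Disjoint unions and induced subgraphs $G_{|I}$ of decorated graphs are decorated by restriction; $G|\sim$ is decorated by $d_{G|\sim}=d_G$; $G/\sim$ is decorated by $d_{G/\sim}(c)=\sum_{x\in c}d_G(x)$ for each class $c$. $\mathcal{H}_{\mathcal{G}(\mathcal{D})}$ (resp. $\mathcal{H}_{\mathcal{G}}$) is the $\mathbb{Q}$-vector space with basis the isoclasses of $\mathcal{D}$-decorated graphs (resp. of graphs), with product $m$ given by disjoint union, and coproducts $$\Delta(G)=\sum_{V(G)=I\sqcup J}G_{|I}\otimes G_{|J},\qquad \delta(G)=\sum_{\sim\triangleleft G}(G/\sim)\otimes(G|\sim).$$ In both cases $(\cdot,m,\Delta)$ is a Hopf algebra, whose counit $\varepsilon$ sends the empty graph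 to $1$ and nonempty graphs to $0$, and $(\cdot,m,\delta)$ is a bialgebra, whose counit $\varepsilon'$ sends graphs without edges to $1$ and the others to $0$. Cointeraction: two bialgebras $(A,m,\Delta)$ (counit $\varepsilon$) and $(A,m,\delta)$ are in cointeraction (with coaction $\delta$) if $\delta(1)=1\otimes1$, $\delta(ab)=\delta(a)\delta(b)$, $(\varepsilon\otimes\mathrm{Id})\circ\delta(a)=\varepsilon(a)1$ for all $a,b\in A$, and $m_{1,3,24}\circ(\delta\otimes\delta)\circ\Delta=(\Delta\otimes\mathrm{Id})\circ\delta$, where $m_{1,3,24}(a_1\otimes b_1\otimes a_2\otimes b_2)=a_1\otimes a_2\otimes b_1b_2$. *)

theory Defs
  imports Complex_Main "HOL-Library.Poly_Mapping"
begin

section \<open>Free rational vector spaces and their tensor products\<close>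

text \<open>
  The \<open>\<rat>\<close>-vector space with basis \<open>'b\<close> is \<open>'b \<Rightarrow>\<^sub>0 rat\<close>, the basis vector of \<open>b\<close> being
  \<open>Poly_Mapping.single b 1\<close>.  The tensor product of the spaces with bases \<open>'b\<close> and \<open>'c\<close> is the
  space with basis \<open>'b \<times> 'c\<close>, the pair \<open>(b, c)\<close> standing for \<open>b \<otimes> c\<close>.  The convolution product that
  Poly-Mapping puts on \<open>'b \<Rightarrow>\<^sub>0 rat\<close> when \<open>'b\<close> is a monoid is not used.
\<close>

type_synonym 'b qvec = "'b \<Rightarrow>\<^sub>0 rat"

definition qscale :: "rat \<Rightarrow> 'b qvec \<Rightarrow> 'b qvec" where
  "qscale c x = Poly_Mapping.map ((*) c) x"

abbreviation qlinear :: "('b qvec \<Rightarrow> 'c qvec) \<Rightarrow> bool" where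
  "qlinear \<equiv> Vector_Spaces.linear qscale qscale"

abbreviation qlinear_form :: "('b qvec \<Rightarrow> rat) \<Rightarrow> bool" where
  "qlinear_form \<equiv> Vector_Spaces.linear qscale (*)"

abbreviation basis_vec :: "'b \<Rightarrow> 'b qvec" where
  "basis_vec b \<equiv> Poly_Mapping.single b 1"

definition lin_ext :: "('b \<Rightarrow> 'c qvec) \<Rightarrow> 'b qvec \<Rightarrow> 'c qvec" where
  "lin_ext f x = (\<Sum>b \<in> Poly_Mapping.keys x. qscale (Poly_Mapping.lookup x b) (f b))"

definition lin_ext_form :: "('b \<Rightarrow> rat) \<Rightarrow> 'b qvec \<Rightarrow> rat" where
  "lin_ext_form f x = (\<Sum>b \<in> Poly_Mapping.keys x. Poly_Mapping.lookup x b * f b)"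

definition tensor :: "'b qvec \<Rightarrow> 'c qvec \<Rightarrow> ('b \<times> 'c) qvec" where
  "tensor x y =
     (\<Sum>b \<in> Poly_Mapping.keys x. \<Sum>c \<in> Poly_Mapping.keys y.
        Poly_Mapping.single (b, c) (Poly_Mapping.lookup x b * Poly_Mapping.lookup y c))"

text \<open>\<open>f \<otimes> g\<close> for linear maps \<open>f\<close> and \<open>g\<close>:\<close>

definition tensor_map ::
  "('a qvec \<Rightarrow> 'c qvec) \<Rightarrow> ('b qvec \<Rightarrow> 'd qvec) \<Rightarrow> ('a \<times> 'b) qvec \<Rightarrow> ('c \<times> 'd) qvec" where
  "tensor_map f g = lin_ext (\<lambda>(a, b). tensor (f (basis_vec a)) (g (basis_vec b)))"

text \<open>\<open>e \<otimes> Id\<close> and \<open>Id \<otimes> e\<close> for a linear form \<open>e\<close>, with \<open>\<rat> \<otimes> A\<close> and \<open>A \<otimes> \<rat>\<close> identified with \<open>A\<close>:\<close>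

definition form_left :: "('a qvec \<Rightarrow> rat) \<Rightarrow> ('a \<times> 'b) qvec \<Rightarrow> 'b qvec" where
  "form_left e = lin_ext (\<lambda>(a, b). qscale (e (basis_vec a)) (basis_vec b))"

definition form_right :: "('b qvec \<Rightarrow> rat) \<Rightarrow> ('a \<times> 'b) qvec \<Rightarrow> 'a qvec" where
  "form_right e = lin_ext (\<lambda>(a, b). qscale (e (basis_vec b)) (basis_vec a))"

definition tensor_assoc :: "(('a \<times> 'b) \<times> 'c) qvec \<Rightarrow> ('a \<times> ('b \<times> 'c)) qvec" where
  "tensor_assoc = lin_ext (\<lambda>((a, b), c). basis_vec (a, (b, c)))"

section \<open>Bialgebras, Hopf algebras, morphisms and cointeraction\<close>

text \<open>
  A product is a linear map \<open>m\<close> from \<open>A \<otimes> A\<close> to \<open>A\<close>, so that \<open>x y\<close> is \<open>m (tensor x y)\<close>;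
  \<open>u\<close> is the unit element, \<open>\<Delta>\<close> a coproduct and \<open>e\<close> a counit.
\<close>

definition algebra :: "'b qvec \<Rightarrow> (('b \<times> 'b) qvec \<Rightarrow> 'b qvec) \<Rightarrow> bool" where
  "algebra u m \<longleftrightarrow>
     qlinear m \<and>
     (\<forall>x y z. m (tensor (m (tensor x y)) z) = m (tensor x (m (tensor y z)))) \<and>
     (\<forall>x. m (tensor u x) = x \<and> m (tensor x u) = x)"

definition coalgebra :: "('b qvec \<Rightarrow> ('b \<times> 'b) qvec) \<Rightarrow> ('b qvec \<Rightarrow> rat) \<Rightarrow> bool" where
  "coalgebra \<Delta> e \<longleftrightarrow>
     qlinear \<Delta> \<and> qlinear_form e \<and>
     (\<forall>x. tensor_assoc (tensor_map \<Delta> id (\<Delta> x)) = tensor_map id \<Delta> (\<Delta> x)) \<and>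
     (\<forall>x. form_left e (\<Delta> x) = x \<and> form_right e (\<Delta> x) = x)"

text \<open>The product of the algebra \<open>A \<otimes> A\<close>, \<open>(a\<^sub>1 \<otimes> b\<^sub>1) (a\<^sub>2 \<otimes> b\<^sub>2) = a\<^sub>1 a\<^sub>2 \<otimes> b\<^sub>1 b\<^sub>2\<close>:\<close>

definition tensor_mult ::
  "(('b \<times> 'b) qvec \<Rightarrow> 'b qvec) \<Rightarrow> (('b \<times> 'b) \<times> ('b \<times> 'b)) qvec \<Rightarrow> ('b \<times> 'b) qvec" where
  "tensor_mult m =
     lin_ext (\<lambda>((a1, b1), (a2, b2)). tensor (m (basis_vec (a1, a2))) (m (basis_vec (b1, b2))))"

definition bialgebra ::
  "'b qvec \<Rightarrow> (('b \<times> 'b) qvec \<Rightarrow> 'b qvec) \<Rightarrow> ('b qvec \<Rightarrow> ('b \<times> 'b) qvec) \<Rightarrow> ('b qvec \<Rightarrow> rat) \<Rightarrow> bool" where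
  "bialgebra u m \<Delta> e \<longleftrightarrow>
     algebra u m \<and> coalgebra \<Delta> e \<and>
     \<Delta> u = tensor u u \<and>
     (\<forall>x y. \<Delta> (m (tensor x y)) = tensor_mult m (tensor (\<Delta> x) (\<Delta> y))) \<and>
     e u = 1 \<and>
     (\<forall>x y. e (m (tensor x y)) = e x * e y)"

definition antipode ::
  "'b qvec \<Rightarrow> (('b \<times> 'b) qvec \<Rightarrow> 'b qvec) \<Rightarrow> ('b qvec \<Rightarrow> ('b \<times> 'b) qvec) \<Rightarrow> ('b qvec \<Rightarrow> rat) \<Rightarrow>
   ('b qvec \<Rightarrow> 'b qvec) \<Rightarrow> bool" where
  "antipode u m \<Delta> e S \<longleftrightarrow>
     qlinear S \<and>
     (\<forall>x. m (tensor_map S id (\<Delta> x)) = qscale (e x) u \<and>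
          m (tensor_map id S (\<Delta> x)) = qscale (e x) u)"

definition hopf_algebra ::
  "'b qvec \<Rightarrow> (('b \<times> 'b) qvec \<Rightarrow> 'b qvec) \<Rightarrow> ('b qvec \<Rightarrow> ('b \<times> 'b) qvec) \<Rightarrow> ('b qvec \<Rightarrow> rat) \<Rightarrow> bool" where
  "hopf_algebra u m \<Delta> e \<longleftrightarrow> bialgebra u m \<Delta> e \<and> (\<exists>S. antipode u m \<Delta> e S)"

definition bialgebra_morphism ::
  "'b qvec \<Rightarrow> (('b \<times> 'b) qvec \<Rightarrow> 'b qvec) \<Rightarrow> ('b qvec \<Rightarrow> ('b \<times> 'b) qvec) \<Rightarrow> ('b qvec \<Rightarrow> rat) \<Rightarrow>
   'c qvec \<Rightarrow> (('c \<times> 'c) qvec \<Rightarrow> 'c qvec) \<Rightarrow> ('c qvec \<Rightarrow> ('c \<times> 'c) qvec) \<Rightarrow> ('c qvec \<Rightarrow> rat) \<Rightarrow>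
   ('b qvec \<Rightarrow> 'c qvec) \<Rightarrow> bool" where
  "bialgebra_morphism u m \<Delta> e u' m' \<Delta>' e' f \<longleftrightarrow>
     bialgebra u m \<Delta> e \<and> bialgebra u' m' \<Delta>' e' \<and>
     qlinear f \<and>
     f u = u' \<and>
     (\<forall>x y. f (m (tensor x y)) = m' (tensor (f x) (f y))) \<and>
     (\<forall>x. \<Delta>' (f x) = tensor_map f f (\<Delta> x)) \<and>
     (\<forall>x. e' (f x) = e x)"

definition hopf_algebra_morphism ::
  "'b qvec \<Rightarrow> (('b \<times> 'b) qvec \<Rightarrow> 'b qvec) \<Rightarrow> ('b qvec \<Rightarrow> ('b \<times> 'b) qvec) \<Rightarrow> ('b qvec \<Rightarrow> rat) \<Rightarrow>
   'c qvec \<Rightarrow> (('c \<times> 'c) qvec \<Rightarrow> 'c qvec) \<Rightarrow> ('c qvec \<Rightarrow> ('c \<times> 'c) qvec) \<Rightarrow> ('c qvec \<Rightarrow> rat) \<Rightarrow>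
   ('b qvec \<Rightarrow> 'c qvec) \<Rightarrow> bool" where
  "hopf_algebra_morphism u m \<Delta> e u' m' \<Delta>' e' f \<longleftrightarrow>
     hopf_algebra u m \<Delta> e \<and> hopf_algebra u' m' \<Delta>' e' \<and>
     bialgebra_morphism u m \<Delta> e u' m' \<Delta>' e' f \<and>
     (\<forall>S S'. antipode u m \<Delta> e S \<longrightarrow> antipode u' m' \<Delta>' e' S' \<longrightarrow> f \<circ> S = S' \<circ> f)"

text \<open>\<open>m\<^sub>1\<^sub>,\<^sub>3\<^sub>,\<^sub>2\<^sub>4 (a\<^sub>1 \<otimes> b\<^sub>1 \<otimes> a\<^sub>2 \<otimes> b\<^sub>2) = a\<^sub>1 \<otimes> a\<^sub>2 \<otimes> b\<^sub>1 b\<^sub>2\<close>, triple tensors being bracketed to the left:\<close>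

definition m_1_3_24 ::
  "(('b \<times> 'b) qvec \<Rightarrow> 'b qvec) \<Rightarrow> (('b \<times> 'b) \<times> ('b \<times> 'b)) qvec \<Rightarrow> (('b \<times> 'b) \<times> 'b) qvec" where
  "m_1_3_24 m = lin_ext (\<lambda>((a1, b1), (a2, b2)). tensor (basis_vec (a1, a2)) (m (basis_vec (b1, b2))))"

definition cointeraction ::
  "'b qvec \<Rightarrow> (('b \<times> 'b) qvec \<Rightarrow> 'b qvec) \<Rightarrow> ('b qvec \<Rightarrow> ('b \<times> 'b) qvec) \<Rightarrow> ('b qvec \<Rightarrow> rat) \<Rightarrow>
   ('b qvec \<Rightarrow> ('b \<times> 'b) qvec) \<Rightarrow> ('b qvec \<Rightarrow> rat) \<Rightarrow> bool" where
  "cointeraction u m \<Delta> e \<delta> e' \<longleftrightarrow>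
     bialgebra u m \<Delta> e \<and> bialgebra u m \<delta> e' \<and>
     \<delta> u = tensor u u \<and>
     (\<forall>a b. \<delta> (m (tensor a b)) = tensor_mult m (tensor (\<delta> a) (\<delta> b))) \<and>
     (\<forall>a. form_left e (\<delta> a) = qscale (e a) u) \<and>
     (\<forall>a. m_1_3_24 m (tensor_map \<delta> \<delta> (\<Delta> a)) = tensor_map \<Delta> id (\<delta> a))"

section \<open>Graphs\<close>

record 'v graph =
  verts :: "'v set"
  edges :: "'v set set"

definition finite_graph :: "'v graph \<Rightarrow> bool" where
  "finite_graph G \<longleftrightarrow> finite (verts G) \<and> (\<forall>e \<in> edges G. e \<subseteq> verts G \<and> card e = 2)"

definition graph_iso :: "('v \<Rightarrow> 'w) \<Rightarrow> 'v graph \<Rightarrow> 'w graph \<Rightarrow> bool" where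
  "graph_iso f G H \<longleftrightarrow> bij_betw f (verts G) (verts H) \<and> edges H = (`) f ` edges G"

definition connected_graph :: "'v graph \<Rightarrow> bool" where
  "connected_graph G \<longleftrightarrow>
     verts G \<noteq> {} \<and> (\<forall>x \<in> verts G. \<forall>y \<in> verts G. (x, y) \<in> {(a, b). {a, b} \<in> edges G}\<^sup>*)"

definition empty_graph :: "'v graph" where
  "empty_graph = \<lparr>verts = {}, edges = {}\<rparr>"

definition disj_union :: "'v graph \<Rightarrow> 'w graph \<Rightarrow> ('v + 'w) graph" where
  "disj_union G H = \<lparr>verts = verts G <+> verts H, edges = (`) Inl ` edges G \<union> (`) Inr ` edges H\<rparr>"

definition induced :: "'v graph \<Rightarrow> 'v set \<Rightarrow> 'v graph" where
  "induced G I = \<lparr>verts = I, edges = {e \<in> edges G. e \<subseteq> I}\<rparr>"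

definition contract :: "'v graph \<Rightarrow> 'v rel \<Rightarrow> 'v set graph" where
  "contract G r =
     \<lparr>verts = verts G // r,
      edges = {{c, c'} | c c'. c \<in> verts G // r \<and> c' \<in> verts G // r \<and> c \<noteq> c' \<and>
                               (\<exists>x \<in> c. \<exists>y \<in> c'. {x, y} \<in> edges G)}\<rparr>"

definition cut :: "'v graph \<Rightarrow> 'v rel \<Rightarrow> 'v graph" where
  "cut G r = \<lparr>verts = verts G, edges = {{x, y} | x y. {x, y} \<in> edges G \<and> (x, y) \<in> r}\<rparr>"

definition admissible :: "'v graph \<Rightarrow> 'v rel set" where
  "admissible G =
     {r. equiv (verts G) r \<and> (\<forall>c \<in> verts G // r. connected_graph (induced G c))}"

section \<open>Decorated graphs\<close>

text \<open>
  The value of a decoration outside the vertex set is irrelevant: isomorphisms ignore it.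
\<close>

type_synonym ('v, 'd) dgraph = "'v graph \<times> ('v \<Rightarrow> 'd)"

definition dgraph_iso :: "('v \<Rightarrow> 'w) \<Rightarrow> ('v, 'd) dgraph \<Rightarrow> ('w, 'd) dgraph \<Rightarrow> bool" where
  "dgraph_iso f G H \<longleftrightarrow>
     graph_iso f (fst G) (fst H) \<and> (\<forall>x \<in> verts (fst G). snd H (f x) = snd G x)"

text \<open>
  The sum of \<open>f\<close> over a finite nonempty set in a commutative semigroup that need not have a
  neutral element; the accumulator \<open>None\<close> means that no summand has been met yet.
\<close>

definition semigroup_sum :: "('v \<Rightarrow> 'd::ab_semigroup_add) \<Rightarrow> 'v set \<Rightarrow> 'd" where
  "semigroup_sum f A =
     the (Finite_Set.fold (\<lambda>x s. Some (case s of None \<Rightarrow> f x | Some a \<Rightarrow> f x + a)) None A)"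

lemma comp_fun_commute_semigroup_sum:
  "comp_fun_commute (\<lambda>x s. Some (case s of None \<Rightarrow> f x | Some a \<Rightarrow> f x + (a::'d::ab_semigroup_add)))"
  by unfold_locales (auto simp: fun_eq_iff ac_simps split: option.splits)

lemma semigroup_sum_singleton [simp]: "semigroup_sum f {x} = f x"
proof -
  interpret comp_fun_commute "\<lambda>x s. Some (case s of None \<Rightarrow> f x | Some a \<Rightarrow> f x + a)"
    by (rule comp_fun_commute_semigroup_sum)
  show ?thesis by (simp add: semigroup_sum_def)
qed

lemma semigroup_sum_insert:
  assumes "finite A" "A \<noteq> {}" "x \<notin> A"
  shows "semigroup_sum f (insert x A) = f x + semigroup_sum f A"
proof -
  let ?g = "\<lambda>x s. Some (case s of None \<Rightarrow> f x | Some a \<Rightarrow> f x + a)"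
  interpret comp_fun_commute ?g
    by (rule comp_fun_commute_semigroup_sum)
  from assms(2) obtain y where "y \<in> A" by blast
  then have "Finite_Set.fold ?g None A = ?g y (Finite_Set.fold ?g None (A - {y}))"
    using fold_rec[OF assms(1)] by simp
  then obtain s where s: "Finite_Set.fold ?g None A = Some s" by simp
  show ?thesis using assms s by (simp add: semigroup_sum_def)
qed

definition ddisj_union :: "('v, 'd) dgraph \<Rightarrow> ('w, 'd) dgraph \<Rightarrow> ('v + 'w, 'd) dgraph" where
  "ddisj_union G H = (disj_union (fst G) (fst H), case_sum (snd G) (snd H))"

definition dinduced :: "('v, 'd) dgraph \<Rightarrow> 'v set \<Rightarrow> ('v, 'd) dgraph" where
  "dinduced G I = (induced (fst G) I, snd G)"

definition dcontract :: "('v, 'd::ab_semigroup_add) dgraph \<Rightarrow> 'v rel \<Rightarrow> ('v set, 'd) dgraph" where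
  "dcontract G r = (contract (fst G) r, \<lambda>c. semigroup_sum (snd G) c)"

definition dcut :: "('v, 'd) dgraph \<Rightarrow> 'v rel \<Rightarrow> ('v, 'd) dgraph" where
  "dcut G r = (cut (fst G) r, snd G)"

section \<open>Isomorphism classes\<close>

text \<open>
  An isoclass is represented by the set of its members with vertices in \<open>nat\<close>; every finite graph,
  on any type of vertices, has an isomorphic copy of this kind, and so has an isoclass.
\<close>

typedef graph_class =
  "{{H :: nat graph. finite_graph H \<and> (\<exists>f. graph_iso f G H)} | G :: nat graph. finite_graph G}"
  morphisms graph_class_members Abs_graph_class
proof -
  have "finite_graph (empty_graph :: nat graph)" by (simp add: finite_graph_def empty_graph_def)
  then show ?thesis by blast
qed

typedef 'd dgraph_class =
  "{{H :: (nat, 'd) dgraph. finite_graph (fst H) \<and> (\<exists>f. dgraph_iso f G H)} |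
      G :: (nat, 'd) dgraph. finite_graph (fst G)}"
  morphisms dgraph_class_members Abs_dgraph_class
proof -
  have "finite_graph (fst (empty_graph, \<lambda>_. undefined) :: nat graph)"
    by (simp add: finite_graph_def empty_graph_def)
  then show ?thesis by blast
qed

definition graph_class :: "'v graph \<Rightarrow> graph_class" where
  "graph_class G = Abs_graph_class {H. finite_graph H \<and> (\<exists>f. graph_iso f G H)}"

definition dgraph_class :: "('v, 'd) dgraph \<Rightarrow> 'd dgraph_class" where
  "dgraph_class G = Abs_dgraph_class {H. finite_graph (fst H) \<and> (\<exists>f. dgraph_iso f G H)}"

definition graph_rep :: "graph_class \<Rightarrow> nat graph" where
  "graph_rep g = (SOME G. G \<in> graph_class_members g)"

definition dgraph_rep :: "'d dgraph_class \<Rightarrow> (nat, 'd) dgraph" where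
  "dgraph_rep g = (SOME G. G \<in> dgraph_class_members g)"

section \<open>The bialgebras of graphs\<close>

text \<open>
  The structure maps are given on a basis element by the defining formula for a chosen
  representative; the result does not depend on the choice.
\<close>

definition graph_unit :: "graph_class qvec" where
  "graph_unit = basis_vec (graph_class (empty_graph :: nat graph))"

definition graph_mult :: "(graph_class \<times> graph_class) qvec \<Rightarrow> graph_class qvec" where
  "graph_mult = lin_ext (\<lambda>(g, h). basis_vec (graph_class (disj_union (graph_rep g) (graph_rep h))))"

definition graph_Delta :: "graph_class qvec \<Rightarrow> (graph_class \<times> graph_class) qvec" where
  "graph_Delta = lin_ext (\<lambda>g. let G = graph_rep g in
     \<Sum>I \<in> Pow (verts G). basis_vec (graph_class (induced G I), graph_class (induced G (verts G - I))))"

definition graph_delta :: "graph_class qvec \<Rightarrow> (graph_class \<times> graph_class) qvec" where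
  "graph_delta = lin_ext (\<lambda>g. let G = graph_rep g in
     \<Sum>r \<in> admissible G. basis_vec (graph_class (contract G r), graph_class (cut G r)))"

definition graph_eps :: "graph_class qvec \<Rightarrow> rat" where
  "graph_eps = lin_ext_form (\<lambda>g. if verts (graph_rep g) = {} then 1 else 0)"

definition graph_eps' :: "graph_class qvec \<Rightarrow> rat" where
  "graph_eps' = lin_ext_form (\<lambda>g. if edges (graph_rep g) = {} then 1 else 0)"

definition dgraph_unit :: "'d dgraph_class qvec" where
  "dgraph_unit = basis_vec (dgraph_class (empty_graph :: nat graph, \<lambda>_. undefined))"

definition dgraph_mult :: "('d dgraph_class \<times> 'd dgraph_class) qvec \<Rightarrow> 'd dgraph_class qvec" where
  "dgraph_mult = lin_ext (\<lambda>(g, h). basis_vec (dgraph_class (ddisj_union (dgraph_rep g) (dgraph_rep h))))"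

definition dgraph_Delta :: "'d dgraph_class qvec \<Rightarrow> ('d dgraph_class \<times> 'd dgraph_class) qvec" where
  "dgraph_Delta = lin_ext (\<lambda>g. let G = dgraph_rep g in
     \<Sum>I \<in> Pow (verts (fst G)).
       basis_vec (dgraph_class (dinduced G I), dgraph_class (dinduced G (verts (fst G) - I))))"

definition dgraph_delta ::
  "'d::ab_semigroup_add dgraph_class qvec \<Rightarrow> ('d dgraph_class \<times> 'd dgraph_class) qvec" where
  "dgraph_delta = lin_ext (\<lambda>g. let G = dgraph_rep g in
     \<Sum>r \<in> admissible (fst G). basis_vec (dgraph_class (dcontract G r), dgraph_class (dcut G r)))"

definition dgraph_eps :: "'d dgraph_class qvec \<Rightarrow> rat" where
  "dgraph_eps = lin_ext_form (\<lambda>g. if verts (fst (dgraph_rep g)) = {} then 1 else 0)"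

definition dgraph_eps' :: "'d dgraph_class qvec \<Rightarrow> rat" where
  "dgraph_eps' = lin_ext_form (\<lambda>g. if edges (fst (dgraph_rep g)) = {} then 1 else 0)"

definition forget :: "'d dgraph_class qvec \<Rightarrow> graph_class qvec" where
  "forget = lin_ext (\<lambda>g. basis_vec (graph_class (fst (dgraph_rep g))))"

end

theory Submission
  imports Defs "HOL-Library.Disjoint_Sets"
begin

text \<open>
  Every axiom is an identity between multilinear maps, hence an identity between finite sums of
  basis tensors when evaluated at isoclasses of graphs.  Coassociativity, multiplicativity and
  cointeraction are proved by a bijection between the index sets of the two sums under which
  corresponding graphs are equal or isomorphic.

  The coproduct \<open>\<delta>\<close> is indexed by the partitions \<open>P\<close> of the vertex set into connected blocks rather than by
  the equivalence relations with these classes, because the blocks are the vertices of \<open>G/P\<close>.  Three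
  bijections carry the proof.

  \<^item> Coassociativity of \<open>\<delta>\<close>: a connected partition \<open>P\<close> of \<open>G\<close> with a connected partition \<open>Q\<close> of
    \<open>G/P\<close> is the same as a connected partition \<open>T\<close> of \<open>G\<close> with a connected partition \<open>P\<close> of \<open>G|T\<close>,
    the blocks of \<open>T\<close> being the unions of the members of \<open>Q\<close> (\<open>connected_partitions_coarsen\<close>,
    \<open>connected_partitions_refine\<close>).  Then \<open>(G/P)/Q\<close> is isomorphic to \<open>G/T\<close>, and the decorations agree
    because a sum over a disjoint union of blocks is the sum of the sums over the blocks.
  \<^item> Cointeraction: a connected partition \<open>R\<close> of \<open>G\<close> with a set \<open>S\<close> of its blocks is the same as a set
    \<open>J = \<Union>S\<close> of vertices with connected partitions of the subgraphs induced on \<open>J\<close> and on its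
    complement (\<open>connected_partitions_sub\<close>, \<open>connected_partitions_union\<close>).
  \<^item> Multiplicativity of \<open>\<delta>\<close>: a connected block of a disjoint union lies in one of the two parts, so
    this is the previous bijection with \<open>J\<close> fixed to be one part.

  The counit of \<open>\<delta>\<close> selects the partition into connected components on one side and the partition into
  singletons on the other.  The antipode for \<open>\<Delta>\<close> exists because \<open>\<Delta>\<close> is graded by the number of
  vertices, with only the empty graph in degree zero (\<open>antipode_exists\<close>).

  The undecorated bialgebras need no separate verification.  The forgetful map is surjective and
  compatible with all structure maps, so the axioms pass to its image
  (\<open>bialgebra_morphismI_surj\<close>); and it is split by constant decorations, which commute with \<open>\<Delta>\<close>, so the
  antipode descends as well (\<open>antipode_retract\<close>).  Compatibility with antipodes holds for every
  bialgebra morphism (\<open>bialgebra_morphism_antipode\<close>).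
\<close>

section \<open>Linear algebra on free rational vector spaces\<close>

lemma lookup_qscale [simp]: "Poly_Mapping.lookup (qscale c x) b = c * Poly_Mapping.lookup x b"
  unfolding qscale_def by (simp add: map.rep_eq when_def)

lemma qscale_simps [simp]:
  "qscale c (x + y) = qscale c x + qscale c y"
  "qscale (c + d) x = qscale c x + qscale d x"
  "qscale c (qscale d x) = qscale (c * d) x"
  "qscale 1 x = x"
  "qscale 0 x = 0"
  "qscale c 0 = 0"
  by (rule poly_mapping_eqI; simp add: lookup_add algebra_simps)+

lemma vector_space_qscale: "vector_space qscale"
  by unfold_locales simp_all

lemma qlinear_iff:
  "qlinear f \<longleftrightarrow> (\<forall>x y. f (x + y) = f x + f y) \<and> (\<forall>c x. f (qscale c x) = qscale c (f x))"
  by (simp add: Vector_Spaces.linear_iff vector_space_qscale)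

lemma qlinear_form_iff:
  "qlinear_form f \<longleftrightarrow> (\<forall>x y. f (x + y) = f x + f y) \<and> (\<forall>c x. f (qscale c x) = c * f x)"
proof -
  have "vector_space ((*) :: rat \<Rightarrow> rat \<Rightarrow> rat)"
    by unfold_locales (simp_all add: algebra_simps)
  then show ?thesis by (simp add: Vector_Spaces.linear_iff vector_space_qscale)
qed

lemma qlinear_simps:
  assumes "qlinear f"
  shows qlinear_add: "f (x + y) = f x + f y"
    and qlinear_scale: "f (qscale c x) = qscale c (f x)"
    and qlinear_zero: "f 0 = 0"
    and qlinear_sum: "f (sum g A) = (\<Sum>a\<in>A. f (g a))"
proof -
  show add: "f (x + y) = f x + f y" for x y using assms by (simp add: qlinear_iff)
  show scale: "f (qscale c x) = qscale c (f x)" for c x using assms by (simp add: qlinear_iff)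
  show zero: "f 0 = 0" using scale[of 0 0] by simp
  show "f (sum g A) = (\<Sum>a\<in>A. f (g a))"
    by (induct A rule: infinite_finite_induct) (simp_all add: zero add)
qed

lemma qlinear_form_simps:
  assumes "qlinear_form f"
  shows qlinear_form_add: "f (x + y) = f x + f y"
    and qlinear_form_scale: "f (qscale c x) = c * f x"
  using assms by (simp_all add: qlinear_form_iff)

lemma qlinear_id [simp]: "qlinear id" "qlinear (\<lambda>x. x)"
  by (simp_all add: qlinear_iff)

lemma qscale_basis_vec: "qscale c (basis_vec b) = Poly_Mapping.single b c"
  by (rule poly_mapping_eqI) (simp add: lookup_single when_def)

text \<open>
  Multilinear identities follow from their instances on basis vectors: this rule is applied once per
  argument, and the two closure steps are discharged by linearity.
\<close>

lemma qvec_induct [case_names basis add scale]: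
  assumes basis: "\<And>b. P (basis_vec b)"
    and add: "\<And>x y. P x \<Longrightarrow> P y \<Longrightarrow> P (x + y)"
    and scale: "\<And>c x. P x \<Longrightarrow> P (qscale c x)"
  shows "P x"
proof -
  have zero: "P 0" using scale[OF basis, of 0] by simp
  have "P (\<Sum>b\<in>A. qscale (Poly_Mapping.lookup x b) (basis_vec b))" for A
    by (induct A rule: infinite_finite_induct) (simp_all add: zero add scale basis)
  moreover have "x = (\<Sum>b\<in>Poly_Mapping.keys x. qscale (Poly_Mapping.lookup x b) (basis_vec b))"
    by (rule poly_mapping_eqI)
      (auto simp: lookup_sum lookup_single when_def in_keys_iff if_distrib cong: if_cong)
  ultimately show ?thesis by metis
qed

text \<open>
  The supports of \<open>x\<close>, \<open>y\<close> and \<open>x + y\<close> differ; additivity is read off from sums over a common finite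
  superset.
\<close>

lemma lin_ext_superset:
  assumes "finite A" "Poly_Mapping.keys x \<subseteq> A"
  shows "lin_ext f x = (\<Sum>b\<in>A. qscale (Poly_Mapping.lookup x b) (f b))"
  unfolding lin_ext_def
  by (rule sum.mono_neutral_left) (use assms in \<open>auto simp: in_keys_iff\<close>)

lemma lin_ext_form_superset:
  assumes "finite A" "Poly_Mapping.keys x \<subseteq> A"
  shows "lin_ext_form f x = (\<Sum>b\<in>A. Poly_Mapping.lookup x b * f b)"
  unfolding lin_ext_form_def
  by (rule sum.mono_neutral_left) (use assms in \<open>auto simp: in_keys_iff\<close>)

lemma qscale_sum: "qscale c (sum f A) = (\<Sum>a\<in>A. qscale c (f a))"
  by (induct A rule: infinite_finite_induct) simp_all

lemma keys_qscale: "Poly_Mapping.keys (qscale c x) \<subseteq> Poly_Mapping.keys x"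
  by (auto simp: in_keys_iff)

lemma qlinear_lin_ext [simp]: "qlinear (lin_ext f)"
  unfolding qlinear_iff
proof (intro conjI allI)
  fix x y :: "'a qvec"
  show "lin_ext f (x + y) = lin_ext f x + lin_ext f y"
    by (subst (1 2 3) lin_ext_superset[where A = "Poly_Mapping.keys x \<union> Poly_Mapping.keys y"])
      (simp_all add: Poly_Mapping.keys_add lookup_add sum.distrib)
next
  fix c and x :: "'a qvec"
  show "lin_ext f (qscale c x) = qscale c (lin_ext f x)"
    by (subst (1 2) lin_ext_superset[where A = "Poly_Mapping.keys x"])
      (simp_all add: keys_qscale qscale_sum)
qed

lemma qlinear_form_lin_ext_form [simp]: "qlinear_form (lin_ext_form f)"
  unfolding qlinear_form_iff
proof (intro conjI allI)
  fix x y :: "'a qvec"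
  show "lin_ext_form f (x + y) = lin_ext_form f x + lin_ext_form f y"
    by (subst (1 2 3) lin_ext_form_superset[where A = "Poly_Mapping.keys x \<union> Poly_Mapping.keys y"])
      (simp_all add: Poly_Mapping.keys_add lookup_add sum.distrib algebra_simps)
next
  fix c and x :: "'a qvec"
  show "lin_ext_form f (qscale c x) = c * lin_ext_form f x"
    by (subst (1 2) lin_ext_form_superset[where A = "Poly_Mapping.keys x"])
      (simp_all add: keys_qscale sum_distrib_left algebra_simps)
qed

lemmas lin_ext_simps [simp] = qlinear_simps[OF qlinear_lin_ext]
lemmas lin_ext_form_simps [simp] = qlinear_form_simps[OF qlinear_form_lin_ext_form]

lemma lin_ext_basis_vec [simp]: "lin_ext f (basis_vec b) = f b"
  by (simp add: lin_ext_def)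

lemma lin_ext_form_basis_vec [simp]: "lin_ext_form f (basis_vec b) = f b"
  by (simp add: lin_ext_form_def)

lemma lookup_tensor:
  "Poly_Mapping.lookup (tensor x y) (b, c) = Poly_Mapping.lookup x b * Poly_Mapping.lookup y c"
proof -
  have "Poly_Mapping.lookup (tensor x y) (b, c) =
    (\<Sum>b'\<in>Poly_Mapping.keys x. \<Sum>c'\<in>Poly_Mapping.keys y.
       if b' = b \<and> c' = c then Poly_Mapping.lookup x b' * Poly_Mapping.lookup y c' else 0)"
    unfolding tensor_def by (simp add: lookup_sum lookup_single when_def)
  also have "\<dots> = (\<Sum>b'\<in>Poly_Mapping.keys x. if b' = b then
       (\<Sum>c'\<in>Poly_Mapping.keys y. if c' = c then Poly_Mapping.lookup x b' * Poly_Mapping.lookup y c' else 0)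
       else 0)"
    by (rule sum.cong) (auto intro!: sum.cong sum.neutral)
  also have "\<dots> = Poly_Mapping.lookup x b * Poly_Mapping.lookup y c"
    by (auto simp: sum.delta in_keys_iff)
  finally show ?thesis .
qed

lemma tensor_simps [simp]:
  "tensor (x + x') y = tensor x y + tensor x' y"
  "tensor x (y + y') = tensor x y + tensor x y'"
  "tensor (qscale c x) y = qscale c (tensor x y)"
  "tensor x (qscale c y) = qscale c (tensor x y)"
  "tensor 0 y = 0"
  "tensor x 0 = 0"
  by (rule poly_mapping_eqI; clarsimp simp: lookup_tensor lookup_add algebra_simps)+

lemma tensor_sum_left [simp]: "tensor (sum f A) y = (\<Sum>a\<in>A. tensor (f a) y)"
  by (induct A rule: infinite_finite_induct) simp_all

lemma tensor_sum_right [simp]: "tensor x (sum f A) = (\<Sum>a\<in>A. tensor x (f a))"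
  by (induct A rule: infinite_finite_induct) simp_all

lemma tensor_basis_vec [simp]: "tensor (basis_vec a) (basis_vec b) = basis_vec (a, b)"
  by (rule poly_mapping_eqI) (auto simp: lookup_tensor lookup_single when_def split: if_splits)

lemma qlinear_tensor_map [simp]: "qlinear (tensor_map f g)"
  by (simp add: tensor_map_def)

lemmas tensor_map_simps [simp] = qlinear_simps[OF qlinear_tensor_map]

lemma tensor_map_basis_vec [simp]:
  "tensor_map f g (basis_vec (a, b)) = tensor (f (basis_vec a)) (g (basis_vec b))"
  by (simp add: tensor_map_def)

lemma tensor_map_tensor:
  assumes "qlinear f" "qlinear g"
  shows "tensor_map f g (tensor x y) = tensor (f x) (g y)"
proof (induct x rule: qvec_induct)
  case (basis a)
  show ?case
    by (induct y rule: qvec_induct) (simp_all add: qlinear_simps[OF assms(2)])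
qed (simp_all add: qlinear_simps[OF assms(1)])

lemma qvec_prod_induct [case_names basis add scale]:
  assumes "\<And>a b. P (basis_vec (a, b))"
    and "\<And>x y. P x \<Longrightarrow> P y \<Longrightarrow> P (x + y)"
    and "\<And>c x. P x \<Longrightarrow> P (qscale c x)"
  shows "P x"
  by (rule qvec_induct) (use assms in auto)

lemma tensor_map_compose:
  assumes "qlinear f" "qlinear g"
  shows "tensor_map f g (tensor_map h k x) = tensor_map (\<lambda>x. f (h x)) (\<lambda>x. g (k x)) x"
  by (induct x rule: qvec_prod_induct) (simp_all add: tensor_map_tensor assms)

lemma qlinear_form_left [simp]: "qlinear (form_left e)"
  and qlinear_form_right [simp]: "qlinear (form_right e)"
  and qlinear_tensor_assoc [simp]: "qlinear tensor_assoc"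
  and qlinear_tensor_mult [simp]: "qlinear (tensor_mult m)"
  and qlinear_m_1_3_24 [simp]: "qlinear (m_1_3_24 m)"
  by (simp_all add: form_left_def form_right_def tensor_assoc_def tensor_mult_def m_1_3_24_def)

lemmas structure_map_simps [simp] =
  qlinear_simps[OF qlinear_form_left] qlinear_simps[OF qlinear_form_right]
  qlinear_simps[OF qlinear_tensor_assoc] qlinear_simps[OF qlinear_tensor_mult]
  qlinear_simps[OF qlinear_m_1_3_24]

lemma form_left_basis_vec [simp]:
  "form_left e (basis_vec (a, b)) = qscale (e (basis_vec a)) (basis_vec b)"
  by (simp add: form_left_def)

lemma form_right_basis_vec [simp]:
  "form_right e (basis_vec (a, b)) = qscale (e (basis_vec b)) (basis_vec a)"
  by (simp add: form_right_def)

lemma tensor_assoc_basis_vec [simp]: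
  "tensor_assoc (basis_vec ((a, b), c)) = basis_vec (a, (b, c))"
  by (simp add: tensor_assoc_def)

lemma tensor_mult_basis_vec [simp]:
  "tensor_mult m (basis_vec ((a, b), (a', b'))) =
     tensor (m (basis_vec (a, a'))) (m (basis_vec (b, b')))"
  by (simp add: tensor_mult_def)

lemma m_1_3_24_basis_vec [simp]:
  "m_1_3_24 m (basis_vec ((a, b), (a', b'))) =
     tensor (basis_vec (a, a')) (m (basis_vec (b, b')))"
  by (simp add: m_1_3_24_def)

lemma form_left_tensor:
  assumes "qlinear_form e"
  shows "form_left e (tensor x y) = qscale (e x) y"
proof (induct x rule: qvec_induct)
  case (basis a)
  show ?case by (induct y rule: qvec_induct) (simp_all add: mult.commute)
qed (simp_all add: qlinear_form_simps[OF assms])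

lemma form_right_tensor:
  assumes "qlinear_form e"
  shows "form_right e (tensor x y) = qscale (e y) x"
proof (induct x rule: qvec_induct)
  case (basis a)
  show ?case
    by (induct y rule: qvec_induct) (simp_all add: qlinear_form_simps[OF assms])
qed (simp_all add: mult.commute)

lemma tensor_assoc_tensor: "tensor_assoc (tensor (tensor x y) z) = tensor x (tensor y z)"
proof (induct x rule: qvec_induct)
  case (basis a)
  show ?case
  proof (induct y rule: qvec_induct)
    case (basis b)
    show ?case by (induct z rule: qvec_induct) simp_all
  qed simp_all
qed simp_all

lemma tensor_mult_tensor:
  assumes "qlinear m"
  shows "tensor_mult m (tensor (tensor a b) (tensor a' b')) =
    tensor (m (tensor a a')) (m (tensor b b'))"
proof (induct a rule: qvec_induct)
  case (basis a)
  show ?case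
  proof (induct b rule: qvec_induct)
    case (basis b)
    show ?case
    proof (induct a' rule: qvec_induct)
      case (basis a')
      show ?case by (induct b' rule: qvec_induct) (simp_all add: qlinear_simps[OF assms])
    qed (simp_all add: qlinear_simps[OF assms])
  qed (simp_all add: qlinear_simps[OF assms])
qed (simp_all add: qlinear_simps[OF assms])

section \<open>Bialgebras and antipodes\<close>

text \<open>All axioms are multilinear, so it is enough to verify them on basis vectors.\<close>

lemma bialgebraI_basis:
  assumes m: "qlinear m" and \<Delta>: "qlinear \<Delta>" and e: "qlinear_form e"
    and assoc: "\<And>a b c. m (tensor (m (basis_vec (a, b))) (basis_vec c)) =
                        m (tensor (basis_vec a) (m (basis_vec (b, c))))"
    and unit: "\<And>a. m (tensor u (basis_vec a)) = basis_vec a"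
              "\<And>a. m (tensor (basis_vec a) u) = basis_vec a"
    and coassoc: "\<And>a. tensor_assoc (tensor_map \<Delta> id (\<Delta> (basis_vec a))) =
                       tensor_map id \<Delta> (\<Delta> (basis_vec a))"
    and counit: "\<And>a. form_left e (\<Delta> (basis_vec a)) = basis_vec a"
                "\<And>a. form_right e (\<Delta> (basis_vec a)) = basis_vec a"
    and \<Delta>_unit: "\<Delta> u = tensor u u"
    and \<Delta>_mult: "\<And>a b. \<Delta> (m (basis_vec (a, b))) =
                        tensor_mult m (tensor (\<Delta> (basis_vec a)) (\<Delta> (basis_vec b)))"
    and e_unit: "e u = 1"
    and e_mult: "\<And>a b. e (m (basis_vec (a, b))) = e (basis_vec a) * e (basis_vec b)"
  shows "bialgebra u m \<Delta> e"
proof -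
  note lin = qlinear_simps[OF m] qlinear_simps[OF \<Delta>] qlinear_form_simps[OF e]
  have "m (tensor (m (tensor x y)) z) = m (tensor x (m (tensor y z)))" for x y z
  proof (induct x rule: qvec_induct)
    case (basis a)
    show ?case
    proof (induct y rule: qvec_induct)
      case (basis b)
      show ?case by (induct z rule: qvec_induct) (simp_all add: lin assoc)
    qed (simp_all add: lin)
  qed (simp_all add: lin)
  moreover have "m (tensor u x) = x" "m (tensor x u) = x" for x
    by (induct x rule: qvec_induct) (simp_all add: lin unit)
  moreover have "tensor_assoc (tensor_map \<Delta> id (\<Delta> x)) = tensor_map id \<Delta> (\<Delta> x)" for x
    by (induct x rule: qvec_induct) (simp_all add: lin coassoc[unfolded id_def] id_def)
  moreover have "form_left e (\<Delta> x) = x" "form_right e (\<Delta> x) = x" for x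
    by (induct x rule: qvec_induct) (simp_all add: lin counit)
  moreover have "\<Delta> (m (tensor x y)) = tensor_mult m (tensor (\<Delta> x) (\<Delta> y))" for x y
  proof (induct x rule: qvec_induct)
    case (basis a)
    show ?case by (induct y rule: qvec_induct) (simp_all add: lin \<Delta>_mult)
  qed (simp_all add: lin)
  moreover have "e (m (tensor x y)) = e x * e y" for x y
  proof (induct x rule: qvec_induct)
    case (basis a)
    show ?case by (induct y rule: qvec_induct) (simp_all add: lin e_mult algebra_simps)
  qed (simp_all add: lin algebra_simps)
  ultimately show ?thesis
    by (simp add: bialgebra_def algebra_def coalgebra_def m \<Delta> e \<Delta>_unit e_unit)
qed

text \<open>
  The axioms are identities, and identities pass to the image of a surjection that is compatible
  with the structure maps.
\<close>

lemma bialgebra_morphismI_surj: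
  assumes B: "bialgebra u m \<Delta> e"
    and f: "qlinear f" "surj f"
    and lin: "qlinear m'" "qlinear \<Delta>'" "qlinear_form e'"
    and u: "f u = u'"
    and m: "\<And>x y. f (m (tensor x y)) = m' (tensor (f x) (f y))"
    and \<Delta>: "\<And>x. \<Delta>' (f x) = tensor_map f f (\<Delta> x)"
    and e: "\<And>x. e' (f x) = e x"
  shows "bialgebra_morphism u m \<Delta> e u' m' \<Delta>' e' f"
proof -
  have linm: "qlinear m" and lin\<Delta>: "qlinear \<Delta>" and line: "qlinear_form e"
    and assoc: "\<And>x y z. m (tensor (m (tensor x y)) z) = m (tensor x (m (tensor y z)))"
    and unit: "\<And>x. m (tensor u x) = x" "\<And>x. m (tensor x u) = x"
    and coassoc: "\<And>x. tensor_assoc (tensor_map \<Delta> id (\<Delta> x)) = tensor_map id \<Delta> (\<Delta> x)"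
    and counit: "\<And>x. form_left e (\<Delta> x) = x" "\<And>x. form_right e (\<Delta> x) = x"
    and \<Delta>_unit: "\<Delta> u = tensor u u"
    and \<Delta>_mult: "\<And>x y. \<Delta> (m (tensor x y)) = tensor_mult m (tensor (\<Delta> x) (\<Delta> y))"
    and e_unit: "e u = 1" and e_mult: "\<And>x y. e (m (tensor x y)) = e x * e y"
    using B by (auto simp: bialgebra_def algebra_def coalgebra_def)
  note ls = qlinear_simps[OF f(1)] qlinear_simps[OF lin(1)] qlinear_simps[OF lin(2)]
    qlinear_form_simps[OF lin(3)]
  have f': "\<exists>x. y = f x" for y using f(2) by (auto simp: surj_def)
  have "m' (tensor (m' (tensor x y)) z) = m' (tensor x (m' (tensor y z)))" for x y z
    using f'[of x] f'[of y] f'[of z] assoc by (metis m)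
  moreover have "m' (tensor u' x) = x" "m' (tensor x u') = x" for x
    using f'[of x] unit by (metis m u)+
  moreover have "tensor_assoc (tensor_map \<Delta>' id (\<Delta>' y)) = tensor_map id \<Delta>' (\<Delta>' y)" for y
  proof -
    obtain x where y: "y = f x" using f' by blast
    have "tensor_assoc (tensor_map \<Delta>' id (\<Delta>' y)) =
        tensor_assoc (tensor_map (\<lambda>x. \<Delta>' (f x)) f (\<Delta> x))"
      unfolding y \<Delta> by (subst tensor_map_compose) (simp_all add: lin qlinear_iff \<Delta> ls)
    also have "\<dots> = tensor_assoc (tensor_map (tensor_map f f) f (tensor_map \<Delta> id (\<Delta> x)))"
      unfolding \<Delta> by (subst tensor_map_compose) (simp_all add: f)
    also have "\<dots> = tensor_map f (tensor_map f f) (tensor_assoc (tensor_map \<Delta> id (\<Delta> x)))"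
    proof (rule qvec_induct[where P = "\<lambda>z. tensor_assoc (tensor_map (tensor_map f f) f z) =
          tensor_map f (tensor_map f f) (tensor_assoc z)"])
      fix b :: "('a \<times> 'a) \<times> 'a"
      show "tensor_assoc (tensor_map (tensor_map f f) f (basis_vec b)) =
          tensor_map f (tensor_map f f) (tensor_assoc (basis_vec b))"
        by (cases b; cases "fst b") (simp add: tensor_assoc_tensor)
    qed simp_all
    also have "\<dots> = tensor_map f (\<lambda>x. \<Delta>' (f x)) (\<Delta> x)"
      unfolding coassoc \<Delta> by (subst tensor_map_compose) (simp_all add: f)
    also have "\<dots> = tensor_map id \<Delta>' (\<Delta>' y)"
      unfolding y \<Delta> by (subst tensor_map_compose) (simp_all add: lin qlinear_iff \<Delta> ls)
    finally show ?thesis .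
  qed
  moreover have "form_left e' (\<Delta>' y) = y" "form_right e' (\<Delta>' y) = y" for y
  proof -
    obtain x where y: "y = f x" using f' by blast
    have "form_left e' (tensor_map f f z) = f (form_left e z)"
      "form_right e' (tensor_map f f z) = f (form_right e z)" for z
      by (induct z rule: qvec_prod_induct)
        (simp_all add: form_left_tensor form_right_tensor lin e ls)
    then show "form_left e' (\<Delta>' y) = y" "form_right e' (\<Delta>' y) = y"
      by (simp_all add: y \<Delta> counit)
  qed
  moreover have "\<Delta>' u' = tensor u' u'"
    by (simp add: u[symmetric] \<Delta> \<Delta>_unit tensor_map_tensor f)
  moreover have "\<Delta>' (m' (tensor x' y')) = tensor_mult m' (tensor (\<Delta>' x') (\<Delta>' y'))" for x' y'
  proof -
    obtain x y where xy: "x' = f x" "y' = f y" using f' by metis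
    have *: "tensor_map f f (tensor_mult m (tensor v w)) =
        tensor_mult m' (tensor (tensor_map f f v) (tensor_map f f w))" for v w
    proof (induct v rule: qvec_prod_induct)
      case (basis a b)
      show ?case
      proof (induct w rule: qvec_prod_induct)
        case (basis a' b')
        have "tensor_map f f (tensor_mult m (tensor (basis_vec (a, b)) (basis_vec (a', b')))) =
            tensor (f (m (tensor (basis_vec a) (basis_vec a'))))
              (f (m (tensor (basis_vec b) (basis_vec b'))))"
          by (simp add: tensor_map_tensor f)
        then show ?case by (simp only: m tensor_map_basis_vec tensor_mult_tensor[OF lin(1)])
      qed simp_all
    qed simp_all
    show ?thesis by (simp add: xy m[symmetric] \<Delta> \<Delta>_mult *)
  qed
  moreover have "e' u' = 1" by (simp add: u[symmetric] e e_unit)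
  moreover have "e' (m' (tensor x y)) = e' x * e' y" for x y
    using f'[of x] f'[of y] e_mult by (metis m e)
  ultimately have "bialgebra u' m' \<Delta>' e'"
    by (simp add: bialgebra_def algebra_def coalgebra_def lin)
  with B show ?thesis by (simp add: bialgebra_morphism_def f u m \<Delta> e)
qed

text \<open>The convolution product of linear maps, whose neutral element is \<open>\<lambda>x. qscale (e x) u\<close>.\<close>

definition conv ::
  "(('c \<times> 'c) qvec \<Rightarrow> 'c qvec) \<Rightarrow> ('b qvec \<Rightarrow> ('b \<times> 'b) qvec) \<Rightarrow>
   ('b qvec \<Rightarrow> 'c qvec) \<Rightarrow> ('b qvec \<Rightarrow> 'c qvec) \<Rightarrow> 'b qvec \<Rightarrow> 'c qvec" where
  "conv m \<Delta> f g x = m (tensor_map f g (\<Delta> x))"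

lemma conv_assoc:
  assumes A: "algebra u m" and C: "coalgebra \<Delta> e"
    and lin: "qlinear f" "qlinear g" "qlinear h"
  shows "conv m \<Delta> (conv m \<Delta> f g) h x = conv m \<Delta> f (conv m \<Delta> g h) x"
proof -
  have m: "qlinear m" and \<Delta>: "qlinear \<Delta>"
    and assoc: "\<And>x y z. m (tensor (m (tensor x y)) z) = m (tensor x (m (tensor y z)))"
    and coassoc: "\<And>x. tensor_assoc (tensor_map \<Delta> id (\<Delta> x)) = tensor_map id \<Delta> (\<Delta> x)"
    using A C by (auto simp: algebra_def coalgebra_def)
  have conv_lin: "qlinear (\<lambda>x. m (tensor_map f g x))" for f g
    by (simp add: qlinear_iff qlinear_simps[OF m])
  have "conv m \<Delta> (conv m \<Delta> f g) h x =
      m (tensor_map (\<lambda>x. m (tensor_map f g x)) h (tensor_map \<Delta> id (\<Delta> x)))"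
    by (subst tensor_map_compose) (simp_all add: conv_lin lin conv_def[abs_def])
  also have "\<dots> = m (tensor_map f (\<lambda>x. m (tensor_map g h x))
      (tensor_assoc (tensor_map \<Delta> id (\<Delta> x))))"
  proof (rule qvec_induct[where P = "\<lambda>z. m (tensor_map (\<lambda>x. m (tensor_map f g x)) h z) =
        m (tensor_map f (\<lambda>x. m (tensor_map g h x)) (tensor_assoc z))"])
    fix b :: "('b \<times> 'b) \<times> 'b"
    obtain b1 b2 b3 where "b = ((b1, b2), b3)" by (metis prod.collapse)
    then show "m (tensor_map (\<lambda>x. m (tensor_map f g x)) h (basis_vec b)) =
        m (tensor_map f (\<lambda>x. m (tensor_map g h x)) (tensor_assoc (basis_vec b)))"
      by (simp add: assoc)
  qed (simp_all add: qlinear_simps[OF m])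
  also have "\<dots> = conv m \<Delta> f (conv m \<Delta> g h) x"
    unfolding coassoc
    by (subst tensor_map_compose) (simp_all add: conv_lin lin conv_def[abs_def])
  finally show ?thesis .
qed

lemma conv_unit:
  assumes A: "algebra u m" and C: "coalgebra \<Delta> e" and f: "qlinear f"
  shows "conv m \<Delta> (\<lambda>x. qscale (e x) u) f x = f x"
    and "conv m \<Delta> f (\<lambda>x. qscale (e x) u) x = f x"
proof -
  have m: "qlinear m" and unit: "\<And>x. m (tensor u x) = x" "\<And>x. m (tensor x u) = x"
    and counit: "\<And>x. form_left e (\<Delta> x) = x" "\<And>x. form_right e (\<Delta> x) = x"
    using A C by (auto simp: algebra_def coalgebra_def)
  note l = qlinear_simps[OF m] qlinear_simps[OF f]
  have "m (tensor_map (\<lambda>x. qscale (e x) u) f z) = f (form_left e z)"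
    "m (tensor_map f (\<lambda>x. qscale (e x) u) z) = f (form_right e z)" for z
    by (induct z rule: qvec_prod_induct) (simp_all add: l unit)
  then show "conv m \<Delta> (\<lambda>x. qscale (e x) u) f x = f x"
    "conv m \<Delta> f (\<lambda>x. qscale (e x) u) x = f x"
    by (simp_all add: conv_def counit)
qed

text \<open>
  Both \<open>f \<circ> S\<close> and \<open>S' \<circ> f\<close> are convolution inverses of \<open>f\<close>, and inverses in a monoid are unique.
\<close>

lemma bialgebra_morphism_antipode:
  assumes F: "bialgebra_morphism u m \<Delta> e u' m' \<Delta>' e' f"
    and S: "antipode u m \<Delta> e S" and S': "antipode u' m' \<Delta>' e' S'"
  shows "f \<circ> S = S' \<circ> f"
proof
  fix x
  have C: "coalgebra \<Delta> e" and A': "algebra u' m'" and f: "qlinear f" and fu: "f u = u'"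
    and fm: "\<And>x y. f (m (tensor x y)) = m' (tensor (f x) (f y))"
    and f\<Delta>: "\<And>x. \<Delta>' (f x) = tensor_map f f (\<Delta> x)" and fe: "\<And>x. e' (f x) = e x"
    using F by (auto simp: bialgebra_morphism_def bialgebra_def)
  have m: "qlinear m" using F by (simp add: bialgebra_morphism_def bialgebra_def algebra_def)
  have m': "qlinear m'" using A' by (simp add: algebra_def)
  have Sl: "qlinear S" "\<And>x. m (tensor_map S id (\<Delta> x)) = qscale (e x) u"
    and S'l: "qlinear S'" "\<And>x. m' (tensor_map id S' (\<Delta>' x)) = qscale (e' x) u'"
    using S S' by (auto simp: antipode_def)
  note l = qlinear_simps[OF f] qlinear_simps[OF m] qlinear_simps[OF m']
    qlinear_simps[OF Sl(1)] qlinear_simps[OF S'l(1)]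
  have lin: "qlinear (\<lambda>x. f (S x))" "qlinear (\<lambda>x. S' (f x))" by (simp_all add: qlinear_iff l)
  have left: "conv m' \<Delta> (\<lambda>x. f (S x)) f = (\<lambda>x. qscale (e x) u')"
  proof
    fix x
    have "f (m (tensor_map S id z)) = m' (tensor_map (\<lambda>x. f (S x)) f z)" for z
      by (induct z rule: qvec_prod_induct) (simp_all add: l fm)
    from this[symmetric] show "conv m' \<Delta> (\<lambda>x. f (S x)) f x = qscale (e x) u'"
      by (simp add: conv_def Sl l fu)
  qed
  have right: "conv m' \<Delta> f (\<lambda>x. S' (f x)) = (\<lambda>x. qscale (e x) u')"
  proof
    fix x
    have "tensor_map f (\<lambda>x. S' (f x)) (\<Delta> x) = tensor_map id S' (\<Delta>' (f x))"
      unfolding f\<Delta> by (subst tensor_map_compose) (simp_all add: S'l)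
    then show "conv m' \<Delta> f (\<lambda>x. S' (f x)) x = qscale (e x) u'"
      by (simp add: conv_def S'l fe)
  qed
  have "f (S x) = conv m' \<Delta> (\<lambda>x. f (S x)) (conv m' \<Delta> f (\<lambda>x. S' (f x))) x"
    by (simp add: right conv_unit[OF A' C lin(1)])
  also have "\<dots> = conv m' \<Delta> (conv m' \<Delta> (\<lambda>x. f (S x)) f) (\<lambda>x. S' (f x)) x"
    by (simp add: conv_assoc[OF A' C lin(1) f lin(2)])
  also have "\<dots> = S' (f x)"
    by (simp add: left conv_unit[OF A' C lin(2)])
  finally show "(f \<circ> S) x = (S' \<circ> f) x" by simp
qed

text \<open>
  Since \<open>s\<close> commutes with the coproducts and \<open>f \<circ> s = id\<close>, applying \<open>f\<close> to the antipode identity of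
  \<open>S\<close> at \<open>s x\<close> gives the antipode identity of \<open>f \<circ> S \<circ> s\<close> at \<open>x\<close>.
\<close>

lemma antipode_retract:
  assumes F: "bialgebra_morphism u m \<Delta> e u' m' \<Delta>' e' f" and S: "antipode u m \<Delta> e S"
    and s: "qlinear s" and fs: "\<And>x. f (s x) = x"
    and s\<Delta>: "\<And>x. \<Delta> (s x) = tensor_map s s (\<Delta>' x)"
  shows "antipode u' m' \<Delta>' e' (\<lambda>x. f (S (s x)))"
proof -
  have f: "qlinear f" and fu: "f u = u'" and m: "qlinear m" and m': "qlinear m'"
    and fm: "\<And>x y. f (m (tensor x y)) = m' (tensor (f x) (f y))" and fe: "\<And>x. e' (f x) = e x"
    using F by (auto simp: bialgebra_morphism_def bialgebra_def algebra_def)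
  have Sl: "qlinear S" "\<And>x. m (tensor_map S id (\<Delta> x)) = qscale (e x) u"
      "\<And>x. m (tensor_map id S (\<Delta> x)) = qscale (e x) u"
    using S by (auto simp: antipode_def)
  note l = qlinear_simps[OF f] qlinear_simps[OF m] qlinear_simps[OF m'] qlinear_simps[OF Sl(1)]
    qlinear_simps[OF s]
  have es: "e (s x) = e' x" for x by (simp add: fe[symmetric] fs)
  have "m' (tensor_map (\<lambda>x. f (S (s x))) id z) = f (m (tensor_map S id (tensor_map s s z)))"
    "m' (tensor_map id (\<lambda>x. f (S (s x))) z) = f (m (tensor_map id S (tensor_map s s z)))" for z
    by (induct z rule: qvec_prod_induct) (simp_all add: l tensor_map_tensor Sl(1) qlinear_iff fm fs)
  then show ?thesis
    by (simp add: antipode_def qlinear_iff l s\<Delta>[symmetric] Sl es fu)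
qed

text \<open>
  In \<open>\<Delta> b = b \<otimes> 1 + \<Sum> l b i \<otimes> r b i\<close> with all \<open>l b i\<close> smaller than \<open>b\<close>, the equation
  \<open>S \<star> id = 1 \<epsilon>\<close> determines \<open>S b\<close> from the values of \<open>S\<close> at smaller basis elements.  This gives a
  left convolution inverse of the identity; commutativity and cocommutativity make it two-sided.
\<close>

lemma antipode_exists:
  fixes N :: "'b \<Rightarrow> nat"
  assumes A: "algebra u m" and C: "coalgebra \<Delta> e"
    and comm: "\<And>a b. m (basis_vec (a, b)) = m (basis_vec (b, a))"
    and cocomm: "\<And>b. lin_ext (\<lambda>(a, b). basis_vec (b, a)) (\<Delta> (basis_vec b)) = \<Delta> (basis_vec b)"
    and \<Delta>: "\<And>b. \<Delta> (basis_vec b) =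
              tensor (basis_vec b) u + (\<Sum>i\<in>I b. basis_vec (l b i, r b i))"
    and smaller: "\<And>b i. i \<in> I b \<Longrightarrow> N (l b i) < N b"
  shows "\<exists>S. antipode u m \<Delta> e S"
proof -
  have m: "qlinear m" and unit: "\<And>x. m (tensor u x) = x" "\<And>x. m (tensor x u) = x"
    and lin\<Delta>: "qlinear \<Delta>" and e: "qlinear_form e"
    using A C by (auto simp: algebra_def coalgebra_def)
  note ls = qlinear_simps[OF m] qlinear_simps[OF lin\<Delta>] qlinear_form_simps[OF e]
  let ?F = "\<lambda>S b. qscale (e (basis_vec b)) u - (\<Sum>i\<in>I b. m (tensor (S (l b i)) (basis_vec (r b i))))"
  define S0 where "S0 = wfrec (measure N) ?F"
  have S0: "S0 b = ?F S0 b" for b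
  proof -
    have "S0 b = ?F (Wfrec.cut S0 (measure N) b) b"
      unfolding S0_def by (rule wfrec) simp
    \<comment> \<open>The recursion calls \<open>S\<close> at smaller elements only, where the restricted function agrees with it.\<close>
    also have "\<dots> = ?F S0 b" using smaller by (simp add: cut_apply)
    finally show ?thesis .
  qed
  define S where "S = lin_ext S0"
  have S: "qlinear S" by (simp add: S_def)
  have S_basis: "S (basis_vec b) = S0 b" for b by (simp add: S_def)
  have fin: "m (tensor_map S id (\<Delta> (basis_vec b))) = qscale (e (basis_vec b)) u" for b
  proof -
    have "m (tensor_map S id (\<Delta> (basis_vec b))) =
        S0 b + (\<Sum>i\<in>I b. m (tensor (S0 (l b i)) (basis_vec (r b i))))"
      unfolding \<Delta> by (simp add: tensor_map_tensor[OF S qlinear_id(1)] qlinear_add[OF m]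
          qlinear_sum[OF m] unit S_basis)
    then show ?thesis by (subst (asm) S0) simp
  qed
  have left: "m (tensor_map S id (\<Delta> x)) = qscale (e x) u" for x
    by (induct x rule: qvec_induct) (simp_all add: ls fin[unfolded id_def] id_def)
  have comm': "m (tensor x y) = m (tensor y x)" for x y
  proof (induct x rule: qvec_induct)
    case (basis a)
    show ?case by (induct y rule: qvec_induct) (simp_all add: ls, rule comm)
  qed (simp_all add: ls)
  have twist: "m (tensor_map id S z) =
      m (tensor_map S id (lin_ext (\<lambda>(a, b). basis_vec (b, a)) z))" for z
    by (induct z rule: qvec_prod_induct) (simp_all add: ls comm')
  have "lin_ext (\<lambda>(a, b). basis_vec (b, a)) (\<Delta> x) = \<Delta> x" for x
    by (induct x rule: qvec_induct) (simp_all add: ls cocomm)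
  then have "m (tensor_map id S (\<Delta> x)) = qscale (e x) u" for x
    by (simp add: twist left)
  with left S show ?thesis unfolding antipode_def by blast
qed

section \<open>Graphs and partitions into connected blocks\<close>

subsection \<open>Graphs determined by adjacency\<close>

lemma edge_cases:
  assumes "finite_graph G" "e \<in> edges G"
  obtains x y where "e = {x, y}" "x \<noteq> y" "x \<in> verts G" "y \<in> verts G"
  using assms unfolding finite_graph_def by (metis card_2_iff insert_subset)

lemma adjacentD:
  assumes "finite_graph G" "{x, y} \<in> edges G"
  shows "x \<noteq> y" "x \<in> verts G" "y \<in> verts G"
  using edge_cases[OF assms] by (auto simp: doubleton_eq_iff)

lemma finite_graphI:
  assumes "finite (verts G)"
    and "\<And>e. e \<in> edges G \<Longrightarrow> \<exists>x y. e = {x, y} \<and> x \<noteq> y \<and> x \<in> verts G \<and> y \<in> verts G"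
  shows "finite_graph G"
  unfolding finite_graph_def
proof (intro conjI ballI)
  fix e assume "e \<in> edges G"
  then obtain x y where "e = {x, y}" "x \<noteq> y" "x \<in> verts G" "y \<in> verts G" using assms(2) by metis
  then show "e \<subseteq> verts G" "card e = 2" by auto
qed (rule assms(1))

lemma finite_verts: "finite_graph G \<Longrightarrow> finite (verts G)"
  by (simp add: finite_graph_def)

text \<open>
  A finite graph is determined by its adjacency relation \<open>{x, y} \<in> edges G\<close>.  Equalities and
  isomorphisms of graphs are established through it, which avoids comparing sets of edges.
\<close>

lemma graph_eqI:
  assumes G: "finite_graph G" and H: "finite_graph H" and "verts G = verts H"
    and adj: "\<And>x y. x \<in> verts G \<Longrightarrow> y \<in> verts G \<Longrightarrow> {x, y} \<in> edges G \<longleftrightarrow> {x, y} \<in> edges H"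
  shows "G = H"
proof -
  have "e \<in> edges G \<longleftrightarrow> e \<in> edges H" for e
    by (metis adj assms(3) edge_cases[OF G] edge_cases[OF H])
  then show ?thesis using assms(3) by (intro graph.equality) auto
qed

lemma verts_simps [simp]:
  "verts (disj_union G H) = verts G <+> verts H"
  "verts (induced G I) = I"
  "verts empty_graph = {}"
  by (simp_all add: disj_union_def induced_def empty_graph_def)

lemma adjacent_disj_union [simp]:
  "{Inl x, Inl x'} \<in> edges (disj_union G H) \<longleftrightarrow> {x, x'} \<in> edges G"
  "{Inr y, Inr y'} \<in> edges (disj_union G H) \<longleftrightarrow> {y, y'} \<in> edges H"
  "{Inl x, Inr y} \<notin> edges (disj_union G H)"
  "{Inr y, Inl x} \<notin> edges (disj_union G H)"
proof -
  have edges: "edges (disj_union G H) = (`) Inl ` edges G \<union> (`) Inr ` edges H"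
    by (simp add: disj_union_def)
  have "Inl ` {x, x'} \<in> (`) Inl ` edges G \<longleftrightarrow> {x, x'} \<in> edges G"
    "Inr ` {y, y'} \<in> (`) Inr ` edges H \<longleftrightarrow> {y, y'} \<in> edges H"
    by (rule inj_image_mem_iff; simp add: inj_def inj_image_eq_iff)+
  moreover have "Inl x \<notin> Inr ` d" "Inr y \<notin> Inl ` e" for e d by blast+
  then have "A \<notin> (`) Inr ` edges H" if "Inl x \<in> A" for A using that by blast
  moreover have "A \<notin> (`) Inl ` edges G" if "Inr y \<in> A" for A using that by blast
  ultimately show "{Inl x, Inl x'} \<in> edges (disj_union G H) \<longleftrightarrow> {x, x'} \<in> edges G"
    "{Inr y, Inr y'} \<in> edges (disj_union G H) \<longleftrightarrow> {y, y'} \<in> edges H"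
    "{Inl x, Inr y} \<notin> edges (disj_union G H)"
    "{Inr y, Inl x} \<notin> edges (disj_union G H)"
    unfolding edges by simp_all
qed

lemma edges_induced: "edges (induced G I) = {e \<in> edges G. e \<subseteq> I}"
  by (simp add: induced_def)

lemma edges_empty_graph [simp]: "edges empty_graph = {}"
  by (simp add: empty_graph_def)

lemma finite_disj_union [simp]:
  assumes "finite_graph G" "finite_graph H"
  shows "finite_graph (disj_union G H)"
  using assms unfolding finite_graph_def
  by (auto simp: disj_union_def card_image)

lemma finite_induced [simp]:
  assumes "finite_graph G" "I \<subseteq> verts G"
  shows "finite_graph (induced G I)"
  using assms by (auto simp: finite_graph_def induced_def intro: finite_subset)

lemma finite_empty_graph [simp]: "finite_graph empty_graph"
  by (simp add: finite_graph_def)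

lemma induced_induced: "J \<subseteq> I \<Longrightarrow> induced (induced G I) J = induced G J"
  by (auto simp: induced_def)

lemma induced_verts: "finite_graph G \<Longrightarrow> induced G (verts G) = G"
  by (auto simp: induced_def finite_graph_def intro!: graph.equality)

lemma induced_empty: "finite_graph G \<Longrightarrow> induced G {} = empty_graph"
  by (auto simp: induced_def finite_graph_def empty_graph_def)

subsection \<open>Connected sets of vertices\<close>

text \<open>
  Connectedness in terms of sets closed under adjacency, instead of paths: in this form it is
  compatible with contraction by mere set algebra.
\<close>

definition connected_in :: "'v set set \<Rightarrow> 'v set \<Rightarrow> bool" where
  "connected_in E c \<longleftrightarrow>
     c \<noteq> {} \<and> (\<forall>S\<subseteq>c. S \<noteq> {} \<longrightarrow> (\<forall>a\<in>S. \<forall>b\<in>c. {a, b} \<in> E \<longrightarrow> b \<in> S) \<longrightarrow> S = c)"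

lemma connected_inD:
  assumes "connected_in E c" "S \<subseteq> c" "S \<noteq> {}" "\<And>a b. a \<in> S \<Longrightarrow> b \<in> c \<Longrightarrow> {a, b} \<in> E \<Longrightarrow> b \<in> S"
  shows "S = c"
  using assms unfolding connected_in_def by metis

lemma connected_graph_induced_iff:
  "connected_graph (induced G c) \<longleftrightarrow> connected_in (edges G) c"
proof
  let ?R = "{(a, b). {a, b} \<in> edges (induced G c)}"
  assume conn: "connected_graph (induced G c)"
  have "S = c" if S: "S \<subseteq> c" "S \<noteq> {}" "\<forall>a\<in>S. \<forall>b\<in>c. {a, b} \<in> edges G \<longrightarrow> b \<in> S" for S
  proof -
    obtain x where "x \<in> S" using S(2) by blast
    have "y \<in> S" if "y \<in> c" for y
    proof -
      have "(x, y) \<in> ?R\<^sup>*" using conn that \<open>x \<in> S\<close> S(1) by (auto simp: connected_graph_def)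
      then show "y \<in> S"
        by induct (use S(3) \<open>x \<in> S\<close> in \<open>auto simp: edges_induced\<close>)
    qed
    with S(1) show ?thesis by blast
  qed
  moreover have "c \<noteq> {}" using conn by (simp add: connected_graph_def)
  ultimately show "connected_in (edges G) c" unfolding connected_in_def by blast
next
  let ?R = "{(a, b). {a, b} \<in> edges (induced G c)}"
  assume conn: "connected_in (edges G) c"
  have "(x, y) \<in> ?R\<^sup>*" if "x \<in> c" "y \<in> c" for x y
  proof -
    have "{y \<in> c. (x, y) \<in> ?R\<^sup>*} = c"
    proof (rule connected_inD[OF conn])
      fix a b assume "a \<in> {y \<in> c. (x, y) \<in> ?R\<^sup>*}" "b \<in> c" "{a, b} \<in> edges G"
      then show "b \<in> {y \<in> c. (x, y) \<in> ?R\<^sup>*}"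
        by (auto simp: edges_induced intro: rtrancl_into_rtrancl)
    qed (use \<open>x \<in> c\<close> in auto)
    with \<open>y \<in> c\<close> show ?thesis by blast
  qed
  then show "connected_graph (induced G c)"
    using conn by (simp add: connected_graph_def connected_in_def)
qed

lemma connected_in_singleton: "connected_in E {x}"
  by (auto simp: connected_in_def)

lemma connected_in_image:
  assumes c: "connected_in E c" and adj: "\<And>x y. x \<in> c \<Longrightarrow> y \<in> c \<Longrightarrow> {f x, f y} \<in> E' \<longleftrightarrow> {x, y} \<in> E"
  shows "connected_in E' (f ` c)"
  unfolding connected_in_def
proof (intro conjI allI impI)
  show "f ` c \<noteq> {}" using c by (auto simp: connected_in_def)
  fix S assume S: "S \<subseteq> f ` c" "S \<noteq> {}" "\<forall>a\<in>S. \<forall>b\<in>f ` c. {a, b} \<in> E' \<longrightarrow> b \<in> S"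
  have "{x \<in> c. f x \<in> S} = c"
    by (rule connected_inD[OF c]) (use S adj in auto)
  with S(1) show "S = f ` c" by blast
qed

lemma connected_in_cong:
  assumes "\<And>x y. x \<in> c \<Longrightarrow> y \<in> c \<Longrightarrow> {x, y} \<in> E \<longleftrightarrow> {x, y} \<in> E'"
  shows "connected_in E c \<longleftrightarrow> connected_in E' c"
  using connected_in_image[of E c "\<lambda>x. x" E'] connected_in_image[of E' c "\<lambda>x. x" E] assms
  by auto

text \<open>The intersection of \<open>c\<close> and \<open>A\<close> is a nonempty subset of \<open>c\<close> closed under adjacency.\<close>

lemma connected_in_subset:
  assumes "connected_in E c" "x \<in> c" "x \<in> A" "\<And>a b. a \<in> A \<Longrightarrow> b \<in> c \<Longrightarrow> {a, b} \<in> E \<Longrightarrow> b \<in> A"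
  shows "c \<subseteq> A"
proof -
  have "c \<inter> A = c" by (rule connected_inD[OF assms(1)]) (use assms in auto)
  then show ?thesis by blast
qed

subsection \<open>Partitions into connected blocks\<close>

text \<open>
  The admissible equivalence relations are handled through their sets of classes, as these are the
  vertices of the contracted graph.
\<close>

definition connected_partitions :: "'v graph \<Rightarrow> 'v set set set" where
  "connected_partitions G =
     {P. partition_on (verts G) P \<and> (\<forall>p\<in>P. connected_in (edges G) p)}"

definition contract_blocks :: "'v graph \<Rightarrow> 'v set set \<Rightarrow> 'v set graph" where
  "contract_blocks G P =
     \<lparr>verts = P,
      edges = {{p, q} | p q. p \<in> P \<and> q \<in> P \<and> p \<noteq> q \<and> (\<exists>x\<in>p. \<exists>y\<in>q. {x, y} \<in> edges G)}\<rparr>"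

definition cut_blocks :: "'v graph \<Rightarrow> 'v set set \<Rightarrow> 'v graph" where
  "cut_blocks G P = \<lparr>verts = verts G, edges = {e \<in> edges G. \<exists>p\<in>P. e \<subseteq> p}\<rparr>"

lemma equiv_rel_iff_quotient:
  assumes "equiv A r"
  shows "(x, y) \<in> r \<longleftrightarrow> (\<exists>p\<in>A // r. x \<in> p \<and> y \<in> p)"
proof
  assume "(x, y) \<in> r"
  then have "x \<in> A" "x \<in> r `` {x}" "y \<in> r `` {x}"
    using assms by (auto elim!: equivE simp: refl_on_def)
  then show "\<exists>p\<in>A // r. x \<in> p \<and> y \<in> p" by (blast intro: quotientI)
qed (use assms in \<open>blast intro: in_quotient_imp_in_rel\<close>)

text \<open>This bijection turns the sum that defines \<open>\<delta>\<close> into one over connected partitions.\<close>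

lemma bij_betw_admissible:
  "bij_betw (\<lambda>r. verts G // r) (admissible G) (connected_partitions G)"
proof (rule bij_betwI')
  fix r r' assume "r \<in> admissible G" "r' \<in> admissible G"
  then have "equiv (verts G) r" "equiv (verts G) r'" by (simp_all add: admissible_def)
  then have "r = {(x, y). \<exists>p\<in>verts G // r. x \<in> p \<and> y \<in> p}"
    "r' = {(x, y). \<exists>p\<in>verts G // r'. x \<in> p \<and> y \<in> p}"
    by (simp_all add: equiv_rel_iff_quotient[symmetric])
  then show "verts G // r = verts G // r' \<longleftrightarrow> r = r'" by metis
next
  fix r assume "r \<in> admissible G"
  then show "verts G // r \<in> connected_partitions G"
    by (simp add: admissible_def connected_partitions_def partition_on_quotient
        connected_graph_induced_iff)
next
  fix P assume "P \<in> connected_partitions G"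
  then have P: "partition_on (verts G) P" "\<forall>p\<in>P. connected_in (edges G) p"
    by (simp_all add: connected_partitions_def)
  let ?r = "{(x, y). \<exists>p\<in>P. x \<in> p \<and> y \<in> p}"
  have "verts G // ?r = P" by (rule partition_on_eq_quotient[OF P(1)])
  moreover from this have "?r \<in> admissible G"
    using equiv_partition_on[OF P(1)] P(2)
    unfolding admissible_def connected_graph_induced_iff mem_Collect_eq by metis
  ultimately show "\<exists>r\<in>admissible G. P = verts G // r" by (intro bexI[of _ ?r]) simp_all
qed

lemma contract_eq_contract_blocks: "contract G r = contract_blocks G (verts G // r)"
  by (simp add: contract_def contract_blocks_def)

lemma cut_eq_cut_blocks:
  assumes "finite_graph G" "r \<in> admissible G"
  shows "Defs.cut G r = cut_blocks G (verts G // r)"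
proof -
  have r: "equiv (verts G) r" using assms by (simp add: admissible_def)
  have "{{x, y} | x y. {x, y} \<in> edges G \<and> (x, y) \<in> r} =
      {e \<in> edges G. \<exists>p\<in>verts G // r. e \<subseteq> p}" (is "?L = ?R")
  proof
    show "?L \<subseteq> ?R" by (auto simp: equiv_rel_iff_quotient[OF r])
    show "?R \<subseteq> ?L"
    proof
      fix e assume e: "e \<in> ?R"
      then have "e \<in> edges G" by simp
      then obtain x y where "e = {x, y}" by (rule edge_cases[OF assms(1)])
      moreover from this e have "(x, y) \<in> r" unfolding equiv_rel_iff_quotient[OF r] by blast
      ultimately show "e \<in> ?L" using e by blast
    qed
  qed
  then show ?thesis by (simp add: cut_def cut_blocks_def)
qed

lemma verts_blocks [simp]:
  "verts (contract_blocks G P) = P"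
  "verts (cut_blocks G P) = verts G"
  by (simp_all add: contract_blocks_def cut_blocks_def)

lemma adjacent_contract_blocks:
  "{p, q} \<in> edges (contract_blocks G P) \<longleftrightarrow>
     p \<in> P \<and> q \<in> P \<and> p \<noteq> q \<and> (\<exists>x\<in>p. \<exists>y\<in>q. {x, y} \<in> edges G)"
  (is "_ \<longleftrightarrow> ?A p q")
proof -
  have "?A p q \<Longrightarrow> ?A q p" for p q by (metis insert_commute)
  then show ?thesis
    unfolding contract_blocks_def graph.simps mem_Collect_eq doubleton_eq_iff by blast
qed

lemma edges_cut_blocks: "edges (cut_blocks G P) = {e \<in> edges G. \<exists>p\<in>P. e \<subseteq> p}"
  by (simp add: cut_blocks_def)

lemma finite_contract_blocks [simp]: "finite P \<Longrightarrow> finite_graph (contract_blocks G P)"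
  by (rule finite_graphI) (auto simp: contract_blocks_def)

lemma finite_cut_blocks [simp]: "finite_graph G \<Longrightarrow> finite_graph (cut_blocks G P)"
  by (auto simp: finite_graph_def cut_blocks_def)

lemma partition_on_unique:
  "partition_on A P \<Longrightarrow> p \<in> P \<Longrightarrow> q \<in> P \<Longrightarrow> x \<in> p \<Longrightarrow> x \<in> q \<Longrightarrow> p = q"
  unfolding partition_on_def disjoint_def by blast

lemma partition_on_block_nonempty: "partition_on A P \<Longrightarrow> p \<in> P \<Longrightarrow> \<exists>x. x \<in> p"
  unfolding partition_on_def by (metis all_not_in_conv)

lemma connected_partitionsD:
  assumes "P \<in> connected_partitions G"
  shows "partition_on (verts G) P" "\<Union>P = verts G" "{} \<notin> P"
    "p \<in> P \<Longrightarrow> connected_in (edges G) p" "p \<in> P \<Longrightarrow> p \<subseteq> verts G"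
    "p \<in> P \<Longrightarrow> q \<in> P \<Longrightarrow> x \<in> p \<Longrightarrow> x \<in> q \<Longrightarrow> p = q"
proof -
  show P: "partition_on (verts G) P" using assms by (simp add: connected_partitions_def)
  show "p \<in> P \<Longrightarrow> q \<in> P \<Longrightarrow> x \<in> p \<Longrightarrow> x \<in> q \<Longrightarrow> p = q" by (rule partition_on_unique[OF P])
qed (use assms in \<open>auto simp: connected_partitions_def partition_on_def\<close>)

lemma finite_block [simp]:
  "finite_graph G \<Longrightarrow> P \<in> connected_partitions G \<Longrightarrow> finite P"
  using finite_elements[OF finite_verts connected_partitionsD(1)] by blast

lemma finite_connected_partitions [simp]:
  "finite_graph G \<Longrightarrow> finite (connected_partitions G)"
  by (rule finite_subset[OF _ finitely_many_partition_on[OF finite_verts]])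
    (auto simp: connected_partitions_def)

subsection \<open>Blocks and induced subgraphs\<close>

lemma connected_in_induced:
  "p \<subseteq> I \<Longrightarrow> connected_in (edges (induced G I)) p \<longleftrightarrow> connected_in (edges G) p"
  by (rule connected_in_cong) (auto simp: edges_induced)

lemma connected_partitions_induced:
  "P \<in> connected_partitions (induced G I) \<longleftrightarrow>
     partition_on I P \<and> (\<forall>p\<in>P. connected_in (edges G) p)"
proof -
  have "p \<subseteq> I" if "partition_on I P" "p \<in> P" for p using that partition_onD1 by blast
  then show ?thesis
    unfolding connected_partitions_def using connected_in_induced[of _ I G] by auto
qed

text \<open>
  The next two lemmas identify the pairs consisting of a connected partition and a set of its
  blocks with the pairs of connected partitions of two complementary induced subgraphs.
\<close>

lemma connected_partitions_sub:
  assumes R: "R \<in> connected_partitions G" and S: "S \<subseteq> R"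
  shows "S \<in> connected_partitions (induced G (\<Union>S))"
    and "R - S \<in> connected_partitions (induced G (verts G - \<Union>S))"
    and "\<Union>(R - S) = verts G - \<Union>S"
proof -
  note R' = connected_partitionsD[OF R]
  show U: "\<Union>(R - S) = verts G - \<Union>S"
    using R'(6) S unfolding R'(2)[symmetric] by blast
  show "S \<in> connected_partitions (induced G (\<Union>S))"
    unfolding connected_partitions_induced partition_on_def
    using R'(3,4) S pairwise_subset[OF partition_onD2[OF R'(1)] S] by auto
  show "R - S \<in> connected_partitions (induced G (verts G - \<Union>S))"
    unfolding connected_partitions_induced U[symmetric] partition_on_def
    using R'(3,4) S pairwise_subset[OF partition_onD2[OF R'(1)], of "R - S"] by auto
qed

lemma connected_partitions_union:
  assumes J: "J \<subseteq> verts G" and P: "P \<in> connected_partitions (induced G J)"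
    and Q: "Q \<in> connected_partitions (induced G (verts G - J))"
  shows "P \<union> Q \<in> connected_partitions G" "\<Union>P = J" "(P \<union> Q) - P = Q"
proof -
  have P': "\<Union>P = J" "disjoint P" "{} \<notin> P" "\<forall>p\<in>P. connected_in (edges G) p"
    and Q': "\<Union>Q = verts G - J" "disjoint Q" "{} \<notin> Q" "\<forall>p\<in>Q. connected_in (edges G) p"
    using P Q unfolding connected_partitions_induced partition_on_def by auto
  show "\<Union>P = J" by (rule P')
  have "p \<inter> q = {}" if "p \<in> P" "q \<in> Q" for p q using that P'(1) Q'(1) by blast
  then have pq: "p \<inter> q = {}" "q \<inter> p = {}" if "p \<in> P" "q \<in> Q" for p q using that by auto
  have "disjoint (P \<union> Q)"
    by (rule disjoint_union[OF P'(2) Q'(2)]) (use P'(1) Q'(1) in auto)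
  moreover have "\<Union>(P \<union> Q) = verts G" using P'(1) Q'(1) J by auto
  ultimately show "P \<union> Q \<in> connected_partitions G"
    using P'(3,4) Q'(3,4) by (auto simp: connected_partitions_def partition_on_def)
  have "P \<inter> Q = {}" using pq P'(3) by fastforce
  then show "(P \<union> Q) - P = Q" by blast
qed

lemma induced_contract_blocks:
  assumes "finite R" "S \<subseteq> R"
  shows "induced (contract_blocks G R) S = contract_blocks (induced G (\<Union>S)) S"
proof (rule graph_eqI)
  show "finite_graph (induced (contract_blocks G R) S)"
    "finite_graph (contract_blocks (induced G (\<Union>S)) S)"
    using assms by (simp_all add: finite_subset)
  fix p q assume pq: "p \<in> verts (induced (contract_blocks G R) S)"
    "q \<in> verts (induced (contract_blocks G R) S)"
  then have "{x, y} \<subseteq> \<Union>S" if "x \<in> p" "y \<in> q" for x y using that by auto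
  then show "{p, q} \<in> edges (induced (contract_blocks G R) S) \<longleftrightarrow>
      {p, q} \<in> edges (contract_blocks (induced G (\<Union>S)) S)"
    using pq assms(2)
    unfolding adjacent_contract_blocks edges_induced mem_Collect_eq verts_simps by blast
qed simp

lemma induced_cut_blocks:
  assumes G: "finite_graph G" and R: "R \<in> connected_partitions G" and S: "S \<subseteq> R"
  shows "induced (cut_blocks G R) (\<Union>S) = cut_blocks (induced G (\<Union>S)) S"
proof -
  have "(e \<in> edges G \<and> (\<exists>p\<in>R. e \<subseteq> p)) \<and> e \<subseteq> \<Union>S \<longleftrightarrow> (e \<in> edges G \<and> e \<subseteq> \<Union>S) \<and> (\<exists>p\<in>S. e \<subseteq> p)" for e
  proof
    assume e: "(e \<in> edges G \<and> (\<exists>p\<in>R. e \<subseteq> p)) \<and> e \<subseteq> \<Union>S"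
    then obtain p where p: "p \<in> R" "e \<subseteq> p" by blast
    obtain x where "x \<in> e" using e edge_cases[OF G] by (metis insertI1)
    then obtain q where "q \<in> S" "x \<in> q" using e by blast
    then have "p = q" using connected_partitionsD(6)[OF R, of p q x] p S \<open>x \<in> e\<close> by blast
    then show "(e \<in> edges G \<and> e \<subseteq> \<Union>S) \<and> (\<exists>p\<in>S. e \<subseteq> p)" using e p \<open>q \<in> S\<close> by blast
  qed (use S in blast)
  then show ?thesis unfolding induced_def cut_blocks_def by simp
qed

subsection \<open>Successive contractions\<close>

text \<open>
  Contracting in two steps, first along \<open>P\<close> and then along a partition \<open>Q\<close> of the set of blocks, is
  the same as refining: \<open>Q\<close> corresponds to the coarser partition \<open>T = \<Union> ` Q\<close> of the vertices, and
  \<open>P\<close> is a connected partition of the graph in which the edges between blocks of \<open>T\<close> are cut.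
\<close>

lemma connected_partitions_cut_blocks:
  assumes G: "finite_graph G" and T: "partition_on (verts G) T"
  shows "P \<in> connected_partitions (cut_blocks G T) \<longleftrightarrow>
    P \<in> connected_partitions G \<and> (\<forall>p\<in>P. \<exists>t\<in>T. p \<subseteq> t)"
proof -
  have T': "t = t'" if "t \<in> T" "t' \<in> T" "x \<in> t" "x \<in> t'" for t t' x
    by (rule partition_on_unique[OF T that])
  have in_block: "\<exists>t\<in>T. p \<subseteq> t" if p: "connected_in (edges (cut_blocks G T)) p" "p \<subseteq> verts G" for p
  proof -
    obtain x where x: "x \<in> p" using p(1) by (auto simp: connected_in_def)
    then obtain t where t: "t \<in> T" "x \<in> t" using p(2) partition_onD1[OF T] by blast
    have "p \<subseteq> t"
    proof (rule connected_in_subset[OF p(1) x t(2)])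
      fix a b assume "a \<in> t" "{a, b} \<in> edges (cut_blocks G T)"
      then show "b \<in> t" using T' t(1) by (auto simp: edges_cut_blocks)
    qed
    with t show ?thesis by blast
  qed
  have cong: "connected_in (edges (cut_blocks G T)) p \<longleftrightarrow> connected_in (edges G) p"
    if "t \<in> T" "p \<subseteq> t" for p t
    by (rule connected_in_cong) (use that in \<open>auto simp: edges_cut_blocks\<close>)
  show ?thesis
  proof
    assume P: "P \<in> connected_partitions (cut_blocks G T)"
    note P' = connected_partitionsD[OF P, simplified]
    have sub: "\<forall>p\<in>P. \<exists>t\<in>T. p \<subseteq> t" using in_block P'(4,5) by blast
    have "connected_in (edges G) p" if "p \<in> P" for p
      using sub cong P'(4) that by metis
    with P'(1) sub show "P \<in> connected_partitions G \<and> (\<forall>p\<in>P. \<exists>t\<in>T. p \<subseteq> t)"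
      by (simp add: connected_partitions_def)
  next
    assume P: "P \<in> connected_partitions G \<and> (\<forall>p\<in>P. \<exists>t\<in>T. p \<subseteq> t)"
    then have "connected_in (edges (cut_blocks G T)) p" if "p \<in> P" for p
      using cong connected_partitionsD(4) that by metis
    with P show "P \<in> connected_partitions (cut_blocks G T)"
      by (simp add: connected_partitions_def)
  qed
qed

lemma Union_blocks:
  assumes P: "partition_on A P" and T: "partition_on A T" and ref: "\<forall>p\<in>P. \<exists>t\<in>T. p \<subseteq> t"
    and t: "t \<in> T"
  shows "\<Union>{p \<in> P. p \<subseteq> t} = t"
  using refines_obtains_subset[of A P T t] P T ref t
  by (auto simp: refines_def partition_on_def)

lemma blocks_in_Union:
  assumes P: "partition_on A P" and q: "q \<subseteq> P"
  shows "{p \<in> P. p \<subseteq> \<Union>q} = q"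
proof -
  have "p \<in> q" if p: "p \<in> P" "p \<subseteq> \<Union>q" for p
  proof -
    obtain x where x: "x \<in> p" using partition_on_block_nonempty[OF P p(1)] by blast
    with p(2) obtain p' where "p' \<in> q" "x \<in> p'" by blast
    then have "p' = p" using partition_on_unique[OF P _ p(1) _ x] q by blast
    with \<open>p' \<in> q\<close> show ?thesis by simp
  qed
  then show ?thesis using q by blast
qed

text \<open>
  A nonempty subset of \<open>\<Union>q\<close> closed under adjacency contains each block that it meets, and these
  blocks form a subset of \<open>q\<close> closed under adjacency in the contracted graph.
\<close>

lemma connected_in_Union:
  assumes G: "P \<in> connected_partitions G" and q: "connected_in (edges (contract_blocks G P)) q" "q \<subseteq> P"
  shows "connected_in (edges G) (\<Union>q)"
  unfolding connected_in_def
proof (intro conjI allI impI)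
  note P = connected_partitionsD[OF G]
  obtain p where "p \<in> q" using q(1) by (auto simp: connected_in_def)
  then show "\<Union>q \<noteq> {}" using partition_on_block_nonempty[OF P(1)] q(2) by blast
  fix S assume S: "S \<subseteq> \<Union>q" "S \<noteq> {}" and closed: "\<forall>a\<in>S. \<forall>b\<in>\<Union>q. {a, b} \<in> edges G \<longrightarrow> b \<in> S"
  have block: "p \<subseteq> S" if "p \<in> q" "x \<in> p" "x \<in> S" for p x
  proof (rule connected_in_subset[OF P(4) that(2,3)])
    show "p \<in> P" using that(1) q(2) by blast
    fix a b assume "a \<in> S" "b \<in> p" "{a, b} \<in> edges G"
    then show "b \<in> S" using closed that(1) by blast
  qed
  have "{p \<in> q. p \<subseteq> S} = q"
  proof (rule connected_inD[OF q(1)])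
    obtain x where "x \<in> S" using S(2) by blast
    moreover from this S(1) obtain p where "p \<in> q" "x \<in> p" by blast
    ultimately have "p \<in> {p \<in> q. p \<subseteq> S}" using block by simp
    then show "{p \<in> q. p \<subseteq> S} \<noteq> {}" by blast
    fix a b assume ab: "a \<in> {p \<in> q. p \<subseteq> S}" "b \<in> q" "{a, b} \<in> edges (contract_blocks G P)"
    then obtain x y where "x \<in> a" "y \<in> b" "{x, y} \<in> edges G"
      by (auto simp: adjacent_contract_blocks)
    then have "y \<in> S" using closed ab(1,2) by blast
    then show "b \<in> {p \<in> q. p \<subseteq> S}" using block[OF ab(2) \<open>y \<in> b\<close>] ab(2) by simp
  qed blast
  then show "S = \<Union>q" using S(1) by blast
qed

text \<open>
  Conversely, a set of blocks closed under adjacency of blocks has a union closed under adjacency of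
  vertices.
\<close>

lemma connected_in_blocks:
  assumes P: "P \<in> connected_partitions G"
    and t: "connected_in (edges G) t" "\<Union>{p \<in> P. p \<subseteq> t} = t"
  shows "connected_in (edges (contract_blocks G P)) {p \<in> P. p \<subseteq> t}"
  unfolding connected_in_def
proof (intro conjI allI impI)
  let ?q = "{p \<in> P. p \<subseteq> t}"
  show "?q \<noteq> {}" using t by (auto simp: connected_in_def)
  fix S assume S: "S \<subseteq> ?q" "S \<noteq> {}"
    and closed: "\<forall>a\<in>S. \<forall>b\<in>?q. {a, b} \<in> edges (contract_blocks G P) \<longrightarrow> b \<in> S"
  have "\<Union>S = t"
  proof (rule connected_inD[OF t(1)])
    show "\<Union>S \<subseteq> t" using S by blast
    obtain p where "p \<in> S" using S(2) by blast
    then show "\<Union>S \<noteq> {}"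
      using partition_on_block_nonempty[OF connected_partitionsD(1)[OF P]] S(1) by blast
    fix a b assume "a \<in> \<Union>S" "b \<in> t" and ab: "{a, b} \<in> edges G"
    then obtain p p' where p: "p \<in> S" "a \<in> p" "p' \<in> ?q" "b \<in> p'" using t(2) by blast
    show "b \<in> \<Union>S"
    proof (cases "p = p'")
      case False
      then have "{p, p'} \<in> edges (contract_blocks G P)"
        unfolding adjacent_contract_blocks using p ab S(1) by blast
      then have "p' \<in> S" using closed p by blast
      with p show ?thesis by blast
    qed (use p in blast)
  qed
  then show "S = ?q"
    using blocks_in_Union[OF connected_partitionsD(1)[OF P], of S] S by auto
qed

lemma connected_partitions_coarsen:
  assumes G: "finite_graph G" and P: "P \<in> connected_partitions G"
    and Q: "Q \<in> connected_partitions (contract_blocks G P)"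
  shows "Union ` Q \<in> connected_partitions G"
    and "P \<in> connected_partitions (cut_blocks G (Union ` Q))"
    and "(\<lambda>t. {p \<in> P. p \<subseteq> t}) ` Union ` Q = Q"
proof -
  note P' = connected_partitionsD[OF P] and Q' = connected_partitionsD[OF Q, simplified]
  have inv: "{p \<in> P. p \<subseteq> \<Union>q} = q" if "q \<in> Q" for q
    by (rule blocks_in_Union[OF P'(1) Q'(5)[OF that]])
  show "(\<lambda>t. {p \<in> P. p \<subseteq> t}) ` Union ` Q = Q" using inv by (simp add: image_image)
  have unique: "q = q'" if q: "q \<in> Q" "q' \<in> Q" "x \<in> \<Union>q" "x \<in> \<Union>q'" for q q' x
  proof -
    obtain p p' where p: "p \<in> q" "x \<in> p" "p' \<in> q'" "x \<in> p'" using q by blast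
    then have "p = p'" using P'(6)[of p p' x] Q'(5) q(1,2) by blast
    then show ?thesis using Q'(6)[OF q(1,2) p(1)] p(3) by simp
  qed
  have "disjoint (Union ` Q)"
  proof (rule disjointI)
    fix a b assume "a \<in> Union ` Q" "b \<in> Union ` Q" and ne: "a \<noteq> b"
    then obtain q q' where "q \<in> Q" "q' \<in> Q" "a = \<Union>q" "b = \<Union>q'" by blast
    moreover from this have "q \<noteq> q'" using ne by blast
    ultimately have "\<not> (x \<in> a \<and> x \<in> b)" for x using unique[of q q' x] by auto
    then show "a \<inter> b = {}" by blast
  qed
  moreover have "{} \<notin> Union ` Q"
  proof
    assume "{} \<in> Union ` Q"
    then obtain q where q: "q \<in> Q" "\<Union>q = {}" by auto
    obtain p where "p \<in> q" using partition_on_block_nonempty[OF Q'(1) q(1)] by blast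
    then show False using q Q'(5)[OF q(1)] P'(3) by auto
  qed
  moreover have "\<Union>(Union ` Q) = verts G" unfolding P'(2)[symmetric] Q'(2)[symmetric] by blast
  ultimately have T: "partition_on (verts G) (Union ` Q)" by (simp add: partition_on_def)
  then show "Union ` Q \<in> connected_partitions G"
    using connected_in_Union[OF P] Q' by (auto simp: connected_partitions_def)
  have "\<exists>t\<in>Union ` Q. p \<subseteq> t" if "p \<in> P" for p using that Q'(2) by blast
  then show "P \<in> connected_partitions (cut_blocks G (Union ` Q))"
    by (simp add: connected_partitions_cut_blocks[OF G T] P)
qed

lemma connected_partitions_refine:
  assumes G: "finite_graph G" and T: "T \<in> connected_partitions G"
    and PT: "P \<in> connected_partitions (cut_blocks G T)"
  shows "P \<in> connected_partitions G"
    and "(\<lambda>t. {p \<in> P. p \<subseteq> t}) ` T \<in> connected_partitions (contract_blocks G P)"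
    and "Union ` (\<lambda>t. {p \<in> P. p \<subseteq> t}) ` T = T"
proof -
  note T' = connected_partitionsD[OF T]
  have P: "P \<in> connected_partitions G" and sub: "\<forall>p\<in>P. \<exists>t\<in>T. p \<subseteq> t"
    using PT connected_partitions_cut_blocks[OF G T'(1)] by auto
  from P show "P \<in> connected_partitions G" .
  note P' = connected_partitionsD[OF P]
  have inv: "\<Union>{p \<in> P. p \<subseteq> t} = t" if "t \<in> T" for t
    by (rule Union_blocks[OF P'(1) T'(1) sub that])
  then show "Union ` (\<lambda>t. {p \<in> P. p \<subseteq> t}) ` T = T" by (simp add: image_image)
  let ?Q = "(\<lambda>t. {p \<in> P. p \<subseteq> t}) ` T"
  have unique: "t = t'" if "t \<in> T" "t' \<in> T" "p \<in> P" "p \<subseteq> t" "p \<subseteq> t'" for t t' p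
  proof -
    obtain x where "x \<in> p" using partition_on_block_nonempty[OF P'(1) \<open>p \<in> P\<close>] by blast
    then show ?thesis using T'(6)[OF that(1,2), of x] that(4,5) by blast
  qed
  have "disjoint ?Q"
  proof (rule disjointI)
    fix a b assume "a \<in> ?Q" "b \<in> ?Q" and ne: "a \<noteq> b"
    then obtain t t' where "t \<in> T" "t' \<in> T" "a = {p \<in> P. p \<subseteq> t}" "b = {p \<in> P. p \<subseteq> t'}" by blast
    moreover from this have "t \<noteq> t'" using ne by blast
    ultimately have "\<not> (p \<in> a \<and> p \<in> b)" for p using unique[of t t' p] by auto
    then show "a \<inter> b = {}" by blast
  qed
  moreover have "{} \<notin> ?Q"
  proof
    assume "{} \<in> ?Q"
    then obtain t where "t \<in> T" "{p \<in> P. p \<subseteq> t} = {}" by auto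
    then show False using inv[OF \<open>t \<in> T\<close>] T'(3) by (metis Union_empty)
  qed
  moreover have "\<Union>?Q = P" using sub by blast
  ultimately have "partition_on P ?Q" by (simp add: partition_on_def)
  moreover have "connected_in (edges (contract_blocks G P)) {p \<in> P. p \<subseteq> t}" if "t \<in> T" for t
    by (rule connected_in_blocks[OF P T'(4)[OF that] inv[OF that]])
  ultimately show "?Q \<in> connected_partitions (contract_blocks G P)"
    by (auto simp: connected_partitions_def)
qed

lemma cut_blocks_contract_blocks:
  assumes G: "finite_graph G" and P: "P \<in> connected_partitions G"
    and Q: "Q \<in> connected_partitions (contract_blocks G P)"
  shows "cut_blocks (contract_blocks G P) Q = contract_blocks (cut_blocks G (Union ` Q)) P"
proof (rule graph_eqI)
  note P' = connected_partitionsD[OF P] and Q' = connected_partitionsD[OF Q, simplified]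
  have finP: "finite P" using G P by simp
  then show "finite_graph (cut_blocks (contract_blocks G P) Q)"
    "finite_graph (contract_blocks (cut_blocks G (Union ` Q)) P)" by simp_all
  fix p p' assume "p \<in> verts (cut_blocks (contract_blocks G P) Q)"
    "p' \<in> verts (cut_blocks (contract_blocks G P) Q)"
  then have p: "p \<in> P" "p' \<in> P" by simp_all
  have iff: "(\<exists>q\<in>Q. p \<in> q \<and> p' \<in> q) \<longleftrightarrow> (\<exists>q\<in>Q. x \<in> \<Union>q \<and> y \<in> \<Union>q)" if "x \<in> p" "y \<in> p'" for x y
  proof
    assume "\<exists>q\<in>Q. x \<in> \<Union>q \<and> y \<in> \<Union>q"
    then obtain q r r' where "q \<in> Q" "r \<in> q" "r' \<in> q" "x \<in> r" "y \<in> r'" by blast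
    moreover from this have "r = p" "r' = p'"
      using P'(6)[OF _ p(1) _ that(1)] P'(6)[OF _ p(2) _ that(2)] Q'(5)[OF \<open>q \<in> Q\<close>] by blast+
    ultimately show "\<exists>q\<in>Q. p \<in> q \<and> p' \<in> q" by blast
  qed (use that in blast)
  define B where "B \<longleftrightarrow> (\<exists>q\<in>Q. p \<in> q \<and> p' \<in> q)"
  define C where "C x y \<longleftrightarrow> (\<exists>q\<in>Q. x \<in> \<Union>q \<and> y \<in> \<Union>q)" for x y
  have "{p, p'} \<in> edges (cut_blocks (contract_blocks G P) Q) \<longleftrightarrow>
      {p, p'} \<in> edges (contract_blocks G P) \<and> B"
    by (simp add: edges_cut_blocks B_def)
  moreover have "{x, y} \<in> edges (cut_blocks G (Union ` Q)) \<longleftrightarrow> {x, y} \<in> edges G \<and> C x y" for x y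
    by (simp add: edges_cut_blocks C_def)
  moreover have "B \<longleftrightarrow> C x y" if "x \<in> p" "y \<in> p'" for x y
    using iff[OF that] by (simp only: B_def C_def)
  ultimately show "{p, p'} \<in> edges (cut_blocks (contract_blocks G P) Q) \<longleftrightarrow>
      {p, p'} \<in> edges (contract_blocks (cut_blocks G (Union ` Q)) P)"
    unfolding adjacent_contract_blocks by metis
qed simp

lemma cut_blocks_cut_blocks:
  assumes "\<forall>p\<in>P. \<exists>t\<in>T. p \<subseteq> t"
  shows "cut_blocks (cut_blocks G T) P = cut_blocks G P"
proof -
  have "(e \<in> edges G \<and> (\<exists>t\<in>T. e \<subseteq> t)) \<and> (\<exists>p\<in>P. e \<subseteq> p) \<longleftrightarrow> e \<in> edges G \<and> (\<exists>p\<in>P. e \<subseteq> p)" for e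
    using assms by (meson subset_trans)
  then show ?thesis by (simp add: cut_blocks_def)
qed

subsection \<open>Extreme partitions\<close>

lemma singletons_connected_partition: "(\<lambda>x. {x}) ` verts G \<in> connected_partitions G"
  by (simp add: connected_partitions_def partition_on_singletons connected_in_singleton)

lemma edges_cut_blocks_empty_iff:
  assumes G: "finite_graph G" and P: "P \<in> connected_partitions G"
  shows "edges (cut_blocks G P) = {} \<longleftrightarrow> P = (\<lambda>x. {x}) ` verts G"
proof
  note P' = connected_partitionsD[OF P]
  assume empty: "edges (cut_blocks G P) = {}"
  have single: "p = {x}" if "p \<in> P" "x \<in> p" for p x
  proof -
    have "p \<subseteq> {x}"
    proof (rule connected_in_subset[OF P'(4)[OF that(1)] that(2)])
      fix a b assume "a \<in> {x}" "b \<in> p" "{a, b} \<in> edges G"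
      then have "{a, b} \<in> edges (cut_blocks G P)" using that by (auto simp: edges_cut_blocks)
      with empty show "b \<in> {x}" by simp
    qed simp
    with that show ?thesis by blast
  qed
  have "p \<in> (\<lambda>x. {x}) ` verts G" if "p \<in> P" for p
    using single[OF that] P'(3,5) that by (metis all_not_in_conv image_eqI subsetD)
  moreover have "{x} \<in> P" if "x \<in> verts G" for x
    using that P'(2) single by (metis UnionE)
  ultimately show "P = (\<lambda>x. {x}) ` verts G" by blast
next
  assume "P = (\<lambda>x. {x}) ` verts G"
  then show "edges (cut_blocks G P) = {}"
    using edge_cases[OF G] by (auto simp: edges_cut_blocks)
qed

lemma edges_contract_blocks_empty_iff:
  "edges (contract_blocks G P) = {} \<longleftrightarrow>
     (\<forall>p\<in>P. \<forall>q\<in>P. \<forall>x\<in>p. \<forall>y\<in>q. {x, y} \<in> edges G \<longrightarrow> p = q)"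
  by (auto simp: contract_blocks_def)

lemma cut_blocks_components:
  assumes G: "finite_graph G" and P: "P \<in> connected_partitions G"
    and empty: "edges (contract_blocks G P) = {}"
  shows "cut_blocks G P = G"
proof (rule graph_eqI)
  fix x y assume "x \<in> verts (cut_blocks G P)" "y \<in> verts (cut_blocks G P)"
  then have "x \<in> \<Union>P" "y \<in> \<Union>P" using connected_partitionsD(2)[OF P] by simp_all
  then obtain p q where "p \<in> P" "q \<in> P" "x \<in> p" "y \<in> q" by blast
  then show "{x, y} \<in> edges (cut_blocks G P) \<longleftrightarrow> {x, y} \<in> edges G"
    using empty unfolding edges_contract_blocks_empty_iff edges_cut_blocks
    by (simp add: insert_subset) metis
qed (simp_all add: G)

text \<open>
  If no edge joins two blocks, the blocks are closed under adjacency; being connected, they are the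
  connected components.
\<close>

lemma components_unique:
  assumes P: "P \<in> connected_partitions G" "edges (contract_blocks G P) = {}"
    and Q: "Q \<in> connected_partitions G" "edges (contract_blocks G Q) = {}"
  shows "P = Q"
proof -
  have "P \<subseteq> Q"
    if P: "P \<in> connected_partitions G" "edges (contract_blocks G P) = {}"
      and Q: "Q \<in> connected_partitions G" "edges (contract_blocks G Q) = {}" for P Q
  proof
    note P' = connected_partitionsD[OF P(1)] and Q' = connected_partitionsD[OF Q(1)]
    have sub: "p \<subseteq> q" if R: "\<And>p. p \<in> R \<Longrightarrow> connected_in (edges G) p" "\<Union>R = verts G"
      "\<Union>S = verts G" "edges (contract_blocks G S) = {}"
      and "p \<in> R" "q \<in> S" "x \<in> p" "x \<in> q" for R S p q x
    proof (rule connected_in_subset[OF R(1)])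
      fix a b assume ab: "a \<in> q" "b \<in> p" "{a, b} \<in> edges G"
      then obtain q' where "q' \<in> S" "b \<in> q'" using \<open>p \<in> R\<close> R(2,3) by blast
      then show "b \<in> q" using R(4) ab \<open>q \<in> S\<close> unfolding edges_contract_blocks_empty_iff by blast
    qed fact+
    fix p assume "p \<in> P"
    then obtain x where "x \<in> p" using partition_on_block_nonempty[OF P'(1)] by blast
    then obtain q where "q \<in> Q" "x \<in> q" using Q'(2) P'(5) \<open>p \<in> P\<close> by blast
    have "p \<subseteq> q" by (rule sub[where R = P and S = Q]) (use P' Q' Q \<open>p \<in> P\<close> \<open>q \<in> Q\<close> \<open>x \<in> p\<close> \<open>x \<in> q\<close> in auto)
    moreover have "q \<subseteq> p"
      by (rule sub[where R = Q and S = P]) (use P' Q' P \<open>p \<in> P\<close> \<open>q \<in> Q\<close> \<open>x \<in> p\<close> \<open>x \<in> q\<close> in auto)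
    ultimately show "p \<in> Q" using \<open>q \<in> Q\<close> by auto
  qed
  with P Q show ?thesis by blast
qed

lemma components_exist:
  assumes G: "finite_graph G"
  obtains P where "P \<in> connected_partitions G" "edges (contract_blocks G P) = {}"
proof
  let ?R = "{(a, b). {a, b} \<in> edges G}"
  define r where "r = {(a, b). a \<in> verts G \<and> b \<in> verts G \<and> (a, b) \<in> ?R\<^sup>*}"
  have "sym ?R" by (auto simp: sym_def insert_commute)
  then have "sym (?R\<^sup>*)" by (rule sym_rtrancl)
  then have r: "equiv (verts G) r"
    by (intro equivI) (auto simp: r_def refl_on_def sym_def trans_def)
  have "connected_in (edges G) p" if p: "p \<in> verts G // r" for p
    unfolding connected_in_def
  proof (intro conjI allI impI)
    show "p \<noteq> {}" by (rule in_quotient_imp_non_empty[OF r p])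
    fix S assume S: "S \<subseteq> p" "S \<noteq> {}" "\<forall>a\<in>S. \<forall>b\<in>p. {a, b} \<in> edges G \<longrightarrow> b \<in> S"
    then obtain s where "s \<in> S" by blast
    have "b \<in> S" if "b \<in> p" for b
    proof -
      have "(s, b) \<in> r" using in_quotient_imp_in_rel[OF r p] \<open>s \<in> S\<close> S(1) that by blast
      then have "(s, b) \<in> ?R\<^sup>*" by (simp add: r_def)
      then show "b \<in> S"
      proof (induct rule: rtrancl_induct)
        case (step a b)
        then have ab: "{a, b} \<in> edges G" by simp
        then have "(a, b) \<in> r" using adjacentD[OF G ab] by (auto simp: r_def)
        then have "b \<in> p" using in_quotient_imp_closed[OF r p] step(3) S(1) by blast
        then show ?case using S(3) step(3) ab by blast
      qed (rule \<open>s \<in> S\<close>)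
    qed
    with S(1) show "S = p" by blast
  qed
  then show "verts G // r \<in> connected_partitions G"
    by (simp add: connected_partitions_def partition_on_quotient[OF r])
  have "p = q" if "p \<in> verts G // r" "q \<in> verts G // r" "x \<in> p" "y \<in> q" "{x, y} \<in> edges G" for p q x y
  proof -
    have "(x, y) \<in> r" using adjacentD[OF G that(5)] that(5) by (auto simp: r_def)
    then show ?thesis using quotient_eqI[OF r that(1-4)] by simp
  qed
  then show "edges (contract_blocks G (verts G // r)) = {}"
    unfolding edges_contract_blocks_empty_iff by blast
qed

section \<open>Decorated graphs up to isomorphism\<close>

subsection \<open>Sums in a commutative semigroup\<close>

lemma semigroup_sum_cong:
  assumes "finite A" "A \<noteq> {}" "\<And>x. x \<in> A \<Longrightarrow> f x = g x"
  shows "semigroup_sum f A = semigroup_sum g A"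
  using assms by (induct A rule: finite_ne_induct) (simp_all add: semigroup_sum_insert)

lemma semigroup_sum_image:
  assumes "finite A" "A \<noteq> {}" "inj_on h A"
  shows "semigroup_sum f (h ` A) = semigroup_sum (\<lambda>x. f (h x)) A"
  using assms
proof (induct A rule: finite_ne_induct)
  case (insert x A)
  then have "h x \<notin> h ` A" by (auto simp: inj_on_def)
  with insert show ?case by (simp add: semigroup_sum_insert)
qed simp

lemma semigroup_sum_Un:
  assumes "finite A" "A \<noteq> {}" "finite B" "B \<noteq> {}" "A \<inter> B = {}"
  shows "semigroup_sum f (A \<union> B) = semigroup_sum f A + semigroup_sum f B"
  using assms
proof (induct A rule: finite_ne_induct)
  case (insert x A)
  then have "semigroup_sum f (insert x (A \<union> B)) = f x + semigroup_sum f (A \<union> B)"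
    by (intro semigroup_sum_insert) auto
  with insert show ?case by (simp add: semigroup_sum_insert add.assoc)
qed (simp add: semigroup_sum_insert)

text \<open>This is why contracting in two steps gives the same decoration as contracting at once.\<close>

lemma semigroup_sum_Union:
  assumes "finite Q" "Q \<noteq> {}" "\<And>p. p \<in> Q \<Longrightarrow> finite p \<and> p \<noteq> {}" "disjoint Q"
  shows "semigroup_sum f (\<Union>Q) = semigroup_sum (semigroup_sum f) Q"
  using assms
proof (induct Q rule: finite_ne_induct)
  case (insert p Q)
  obtain q where "q \<in> Q" using insert.hyps by blast
  then have ne: "\<Union>Q \<noteq> {}" using insert.prems by blast
  have "p \<inter> q = {}" if "q \<in> Q" for q
    by (rule disjointD[OF insert.prems(2)]) (use insert.hyps that in auto)
  then have "p \<inter> \<Union>Q = {}" by blast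
  then have "semigroup_sum f (p \<union> \<Union>Q) = semigroup_sum f p + semigroup_sum f (\<Union>Q)"
    by (intro semigroup_sum_Un) (use insert.prems insert.hyps ne in auto)
  moreover have "disjoint Q" by (rule pairwise_subset[OF insert.prems(2)]) blast
  ultimately show ?case using insert by (simp add: semigroup_sum_insert)
qed simp

subsection \<open>Isomorphisms\<close>

lemma graph_iso_adjacent:
  assumes G: "finite_graph G" and f: "graph_iso f G H" and xy: "x \<in> verts G" "y \<in> verts G"
  shows "{f x, f y} \<in> edges H \<longleftrightarrow> {x, y} \<in> edges G"
proof
  assume "{f x, f y} \<in> edges H"
  then obtain e where e: "e \<in> edges G" "f ` {x, y} = f ` e" using f by (auto simp: graph_iso_def)
  have "{x, y} = e"
    by (rule inj_on_image_eq_iff[THEN iffD1, OF _ _ _ e(2), of "verts G"])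
      (use e f G xy in \<open>auto simp: graph_iso_def bij_betw_def finite_graph_def\<close>)
  with e show "{x, y} \<in> edges G" by simp
next
  assume "{x, y} \<in> edges G"
  then have "f ` {x, y} \<in> (`) f ` edges G" by blast
  then show "{f x, f y} \<in> edges H" using f by (simp add: graph_iso_def)
qed

lemma graph_isoI:
  assumes G: "finite_graph G" and H: "finite_graph H" and f: "bij_betw f (verts G) (verts H)"
    and adj: "\<And>x y. x \<in> verts G \<Longrightarrow> y \<in> verts G \<Longrightarrow> {f x, f y} \<in> edges H \<longleftrightarrow> {x, y} \<in> edges G"
  shows "graph_iso f G H"
proof -
  have "e \<in> (`) f ` edges G" if e: "e \<in> edges H" for e
  proof -
    obtain x' y' where "e = {x', y'}" "x' \<in> verts H" "y' \<in> verts H" using edge_cases[OF H e] by metis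
    moreover have "verts H = f ` verts G" using f by (simp add: bij_betw_def)
    ultimately obtain x y where "x \<in> verts G" "y \<in> verts G" "x' = f x" "y' = f y" by blast
    with \<open>e = {x', y'}\<close> have "e = f ` {x, y}" "{x, y} \<in> edges G" using adj e by auto
    then show ?thesis by blast
  qed
  moreover have "f ` e \<in> edges H" if e: "e \<in> edges G" for e
  proof -
    obtain x y where "e = {x, y}" "x \<in> verts G" "y \<in> verts G" using edge_cases[OF G e] by metis
    then show ?thesis using adj e by simp
  qed
  ultimately show ?thesis using f by (auto simp: graph_iso_def)
qed

lemma dgraph_isoI:
  assumes "finite_graph (fst G)" "finite_graph (fst H)" "bij_betw f (verts (fst G)) (verts (fst H))"
    and "\<And>x y. x \<in> verts (fst G) \<Longrightarrow> y \<in> verts (fst G) \<Longrightarrow>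
           {f x, f y} \<in> edges (fst H) \<longleftrightarrow> {x, y} \<in> edges (fst G)"
    and "\<And>x. x \<in> verts (fst G) \<Longrightarrow> snd H (f x) = snd G x"
  shows "dgraph_iso f G H"
  using assms by (simp add: dgraph_iso_def graph_isoI)

lemma dgraph_isoD:
  assumes "finite_graph (fst G)" "dgraph_iso f G H"
  shows "bij_betw f (verts (fst G)) (verts (fst H))"
    and "f ` verts (fst G) = verts (fst H)" and "inj_on f (verts (fst G))"
    and "x \<in> verts (fst G) \<Longrightarrow> y \<in> verts (fst G) \<Longrightarrow>
           {f x, f y} \<in> edges (fst H) \<longleftrightarrow> {x, y} \<in> edges (fst G)"
    and "x \<in> verts (fst G) \<Longrightarrow> snd H (f x) = snd G x"
  using assms graph_iso_adjacent[of "fst G" f "fst H" x y]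
  by (auto simp: dgraph_iso_def graph_iso_def bij_betw_def)

lemma dgraph_iso_finite:
  assumes G: "finite_graph (fst G)" and f: "dgraph_iso f G H"
  shows "finite_graph (fst H)"
proof (rule finite_graphI)
  note D = dgraph_isoD[OF G f]
  show "finite (verts (fst H))" using finite_verts[OF G] unfolding D(2)[symmetric] by simp
  fix e assume "e \<in> edges (fst H)"
  then obtain d where d: "d \<in> edges (fst G)" "e = f ` d"
    using f by (auto simp: dgraph_iso_def graph_iso_def)
  obtain x y where "d = {x, y}" "x \<noteq> y" "x \<in> verts (fst G)" "y \<in> verts (fst G)"
    using edge_cases[OF G d(1)] by metis
  then have "e = {f x, f y} \<and> f x \<noteq> f y \<and> f x \<in> verts (fst H) \<and> f y \<in> verts (fst H)"
    using d(2) D(2,3) by (auto simp: inj_on_def)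
  then show "\<exists>x y. e = {x, y} \<and> x \<noteq> y \<and> x \<in> verts (fst H) \<and> y \<in> verts (fst H)" by blast
qed

lemma dgraph_iso_trans:
  assumes G: "finite_graph (fst G)" and f: "dgraph_iso f G H" and g: "dgraph_iso g H K"
  shows "dgraph_iso (g \<circ> f) G K"
proof -
  have H: "finite_graph (fst H)" by (rule dgraph_iso_finite[OF G f])
  have K: "finite_graph (fst K)" by (rule dgraph_iso_finite[OF H g])
  note D = dgraph_isoD[OF G f] and E = dgraph_isoD[OF H g]
  have "f x \<in> verts (fst H)" if "x \<in> verts (fst G)" for x using D(2) that by blast
  then show ?thesis
    by (intro dgraph_isoI[OF G K]) (simp_all add: bij_betw_trans[OF D(1) E(1)] D(4,5) E(4,5))
qed

lemma dgraph_iso_sym: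
  assumes G: "finite_graph (fst G)" and f: "dgraph_iso f G H"
  shows "dgraph_iso (inv_into (verts (fst G)) f) H G"
proof (rule dgraph_isoI)
  let ?g = "inv_into (verts (fst G)) f"
  note D = dgraph_isoD[OF G f]
  show "finite_graph (fst H)" by (rule dgraph_iso_finite[OF G f])
  show "bij_betw ?g (verts (fst H)) (verts (fst G))" by (rule bij_betw_inv_into[OF D(1)])
  have g: "?g x \<in> verts (fst G)" "f (?g x) = x" if "x \<in> verts (fst H)" for x
    using that unfolding D(2)[symmetric] by (simp_all add: inv_into_into f_inv_into_f)
  show "{?g x, ?g y} \<in> edges (fst G) \<longleftrightarrow> {x, y} \<in> edges (fst H)"
    if "x \<in> verts (fst H)" "y \<in> verts (fst H)" for x y
    using D(4)[of "?g x" "?g y"] g that by simp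
  show "snd G (?g x) = snd H x" if "x \<in> verts (fst H)" for x
    using D(5)[of "?g x"] g that by simp
qed (rule G)

text \<open>
  Isoclasses have members with vertices in \<open>nat\<close> only, whereas contractions have sets as vertices;
  every finite graph therefore has to be copied to \<open>nat\<close>.
\<close>

lemma dgraph_copy:
  fixes G :: "('v, 'd) dgraph"
  assumes G: "finite_graph (fst G)"
  obtains f and H :: "(nat, 'd) dgraph" where "dgraph_iso f G H"
proof -
  obtain f :: "'v \<Rightarrow> nat" where f: "bij_betw f (verts (fst G)) {0..<card (verts (fst G))}"
    using ex_bij_betw_finite_nat[OF finite_verts[OF G]] by blast
  then have inj: "inj_on f (verts (fst G))" by (simp add: bij_betw_def)
  let ?H = "(\<lparr>verts = f ` verts (fst G), edges = (`) f ` edges (fst G)\<rparr>,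
    \<lambda>x. snd G (inv_into (verts (fst G)) f x))"
  have "dgraph_iso f G ?H"
    by (simp add: dgraph_iso_def graph_iso_def inj inj_on_imp_bij_betw inv_into_f_f)
  then show thesis by (rule that)
qed

subsection \<open>Classes and representatives\<close>

lemma dgraph_class_eqI:
  assumes G: "finite_graph (fst G)" and f: "dgraph_iso f G H"
  shows "dgraph_class G = dgraph_class H"
proof -
  have H: "finite_graph (fst H)" by (rule dgraph_iso_finite[OF G f])
  have "(\<exists>g. dgraph_iso g G K) \<longleftrightarrow> (\<exists>g. dgraph_iso g H K)" for K :: "(nat, 'b) dgraph"
    using dgraph_iso_trans[OF G f] dgraph_iso_trans[OF H dgraph_iso_sym[OF G f]] by blast
  then show ?thesis by (simp add: dgraph_class_def)
qed

lemma dgraph_class_members_class: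
  assumes G: "finite_graph (fst G)"
  shows "dgraph_class_members (dgraph_class G) =
    {H. finite_graph (fst H) \<and> (\<exists>f. dgraph_iso f G H)}"
proof -
  obtain f and H :: "(nat, 'b) dgraph" where f: "dgraph_iso f G H" using dgraph_copy[OF G] .
  have H: "finite_graph (fst H)" by (rule dgraph_iso_finite[OF G f])
  have "dgraph_class_members (dgraph_class H) =
      {K. finite_graph (fst K) \<and> (\<exists>f. dgraph_iso f H K)}"
    unfolding dgraph_class_def by (rule Abs_dgraph_class_inverse) (use H in blast)
  moreover have "(\<exists>g. dgraph_iso g G K) \<longleftrightarrow> (\<exists>g. dgraph_iso g H K)" for K :: "(nat, 'b) dgraph"
    using dgraph_iso_trans[OF G f] dgraph_iso_trans[OF H dgraph_iso_sym[OF G f]] by blast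
  ultimately show ?thesis by (simp add: dgraph_class_eqI[OF G f])
qed

lemma dgraph_rep_class:
  assumes G: "finite_graph (fst G)"
  obtains f where "dgraph_iso f G (dgraph_rep (dgraph_class G))"
proof -
  obtain f and H :: "(nat, 'b) dgraph" where f: "dgraph_iso f G H" using dgraph_copy[OF G] .
  then have "H \<in> dgraph_class_members (dgraph_class G)"
    using dgraph_iso_finite[OF G f] by (auto simp: dgraph_class_members_class[OF G])
  then have "dgraph_rep (dgraph_class G) \<in> dgraph_class_members (dgraph_class G)"
    unfolding dgraph_rep_def by (rule someI)
  then show thesis using that by (auto simp: dgraph_class_members_class[OF G])
qed

lemma dgraph_class_cases:
  obtains G :: "(nat, 'd) dgraph" where "finite_graph (fst G)" "g = dgraph_class G"
proof -
  obtain G :: "(nat, 'd) dgraph" where G: "finite_graph (fst G)"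
    "dgraph_class_members g = {H. finite_graph (fst H) \<and> (\<exists>f. dgraph_iso f G H)}"
    using dgraph_class_members[of g] by blast
  then have "dgraph_class_members g = dgraph_class_members (dgraph_class G)"
    by (simp add: dgraph_class_members_class)
  then show thesis using that[OF G(1)] by (simp add: dgraph_class_members_inject)
qed

lemma dgraph_rep [simp]:
  "finite_graph (fst (dgraph_rep g))" "dgraph_class (dgraph_rep g) = g"
proof -
  obtain G :: "(nat, 'a) dgraph" where G: "finite_graph (fst G)" "g = dgraph_class G"
    by (rule dgraph_class_cases)
  then obtain f where f: "dgraph_iso f G (dgraph_rep g)" using dgraph_rep_class[OF G(1)] by metis
  show "finite_graph (fst (dgraph_rep g))" by (rule dgraph_iso_finite[OF G(1) f])
  show "dgraph_class (dgraph_rep g) = g" using dgraph_class_eqI[OF G(1) f] G(2) by simp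
qed

text \<open>
  An isomorphism of graphs preserves constant decorations, so the facts about isoclasses of graphs
  are instances of those about decorated graphs.
\<close>

lemma dgraph_iso_const: "dgraph_iso f (G, \<lambda>_. c) (H, \<lambda>_. c) \<longleftrightarrow> graph_iso f G H"
  by (simp add: dgraph_iso_def)

lemma graph_iso_finite: "finite_graph G \<Longrightarrow> graph_iso f G H \<Longrightarrow> finite_graph H"
  using dgraph_iso_finite[of "(G, \<lambda>_. 0 :: nat)" f "(H, \<lambda>_. 0)"] by (simp add: dgraph_iso_const)

lemma graph_iso_class_eq:
  fixes G :: "'v graph" and H :: "'w graph" and K :: "'u graph"
  assumes G: "finite_graph G" and f: "graph_iso f G H"
  shows "(\<exists>g. graph_iso g G K) \<longleftrightarrow> (\<exists>g. graph_iso g H K)"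
proof -
  let ?u = "\<lambda>G. (G, \<lambda>_. 0 :: nat)"
  have f': "dgraph_iso f (?u G) (?u H)" by (simp add: dgraph_iso_const f)
  have G': "finite_graph (fst (?u G))" by (simp add: G)
  have "dgraph_iso g (?u G) (?u K) \<Longrightarrow> \<exists>g. dgraph_iso g (?u H) (?u K)"
    "dgraph_iso h (?u H) (?u K) \<Longrightarrow> \<exists>g. dgraph_iso g (?u G) (?u K)" for g h
    using dgraph_iso_trans[OF G' f'] dgraph_iso_trans[OF dgraph_iso_finite[OF G' f'] dgraph_iso_sym[OF G' f']]
    by blast+
  then show ?thesis unfolding dgraph_iso_const by blast
qed

lemma graph_class_eqI:
  assumes "finite_graph G" "graph_iso f G H"
  shows "graph_class G = graph_class H"
  by (simp add: graph_class_def graph_iso_class_eq[OF assms])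

lemma graph_copy:
  fixes G :: "'v graph"
  assumes "finite_graph G"
  obtains f and H :: "nat graph" where "graph_iso f G H"
proof -
  obtain f and H :: "(nat, nat) dgraph" where "dgraph_iso f (G, \<lambda>_. 0) H"
    using dgraph_copy[of "(G, \<lambda>_. 0)"] assms by auto
  then show thesis using that[of f "fst H"] by (simp add: dgraph_iso_def)
qed

lemma graph_class_members_class:
  assumes G: "finite_graph G"
  shows "graph_class_members (graph_class G) = {H. finite_graph H \<and> (\<exists>f. graph_iso f G H)}"
proof -
  obtain f and H :: "nat graph" where f: "graph_iso f G H" using graph_copy[OF G] .
  have "graph_class_members (graph_class H) = {K. finite_graph K \<and> (\<exists>f. graph_iso f H K)}"
    unfolding graph_class_def
    by (rule Abs_graph_class_inverse) (use graph_iso_finite[OF G f] in blast)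
  then show ?thesis by (simp add: graph_class_eqI[OF G f] graph_iso_class_eq[OF G f])
qed

lemma graph_rep_class:
  assumes G: "finite_graph G"
  obtains f where "graph_iso f G (graph_rep (graph_class G))"
proof -
  obtain f and H :: "nat graph" where f: "graph_iso f G H" using graph_copy[OF G] .
  then have "H \<in> graph_class_members (graph_class G)"
    using graph_iso_finite[OF G f] by (auto simp: graph_class_members_class[OF G])
  then have "graph_rep (graph_class G) \<in> graph_class_members (graph_class G)"
    unfolding graph_rep_def by (rule someI)
  then show thesis using that by (auto simp: graph_class_members_class[OF G])
qed

lemma graph_rep [simp]:
  "finite_graph (graph_rep g)" "graph_class (graph_rep g) = g"
proof -
  obtain G :: "nat graph" where G: "finite_graph G"
    "graph_class_members g = {H. finite_graph H \<and> (\<exists>f. graph_iso f G H)}"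
    using graph_class_members[of g] by blast
  then have g: "g = graph_class G"
    by (simp add: graph_class_members_class graph_class_members_inject[symmetric])
  obtain f where f: "graph_iso f G (graph_rep g)" using graph_rep_class[OF G(1)] g by metis
  show "finite_graph (graph_rep g)" by (rule graph_iso_finite[OF G(1) f])
  show "graph_class (graph_rep g) = g" using graph_class_eqI[OF G(1) f] g by simp
qed

subsection \<open>Transport of the constructions along isomorphisms\<close>

definition dcontract_blocks ::
  "('v, 'd::ab_semigroup_add) dgraph \<Rightarrow> 'v set set \<Rightarrow> ('v set, 'd) dgraph" where
  "dcontract_blocks G P = (contract_blocks (fst G) P, semigroup_sum (snd G))"

definition dcut_blocks :: "('v, 'd) dgraph \<Rightarrow> 'v set set \<Rightarrow> ('v, 'd) dgraph" where
  "dcut_blocks G P = (cut_blocks (fst G) P, snd G)"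

lemma fst_dgraph [simp]:
  "fst (ddisj_union G H) = disj_union (fst G) (fst H)"
  "fst (dinduced G I) = induced (fst G) I"
  "fst (dcut_blocks G P) = cut_blocks (fst G) P"
  by (simp_all add: ddisj_union_def dinduced_def dcut_blocks_def)

lemma fst_dcontract_blocks [simp]: "fst (dcontract_blocks G P) = contract_blocks (fst G) P"
  by (simp add: dcontract_blocks_def)

lemma snd_dgraph [simp]:
  "snd (ddisj_union G H) = case_sum (snd G) (snd H)"
  "snd (dinduced G I) = snd G"
  "snd (dcut_blocks G P) = snd G"
  by (simp_all add: ddisj_union_def dinduced_def dcut_blocks_def)

lemma snd_dcontract_blocks [simp]: "snd (dcontract_blocks G P) = semigroup_sum (snd G)"
  by (simp add: dcontract_blocks_def)

lemma ddisj_union_iso: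
  assumes G: "finite_graph (fst G)" and H: "finite_graph (fst H)"
    and f: "dgraph_iso f G G'" and g: "dgraph_iso g H H'"
  shows "dgraph_iso (map_sum f g) (ddisj_union G H) (ddisj_union G' H')"
proof (rule dgraph_isoI)
  note D = dgraph_isoD[OF G f] and E = dgraph_isoD[OF H g]
  show "bij_betw (map_sum f g) (verts (fst (ddisj_union G H))) (verts (fst (ddisj_union G' H')))"
  proof -
    have "inj_on (map_sum f g) (verts (fst G) <+> verts (fst H))"
      by (rule inj_onI, elim PlusE) (use D(3) E(3) in \<open>simp_all add: inj_on_def\<close>)
    moreover have "map_sum f g ` (verts (fst G) <+> verts (fst H)) =
        f ` verts (fst G) <+> g ` verts (fst H)"
      by (simp add: Plus_def image_Un image_image)
    ultimately show ?thesis by (simp add: bij_betw_def D(2) E(2))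
  qed
  fix x y assume "x \<in> verts (fst (ddisj_union G H))" "y \<in> verts (fst (ddisj_union G H))"
  then show "{map_sum f g x, map_sum f g y} \<in> edges (fst (ddisj_union G' H')) \<longleftrightarrow>
      {x, y} \<in> edges (fst (ddisj_union G H))"
    by (cases x; cases y) (auto simp: D(4) E(4))
next
  fix x assume "x \<in> verts (fst (ddisj_union G H))"
  then show "snd (ddisj_union G' H') (map_sum f g x) = snd (ddisj_union G H) x"
    using dgraph_isoD(5)[OF G f] dgraph_isoD(5)[OF H g] by (cases x) auto
qed (use G H dgraph_iso_finite[OF G f] dgraph_iso_finite[OF H g] in simp_all)

lemma dinduced_iso:
  assumes G: "finite_graph (fst G)" and f: "dgraph_iso f G H" and I: "I \<subseteq> verts (fst G)"
  shows "dgraph_iso f (dinduced G I) (dinduced H (f ` I))"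
proof (rule dgraph_isoI)
  note D = dgraph_isoD[OF G f]
  show "bij_betw f (verts (fst (dinduced G I))) (verts (fst (dinduced H (f ` I))))"
    using D(3) I by (auto simp: bij_betw_def intro: inj_on_subset)
  show "finite_graph (fst (dinduced H (f ` I)))"
    using dgraph_iso_finite[OF G f] image_mono[OF I, of f] D(2) by simp
  fix x y assume "x \<in> verts (fst (dinduced G I))" "y \<in> verts (fst (dinduced G I))"
  then show "{f x, f y} \<in> edges (fst (dinduced H (f ` I))) \<longleftrightarrow> {x, y} \<in> edges (fst (dinduced G I))"
    using I D(4) by (auto simp: edges_induced)
qed (use G I dgraph_isoD(5)[OF G f] in auto)

lemma connected_partitions_image:
  assumes G: "finite_graph (fst G)" and f: "dgraph_iso f G H"
    and P: "P \<in> connected_partitions (fst G)"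
  shows "(`) f ` P \<in> connected_partitions (fst H)"
proof -
  note D = dgraph_isoD[OF G f] and P' = connected_partitionsD[OF P]
  have "(`) f ` P - {{}} = (`) f ` P" using P'(3) by auto
  then have "partition_on (verts (fst H)) ((`) f ` P)"
    using partition_on_inj_image[OF P'(1) D(3)] by (simp add: D(2))
  moreover have "connected_in (edges (fst H)) (f ` p)" if p: "p \<in> P" for p
    by (rule connected_in_image[OF P'(4)[OF p]]) (use D(4) P'(5)[OF p] in blast)
  ultimately show ?thesis by (auto simp: connected_partitions_def)
qed

lemma bij_betw_connected_partitions:
  assumes G: "finite_graph (fst G)" and f: "dgraph_iso f G H"
  shows "bij_betw ((`) ((`) f)) (connected_partitions (fst G)) (connected_partitions (fst H))"
proof -
  let ?g = "inv_into (verts (fst G)) f"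
  note D = dgraph_isoD[OF G f]
  have H: "finite_graph (fst H)" by (rule dgraph_iso_finite[OF G f])
  have inv: "(`) k ` (`) h ` P = P"
    if "\<Union>P \<subseteq> A" "\<And>x. x \<in> A \<Longrightarrow> k (h x) = x" for P and A :: "'x set" and h :: "'x \<Rightarrow> 'y" and k
  proof -
    have "k ` h ` p = p" if "p \<in> P" for p
    proof -
      have "k (h x) = x" if "x \<in> p" for x using that \<open>p \<in> P\<close> \<open>\<Union>P \<subseteq> A\<close> \<open>\<And>x. x \<in> A \<Longrightarrow> k (h x) = x\<close> by blast
      then show ?thesis by (simp add: image_image)
    qed
    then show ?thesis by (simp add: image_image)
  qed
  show ?thesis
  proof (rule bij_betw_byWitness[where f' = "(`) ((`) ?g)"])
    show "\<forall>P\<in>connected_partitions (fst G). (`) ?g ` (`) f ` P = P"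
    proof
      fix P assume "P \<in> connected_partitions (fst G)"
      then show "(`) ?g ` (`) f ` P = P"
        by (intro inv[of P "verts (fst G)"]) (simp_all add: connected_partitionsD(2) D(3))
    qed
    show "\<forall>P\<in>connected_partitions (fst H). (`) f ` (`) ?g ` P = P"
    proof
      fix P assume "P \<in> connected_partitions (fst H)"
      then show "(`) f ` (`) ?g ` P = P"
        by (intro inv[of P "verts (fst H)"])
          (simp_all add: connected_partitionsD(2) D(2)[symmetric] f_inv_into_f)
    qed
    show "(`) ((`) f) ` connected_partitions (fst G) \<subseteq> connected_partitions (fst H)"
      using connected_partitions_image[OF G f] by blast
    show "(`) ((`) ?g) ` connected_partitions (fst H) \<subseteq> connected_partitions (fst G)"
      using connected_partitions_image[OF H dgraph_iso_sym[OF G f]] by blast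
  qed
qed

lemma dcontract_blocks_iso:
  assumes G: "finite_graph (fst G)" and f: "dgraph_iso f G H"
    and P: "P \<in> connected_partitions (fst G)"
  shows "dgraph_iso ((`) f) (dcontract_blocks G P) (dcontract_blocks H ((`) f ` P))"
proof (rule dgraph_isoI)
  note D = dgraph_isoD[OF G f] and P' = connected_partitionsD[OF P]
  have finP: "finite P" using G P by simp
  then show "finite_graph (fst (dcontract_blocks G P))"
    "finite_graph (fst (dcontract_blocks H ((`) f ` P)))" by simp_all
  have inj: "inj_on ((`) f) P"
    by (rule inj_on_image) (simp add: P'(2) D(3))
  then show "bij_betw ((`) f) (verts (fst (dcontract_blocks G P)))
      (verts (fst (dcontract_blocks H ((`) f ` P))))"
    by (simp add: bij_betw_def)
  fix p assume "p \<in> verts (fst (dcontract_blocks G P))"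
  then have p: "p \<in> P" "p \<subseteq> verts (fst G)" using P'(5) by simp_all
  show "snd (dcontract_blocks H ((`) f ` P)) (f ` p) = snd (dcontract_blocks G P) p"
  proof -
    have fin: "finite p" "p \<noteq> {}" using p finite_verts[OF G] P'(3) by (auto intro: finite_subset)
    have "semigroup_sum (snd H) (f ` p) = semigroup_sum (\<lambda>x. snd H (f x)) p"
      by (rule semigroup_sum_image[OF fin inj_on_subset[OF D(3) p(2)]])
    also have "\<dots> = semigroup_sum (snd G) p"
      by (rule semigroup_sum_cong[OF fin]) (use D(5) p in blast)
    finally show ?thesis by simp
  qed
  fix q assume "q \<in> verts (fst (dcontract_blocks G P))"
  then have q: "q \<in> P" "q \<subseteq> verts (fst G)" using P'(5) by simp_all
  have adj: "{f x, f y} \<in> edges (fst H) \<longleftrightarrow> {x, y} \<in> edges (fst G)" if "x \<in> p" "y \<in> q" for x y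
    using D(4) p q that by blast
  have "f ` p = f ` q \<longleftrightarrow> p = q" using inj p q by (auto simp: inj_on_def)
  then show "{f ` p, f ` q} \<in> edges (fst (dcontract_blocks H ((`) f ` P))) \<longleftrightarrow>
      {p, q} \<in> edges (fst (dcontract_blocks G P))"
    by (simp add: adjacent_contract_blocks p q adj)
qed

lemma dcut_blocks_iso:
  assumes G: "finite_graph (fst G)" and f: "dgraph_iso f G H"
    and P: "P \<in> connected_partitions (fst G)"
  shows "dgraph_iso f (dcut_blocks G P) (dcut_blocks H ((`) f ` P))"
proof (rule dgraph_isoI)
  note D = dgraph_isoD[OF G f] and P' = connected_partitionsD[OF P]
  show "finite_graph (fst (dcut_blocks G P))" "finite_graph (fst (dcut_blocks H ((`) f ` P)))"
    using G dgraph_iso_finite[OF G f] by simp_all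
  show "bij_betw f (verts (fst (dcut_blocks G P))) (verts (fst (dcut_blocks H ((`) f ` P))))"
    using D(1) by simp
  fix x assume "x \<in> verts (fst (dcut_blocks G P))"
  then have x: "x \<in> verts (fst G)" by simp
  then show "snd (dcut_blocks H ((`) f ` P)) (f x) = snd (dcut_blocks G P) x" using D(5) by simp
  fix y assume "y \<in> verts (fst (dcut_blocks G P))"
  then have y: "y \<in> verts (fst G)" by simp
  have "z \<in> p" if "f z \<in> f ` p" "p \<in> P" "z \<in> verts (fst G)" for z p
    using inj_on_image_mem_iff[OF D(3) that(3) P'(5)[OF that(2)]] that(1) by simp
  then have "(\<exists>p\<in>P. f x \<in> f ` p \<and> f y \<in> f ` p) \<longleftrightarrow> (\<exists>p\<in>P. x \<in> p \<and> y \<in> p)"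
    using x y by blast
  then show "{f x, f y} \<in> edges (fst (dcut_blocks H ((`) f ` P))) \<longleftrightarrow>
      {x, y} \<in> edges (fst (dcut_blocks G P))"
    using D(4)[OF x y] by (simp add: edges_cut_blocks)
qed

lemma dcontract_blocks_contract_blocks:
  assumes G: "finite_graph (fst G)" and P: "P \<in> connected_partitions (fst G)"
    and Q: "Q \<in> connected_partitions (contract_blocks (fst G) P)"
  shows "dgraph_iso Union (dcontract_blocks (dcontract_blocks G P) Q)
           (dcontract_blocks G (Union ` Q))"
proof (rule dgraph_isoI)
  note P' = connected_partitionsD[OF P] and Q' = connected_partitionsD[OF Q, simplified]
  have finP: "finite P" using G P by simp
  have finQ: "finite Q" using Q finP by (intro finite_block[of "contract_blocks (fst G) P"]) simp_all
  then show "finite_graph (fst (dcontract_blocks (dcontract_blocks G P) Q))"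
    "finite_graph (fst (dcontract_blocks G (Union ` Q)))" by simp_all
  have inj: "inj_on Union Q"
  proof (rule inj_onI)
    fix q q' assume q: "q \<in> Q" and q': "q' \<in> Q" and eq: "\<Union>q = \<Union>q'"
    have "q = {p \<in> P. p \<subseteq> \<Union>q}" by (rule blocks_in_Union[OF P'(1) Q'(5)[OF q], symmetric])
    also have "\<dots> = q'" unfolding eq by (rule blocks_in_Union[OF P'(1) Q'(5)[OF q']])
    finally show "q = q'" .
  qed
  then show "bij_betw Union (verts (fst (dcontract_blocks (dcontract_blocks G P) Q)))
      (verts (fst (dcontract_blocks G (Union ` Q))))"
    by (simp add: bij_betw_def)
  fix q assume "q \<in> verts (fst (dcontract_blocks (dcontract_blocks G P) Q))"
  then have q: "q \<in> Q" by simp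
  have "semigroup_sum (snd G) (\<Union>q) = semigroup_sum (semigroup_sum (snd G)) q"
  proof (rule semigroup_sum_Union)
    show "finite q" by (rule finite_subset[OF Q'(5)[OF q] finP])
    show "q \<noteq> {}" using Q'(3) q by auto
    show "disjoint q" by (rule pairwise_subset[OF partition_onD2[OF P'(1)] Q'(5)[OF q]])
    fix p assume "p \<in> q"
    then have "p \<in> P" using Q'(5)[OF q] by blast
    then show "finite p \<and> p \<noteq> {}"
      using P'(3) P'(5)[of p] finite_subset[OF _ finite_verts[OF G]] by metis
  qed
  then show "snd (dcontract_blocks G (Union ` Q)) (\<Union>q) =
      snd (dcontract_blocks (dcontract_blocks G P) Q) q" by simp
  fix r assume "r \<in> verts (fst (dcontract_blocks (dcontract_blocks G P) Q))"
  then have r: "r \<in> Q" by simp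
  have ne: "\<Union>q = \<Union>r \<longleftrightarrow> q = r" using inj q r by (auto simp: inj_on_def)
  have "(\<exists>a\<in>q. \<exists>b\<in>r. {a, b} \<in> edges (contract_blocks (fst G) P)) \<longleftrightarrow>
      (\<exists>x\<in>\<Union>q. \<exists>y\<in>\<Union>r. {x, y} \<in> edges (fst G))" (is "?L \<longleftrightarrow> ?R") if "q \<noteq> r"
  proof
    assume ?R
    then obtain x y a b where ab: "a \<in> q" "b \<in> r" "x \<in> a" "y \<in> b" "{x, y} \<in> edges (fst G)" by blast
    have "a \<noteq> b" using Q'(6)[OF q r] ab(1,2) that by blast
    moreover have "a \<in> P" "b \<in> P" using Q'(5) q r ab by blast+
    ultimately have "{a, b} \<in> edges (contract_blocks (fst G) P)"
      unfolding adjacent_contract_blocks using ab by blast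
    then show ?L using ab by blast
  qed (unfold adjacent_contract_blocks, blast)
  then show "{\<Union>q, \<Union>r} \<in> edges (fst (dcontract_blocks G (Union ` Q))) \<longleftrightarrow>
      {q, r} \<in> edges (fst (dcontract_blocks (dcontract_blocks G P) Q))"
    using q r ne by (simp add: adjacent_contract_blocks[of _ _ _ Q] adjacent_contract_blocks[of _ _ _ "Union ` Q"]) blast
qed

lemma dcontract_blocks_singletons:
  assumes G: "finite_graph (fst G)"
  shows "dgraph_iso (\<lambda>x. {x}) G (dcontract_blocks G ((\<lambda>x. {x}) ` verts (fst G)))"
proof (rule dgraph_isoI[OF G])
  show "finite_graph (fst (dcontract_blocks G ((\<lambda>x. {x}) ` verts (fst G))))"
    using finite_verts[OF G] by simp
  fix x y assume "x \<in> verts (fst G)" "y \<in> verts (fst G)"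
  then show "{{x}, {y}} \<in> edges (fst (dcontract_blocks G ((\<lambda>x. {x}) ` verts (fst G)))) \<longleftrightarrow>
      {x, y} \<in> edges (fst G)"
    using adjacentD(1)[OF G, of x y] by (auto simp: adjacent_contract_blocks)
qed (simp_all add: bij_betw_def)

section \<open>The structure maps on isoclasses\<close>

text \<open>
  Disjoint union makes the isoclasses a commutative monoid, and the product is its bilinear extension.
\<close>

definition class_mult :: "'d dgraph_class \<Rightarrow> 'd dgraph_class \<Rightarrow> 'd dgraph_class" (infixl "\<odot>" 70) where
  "g \<odot> h = dgraph_class (ddisj_union (dgraph_rep g) (dgraph_rep h))"

abbreviation empty_class :: "'d dgraph_class" where
  "empty_class \<equiv> dgraph_class (empty_graph :: nat graph, \<lambda>_. undefined)"

lemma class_mult_class: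
  assumes G: "finite_graph (fst G)" and H: "finite_graph (fst H)"
  shows "dgraph_class G \<odot> dgraph_class H = dgraph_class (ddisj_union G H)"
proof -
  obtain f where f: "dgraph_iso f G (dgraph_rep (dgraph_class G))" using dgraph_rep_class[OF G] .
  obtain g where g: "dgraph_iso g H (dgraph_rep (dgraph_class H))" using dgraph_rep_class[OF H] .
  show ?thesis
    unfolding class_mult_def
    by (rule dgraph_class_eqI[OF _ ddisj_union_iso[OF G H f g], symmetric]) (simp add: G H)
qed

lemma dgraph_class_empty:
  assumes "finite_graph (fst G)" "verts (fst G) = {}"
  shows "dgraph_class G = empty_class"
  by (rule dgraph_class_eqI[of _ "\<lambda>_. 0"]) (use assms in \<open>auto intro!: dgraph_isoI simp: bij_betw_def\<close>)

lemma class_mult_comm: "g \<odot> h = h \<odot> g"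
proof -
  have "dgraph_iso (case_sum Inr Inl) (ddisj_union (dgraph_rep g) (dgraph_rep h))
      (ddisj_union (dgraph_rep h) (dgraph_rep g))"
  proof (rule dgraph_isoI)
    fix x y assume "x \<in> verts (fst (ddisj_union (dgraph_rep g) (dgraph_rep h)))"
      "y \<in> verts (fst (ddisj_union (dgraph_rep g) (dgraph_rep h)))"
    show "{case_sum Inr Inl x, case_sum Inr Inl y} \<in>
        edges (fst (ddisj_union (dgraph_rep h) (dgraph_rep g))) \<longleftrightarrow>
        {x, y} \<in> edges (fst (ddisj_union (dgraph_rep g) (dgraph_rep h)))"
      by (cases x; cases y) auto
  next
    show "bij_betw (case_sum Inr Inl) (verts (fst (ddisj_union (dgraph_rep g) (dgraph_rep h))))
        (verts (fst (ddisj_union (dgraph_rep h) (dgraph_rep g))))"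
      by (rule bij_betw_byWitness[where f' = "case_sum Inr Inl"]) auto
  qed (auto split: sum.splits)
  then show ?thesis unfolding class_mult_def by (intro dgraph_class_eqI) simp_all
qed

lemma class_mult_assoc: "(g \<odot> h) \<odot> k = g \<odot> (h \<odot> k)"
proof -
  let ?G = "dgraph_rep g" and ?H = "dgraph_rep h" and ?K = "dgraph_rep k"
  let ?L = "ddisj_union (ddisj_union ?G ?H) ?K" and ?R = "ddisj_union ?G (ddisj_union ?H ?K)"
  let ?f = "case_sum (case_sum Inl (Inr \<circ> Inl)) (Inr \<circ> Inr) :: (nat + nat) + nat \<Rightarrow> nat + (nat + nat)"
  have "dgraph_iso ?f ?L ?R"
  proof (rule dgraph_isoI)
    fix x y
    show "{?f x, ?f y} \<in> edges (fst ?R) \<longleftrightarrow> {x, y} \<in> edges (fst ?L)"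
      by (cases x rule: sum.exhaust[case_product sum.exhaust[of "projl x"]];
          cases y rule: sum.exhaust[case_product sum.exhaust[of "projl y"]]) auto
  next
    show "bij_betw ?f (verts (fst ?L)) (verts (fst ?R))"
      by (rule bij_betw_byWitness[where f' = "case_sum (Inl \<circ> Inl) (case_sum (Inl \<circ> Inr) Inr)"]) auto
  qed (auto split: sum.splits)
  then have "dgraph_class ?L = dgraph_class ?R" by (intro dgraph_class_eqI) simp_all
  moreover have "dgraph_class ?L = (g \<odot> h) \<odot> k" "dgraph_class ?R = g \<odot> (h \<odot> k)"
    by (simp_all add: class_mult_class[symmetric])
  ultimately show ?thesis by simp
qed

lemma class_mult_empty: "g \<odot> empty_class = g"
proof -
  let ?G = "dgraph_rep g" and ?E = "(empty_graph :: nat graph, \<lambda>_. undefined)"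
  have "dgraph_iso Inl ?G (ddisj_union ?G ?E)"
    by (rule dgraph_isoI) (auto simp: bij_betw_def)
  then have "dgraph_class ?G = dgraph_class (ddisj_union ?G ?E)" by (intro dgraph_class_eqI) simp_all
  also have "\<dots> = dgraph_class ?G \<odot> empty_class"
    by (rule class_mult_class[symmetric]) simp_all
  finally show ?thesis by simp
qed

text \<open>
  Disjoint unions inside a given graph: with them, the identities that involve the product reduce to
  equalities of graphs on one vertex set.
\<close>

definition splits :: "'v graph \<Rightarrow> 'v set \<Rightarrow> 'v set \<Rightarrow> bool" where
  "splits G A B \<longleftrightarrow> verts G = A \<union> B \<and> A \<inter> B = {} \<and> (\<forall>e\<in>edges G. e \<subseteq> A \<or> e \<subseteq> B)"

lemma class_mult_splits:
  assumes G: "finite_graph (fst G)" and s: "splits (fst G) A B"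
  shows "dgraph_class (dinduced G A) \<odot> dgraph_class (dinduced G B) = dgraph_class G"
proof -
  have AB: "A \<subseteq> verts (fst G)" "B \<subseteq> verts (fst G)" "A \<inter> B = {}"
    using s by (auto simp: splits_def)
  have "dgraph_iso (case_sum id id) (ddisj_union (dinduced G A) (dinduced G B)) G"
  proof (rule dgraph_isoI)
    show "finite_graph (fst (ddisj_union (dinduced G A) (dinduced G B)))" using G AB by simp
    have "inj_on (case_sum id id) (A <+> B)" using AB(3) by (auto simp: inj_on_def)
    moreover have "case_sum id id ` (A <+> B) = verts (fst G)"
      using s by (auto simp: splits_def Plus_def image_Un image_image)
    ultimately show "bij_betw (case_sum id id)
        (verts (fst (ddisj_union (dinduced G A) (dinduced G B)))) (verts (fst G))"
      by (simp add: bij_betw_def)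
    fix x y assume "x \<in> verts (fst (ddisj_union (dinduced G A) (dinduced G B)))"
      "y \<in> verts (fst (ddisj_union (dinduced G A) (dinduced G B)))"
    moreover have "{a, b} \<notin> edges (fst G)" "{b, a} \<notin> edges (fst G)" if "a \<in> A" "b \<in> B" for a b
    proof -
      show "{a, b} \<notin> edges (fst G)"
      proof
      assume "{a, b} \<in> edges (fst G)"
      then have "{a, b} \<subseteq> A \<or> {a, b} \<subseteq> B" using s by (simp only: splits_def)
      then show False using AB(3) that by auto
      qed
      then show "{b, a} \<notin> edges (fst G)" by (subst insert_commute)
    qed
    ultimately show "{case_sum id id x, case_sum id id y} \<in> edges (fst G) \<longleftrightarrow>
        {x, y} \<in> edges (fst (ddisj_union (dinduced G A) (dinduced G B)))"
      by (cases x; cases y) (auto simp: edges_induced)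
  qed (use G in \<open>auto split: sum.splits\<close>)
  then show ?thesis
    by (subst class_mult_class) (use G AB in \<open>auto intro: dgraph_class_eqI\<close>)
qed

lemma class_pair_cases:
  obtains K :: "(nat + nat, 'd) dgraph" and A B where
    "finite_graph (fst K)" "splits (fst K) A B"
    "g = dgraph_class (dinduced K A)" "h = dgraph_class (dinduced K B)"
proof
  let ?G = "dgraph_rep g" and ?H = "dgraph_rep h"
  let ?K = "ddisj_union ?G ?H"
  let ?A = "Inl ` verts (fst ?G)" and ?B = "Inr ` verts (fst ?H)"
  show K: "finite_graph (fst ?K)" by simp
  have sub: "e \<subseteq> verts G" if "finite_graph G" "e \<in> edges G" for e and G :: "nat graph"
    using that by (simp add: finite_graph_def)
  have "e \<subseteq> ?A \<or> e \<subseteq> ?B" if "e \<in> edges (fst ?K)" for e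
  proof -
    from that consider d where "d \<in> edges (fst ?G)" "e = Inl ` d"
      | d where "d \<in> edges (fst ?H)" "e = Inr ` d"
      by (auto simp: disj_union_def)
    then show ?thesis
    proof cases
      case 1
      then have "e \<subseteq> ?A" using image_mono[OF sub[OF dgraph_rep(1)]] by simp
      then show ?thesis ..
    next
      case 2
      then have "e \<subseteq> ?B" using image_mono[OF sub[OF dgraph_rep(1)]] by simp
      then show ?thesis ..
    qed
  qed
  moreover have "?A \<inter> ?B = {}" by blast
  ultimately show "splits (fst ?K) ?A ?B" by (simp add: splits_def Plus_def)
  have "dgraph_iso Inl ?G (dinduced ?K ?A)"
    by (rule dgraph_isoI) (auto simp: bij_betw_def edges_induced intro!: finite_induced)
  then have "dgraph_class ?G = dgraph_class (dinduced ?K ?A)" by (intro dgraph_class_eqI) simp_all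
  then show "g = dgraph_class (dinduced ?K ?A)" by simp
  have "dgraph_iso Inr ?H (dinduced ?K ?B)"
    by (rule dgraph_isoI) (auto simp: bij_betw_def edges_induced intro!: finite_induced)
  then have "dgraph_class ?H = dgraph_class (dinduced ?K ?B)" by (intro dgraph_class_eqI) simp_all
  then show "h = dgraph_class (dinduced ?K ?B)" by simp
qed

lemma dgraph_mult_class: "dgraph_mult (basis_vec (g, h)) = basis_vec (g \<odot> h)"
  by (simp add: dgraph_mult_def class_mult_def)

text \<open>
  The structure maps may be computed on any graph of the class, on any type of vertices, instead of
  the chosen representative.
\<close>

lemma dgraph_Delta_class:
  assumes G: "finite_graph (fst G)"
  shows "dgraph_Delta (basis_vec (dgraph_class G)) =
    (\<Sum>I\<in>Pow (verts (fst G)).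
       basis_vec (dgraph_class (dinduced G I), dgraph_class (dinduced G (verts (fst G) - I))))"
proof -
  let ?R = "dgraph_rep (dgraph_class G)"
  obtain f where f: "dgraph_iso f G ?R" using dgraph_rep_class[OF G] .
  note D = dgraph_isoD[OF G f]
  have "dgraph_Delta (basis_vec (dgraph_class G)) = (\<Sum>I\<in>Pow (verts (fst ?R)).
      basis_vec (dgraph_class (dinduced ?R I), dgraph_class (dinduced ?R (verts (fst ?R) - I))))"
    by (simp add: dgraph_Delta_def Let_def)
  also have "\<dots> = (\<Sum>I\<in>Pow (verts (fst G)). basis_vec (dgraph_class (dinduced ?R (f ` I)),
      dgraph_class (dinduced ?R (verts (fst ?R) - f ` I))))"
    by (rule sum.reindex_bij_betw[OF bij_betw_Pow[OF D(1)], symmetric])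
  also have "\<dots> = (\<Sum>I\<in>Pow (verts (fst G)).
       basis_vec (dgraph_class (dinduced G I), dgraph_class (dinduced G (verts (fst G) - I))))"
  proof (rule sum.cong[OF refl])
    fix I assume I: "I \<in> Pow (verts (fst G))"
    have iso: "dgraph_class (dinduced ?R (f ` J)) = dgraph_class (dinduced G J)"
      if "J \<subseteq> verts (fst G)" for J
      by (rule dgraph_class_eqI[OF _ dinduced_iso[OF G f that], symmetric]) (simp add: G that)
    have "verts (fst ?R) - f ` I = f ` (verts (fst G) - I)"
      unfolding D(2)[symmetric] using I by (intro inj_on_image_set_diff[OF D(3), symmetric]) auto
    then show "basis_vec (dgraph_class (dinduced ?R (f ` I)),
        dgraph_class (dinduced ?R (verts (fst ?R) - f ` I))) =
      basis_vec (dgraph_class (dinduced G I), dgraph_class (dinduced G (verts (fst G) - I)))"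
      using I by (simp add: iso)
  qed
  finally show ?thesis .
qed

lemma dgraph_delta_class:
  assumes G: "finite_graph (fst G)"
  shows "dgraph_delta (basis_vec (dgraph_class G)) =
    (\<Sum>P\<in>connected_partitions (fst G).
       basis_vec (dgraph_class (dcontract_blocks G P), dgraph_class (dcut_blocks G P)))"
proof -
  let ?R = "dgraph_rep (dgraph_class G)"
  let ?t = "\<lambda>G P. basis_vec (dgraph_class (dcontract_blocks G P), dgraph_class (dcut_blocks G P))"
  obtain f where f: "dgraph_iso f G ?R" using dgraph_rep_class[OF G] .
  have "dgraph_delta (basis_vec (dgraph_class G)) =
      (\<Sum>r\<in>admissible (fst ?R). basis_vec (dgraph_class (dcontract ?R r), dgraph_class (dcut ?R r)))"
    by (simp add: dgraph_delta_def Let_def)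
  also have "\<dots> = (\<Sum>r\<in>admissible (fst ?R). ?t ?R (verts (fst ?R) // r))"
    by (rule sum.cong) (simp_all add: dcontract_def dcut_def dcontract_blocks_def dcut_blocks_def
        contract_eq_contract_blocks cut_eq_cut_blocks)
  also have "\<dots> = (\<Sum>P\<in>connected_partitions (fst ?R). ?t ?R P)"
    by (rule sum.reindex_bij_betw[OF bij_betw_admissible])
  also have "\<dots> = (\<Sum>P\<in>connected_partitions (fst G). ?t ?R ((`) f ` P))"
    by (rule sum.reindex_bij_betw[OF bij_betw_connected_partitions[OF G f], symmetric])
  also have "\<dots> = (\<Sum>P\<in>connected_partitions (fst G). ?t G P)"
  proof (rule sum.cong[OF refl])
    fix P assume P: "P \<in> connected_partitions (fst G)"
    have "dgraph_class (dcontract_blocks G P) = dgraph_class (dcontract_blocks ?R ((`) f ` P))"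
      by (rule dgraph_class_eqI[OF _ dcontract_blocks_iso[OF G f P]]) (simp add: finite_block[OF G P])
    moreover have "dgraph_class (dcut_blocks G P) = dgraph_class (dcut_blocks ?R ((`) f ` P))"
      by (rule dgraph_class_eqI[OF _ dcut_blocks_iso[OF G f P]]) (simp add: G)
    ultimately show "?t ?R ((`) f ` P) = ?t G P" by simp
  qed
  finally show ?thesis .
qed

lemma dgraph_eps_class:
  assumes G: "finite_graph (fst G)"
  shows "dgraph_eps (basis_vec (dgraph_class G)) = (if verts (fst G) = {} then 1 else 0)"
proof -
  obtain f where f: "dgraph_iso f G (dgraph_rep (dgraph_class G))" using dgraph_rep_class[OF G] .
  from dgraph_isoD(2)[OF G f] have "verts (fst (dgraph_rep (dgraph_class G))) = {} \<longleftrightarrow> verts (fst G) = {}"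
    by auto
  then show ?thesis by (simp add: dgraph_eps_def)
qed

lemma dgraph_eps'_class:
  assumes G: "finite_graph (fst G)"
  shows "dgraph_eps' (basis_vec (dgraph_class G)) = (if edges (fst G) = {} then 1 else 0)"
proof -
  obtain f where f: "dgraph_iso f G (dgraph_rep (dgraph_class G))" using dgraph_rep_class[OF G] .
  then have "edges (fst (dgraph_rep (dgraph_class G))) = (`) f ` edges (fst G)"
    by (simp add: dgraph_iso_def graph_iso_def)
  then show ?thesis by (simp add: dgraph_eps'_def)
qed

lemma qlinear_dgraph [simp]:
  "qlinear dgraph_mult" "qlinear dgraph_Delta" "qlinear dgraph_delta" "qlinear forget"
  "qlinear_form dgraph_eps" "qlinear_form dgraph_eps'"
  by (simp_all add: dgraph_mult_def dgraph_Delta_def dgraph_delta_def forget_def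
      dgraph_eps_def dgraph_eps'_def)

lemmas dgraph_linear_simps [simp] =
  qlinear_simps[OF qlinear_dgraph(1)] qlinear_simps[OF qlinear_dgraph(2)]
  qlinear_simps[OF qlinear_dgraph(3)] qlinear_simps[OF qlinear_dgraph(4)]
  qlinear_form_simps[OF qlinear_dgraph(5)] qlinear_form_simps[OF qlinear_dgraph(6)]

section \<open>The bialgebra of the coproduct by induced subgraphs\<close>

lemma dinduced_dinduced: "J \<subseteq> I \<Longrightarrow> dinduced (dinduced G I) J = dinduced G J"
  by (simp add: dinduced_def induced_induced)

lemma dgraph_Delta_induced:
  assumes G: "finite_graph (fst G)" and I: "I \<subseteq> verts (fst G)"
  shows "dgraph_Delta (basis_vec (dgraph_class (dinduced G I))) =
    (\<Sum>J\<in>Pow I. basis_vec (dgraph_class (dinduced G J), dgraph_class (dinduced G (I - J))))"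
  by (subst dgraph_Delta_class) (auto simp: G I dinduced_dinduced intro!: sum.cong)

text \<open>
  Both sides are indexed by the ordered partitions of the vertex set into three possibly empty
  parts.
\<close>

lemma dgraph_Delta_coassoc:
  "tensor_assoc (tensor_map dgraph_Delta id (dgraph_Delta (basis_vec g))) =
     tensor_map id dgraph_Delta (dgraph_Delta (basis_vec g))"
proof -
  obtain G :: "(nat, 'a) dgraph" where G: "finite_graph (fst G)" and g: "g = dgraph_class G"
    by (rule dgraph_class_cases)
  let ?V = "verts (fst G)" and ?c = "\<lambda>I. dgraph_class (dinduced G I)"
  have fin: "finite ?V" by (rule finite_verts[OF G])
  then have fin': "finite I" if "I \<subseteq> ?V" for I using that by (rule rev_finite_subset)
  have diff: "A - J - (I - J) = A - I" if "J \<subseteq> I" for A I J :: "nat set" using that by blast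
  have "tensor_assoc (tensor_map dgraph_Delta id (dgraph_Delta (basis_vec g))) =
      (\<Sum>I\<in>Pow ?V. \<Sum>J\<in>Pow I. basis_vec (?c J, (?c (I - J), ?c (?V - I))))"
    by (simp add: g dgraph_Delta_class[OF G], rule sum.cong) (simp_all add: dgraph_Delta_induced[OF G])
  also have "\<dots> = (\<Sum>(I, J)\<in>Sigma (Pow ?V) Pow. basis_vec (?c J, (?c (I - J), ?c (?V - I))))"
    by (rule sum.Sigma) (use fin fin' in auto)
  also have "\<dots> = (\<Sum>(I, J)\<in>Sigma (Pow ?V) (\<lambda>I. Pow (?V - I)).
      basis_vec (?c I, (?c J, ?c (?V - I - J))))"
    by (rule sum.reindex_bij_witness[where i = "\<lambda>(I, J). (I \<union> J, I)" and j = "\<lambda>(I, J). (J, I - J)"])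
      (auto simp: diff Diff_partition)
  also have "\<dots> = (\<Sum>I\<in>Pow ?V. \<Sum>J\<in>Pow (?V - I). basis_vec (?c I, (?c J, ?c (?V - I - J))))"
    by (rule sum.Sigma[symmetric]) (use fin in auto)
  also have "\<dots> = tensor_map id dgraph_Delta (dgraph_Delta (basis_vec g))"
    by (simp add: g dgraph_Delta_class[OF G], rule sum.cong) (simp_all add: dgraph_Delta_induced[OF G])
  finally show ?thesis .
qed

lemma dgraph_Delta_counit:
  "form_left dgraph_eps (dgraph_Delta (basis_vec g)) = basis_vec g"
  "form_right dgraph_eps (dgraph_Delta (basis_vec g)) = basis_vec g"
proof -
  obtain G :: "(nat, 'a) dgraph" where G: "finite_graph (fst G)" and g: "g = dgraph_class G"
    by (rule dgraph_class_cases)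
  let ?V = "verts (fst G)" and ?c = "\<lambda>I. dgraph_class (dinduced G I)"
  have fin: "finite (Pow ?V)" using finite_verts[OF G] by simp
  have cV: "?c ?V = g" by (simp add: g dinduced_def induced_verts[OF G])
  have eps: "dgraph_eps (basis_vec (?c I)) = (if I = {} then 1 else 0)" if "I \<subseteq> ?V" for I
    using that by (subst dgraph_eps_class) (simp_all add: G)
  have "form_left dgraph_eps (dgraph_Delta (basis_vec g)) =
      (\<Sum>I\<in>Pow ?V. if I = {} then basis_vec g else 0)"
    by (simp add: g dgraph_Delta_class[OF G], rule sum.cong) (auto simp: eps cV g)
  then show "form_left dgraph_eps (dgraph_Delta (basis_vec g)) = basis_vec g"
    by (simp add: sum.delta[OF fin])
  have "form_right dgraph_eps (dgraph_Delta (basis_vec g)) =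
      (\<Sum>I\<in>Pow ?V. if I = ?V then basis_vec g else 0)"
    by (simp add: g dgraph_Delta_class[OF G], rule sum.cong) (auto simp: eps cV g)
  then show "form_right dgraph_eps (dgraph_Delta (basis_vec g)) = basis_vec g"
    by (simp add: sum.delta[OF fin])
qed

lemma class_mult_induced:
  assumes K: "finite_graph (fst K)" and s: "splits (fst K) A B" and I: "I \<subseteq> A" "J \<subseteq> B"
  shows "dgraph_class (dinduced K I) \<odot> dgraph_class (dinduced K J) =
    dgraph_class (dinduced K (I \<union> J))"
proof -
  have "I \<union> J \<subseteq> verts (fst K)" using s I by (auto simp: splits_def)
  moreover have "splits (fst (dinduced K (I \<union> J))) I J"
  proof -
    have AB: "A \<inter> B = {}" using s by (simp add: splits_def)
    have "e \<subseteq> I \<or> e \<subseteq> J" if e: "e \<in> edges (fst K)" "e \<subseteq> I \<union> J" for e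
    proof -
      have "e \<subseteq> A \<or> e \<subseteq> B" using s e(1) by (simp only: splits_def)
      then show ?thesis using e(2) I AB by blast
    qed
    moreover have "I \<inter> J = {}" using I AB by blast
    ultimately show ?thesis by (simp add: splits_def edges_induced)
  qed
  ultimately show ?thesis
    using class_mult_splits[of "dinduced K (I \<union> J)" I J] K by (simp add: dinduced_dinduced)
qed

lemma dgraph_Delta_mult:
  "dgraph_Delta (dgraph_mult (basis_vec (g, h))) =
     tensor_mult dgraph_mult (tensor (dgraph_Delta (basis_vec g)) (dgraph_Delta (basis_vec h)))"
proof -
  obtain K :: "(nat + nat, 'a) dgraph" and A B where K: "finite_graph (fst K)"
    and s: "splits (fst K) A B"
    and g: "g = dgraph_class (dinduced K A)" and h: "h = dgraph_class (dinduced K B)"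
    by (rule class_pair_cases)
  let ?c = "\<lambda>I. dgraph_class (dinduced K I)"
  have AB: "verts (fst K) = A \<union> B" "A \<subseteq> verts (fst K)" "B \<subseteq> verts (fst K)" "A \<inter> B = {}"
    using s by (auto simp: splits_def)
  have fin: "finite A" "finite B" using finite_verts[OF K] AB(1) by auto
  have gh: "g \<odot> h = dgraph_class K" unfolding g h by (rule class_mult_splits[OF K s])
  have "tensor_mult dgraph_mult (tensor (dgraph_Delta (basis_vec g)) (dgraph_Delta (basis_vec h))) =
      (\<Sum>I\<in>Pow A. \<Sum>J\<in>Pow B. basis_vec (?c I \<odot> ?c J, ?c (A - I) \<odot> ?c (B - J)))"
    by (simp add: g h dgraph_Delta_induced[OF K] AB(2,3) dgraph_mult_class) (rule sum.swap)
  also have "\<dots> = (\<Sum>I\<in>Pow A. \<Sum>J\<in>Pow B. basis_vec (?c (I \<union> J), ?c ((A \<union> B) - (I \<union> J))))"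
  proof (intro sum.cong refl)
    fix I J assume "I \<in> Pow A" "J \<in> Pow B"
    moreover from this AB(4) have "(A \<union> B) - (I \<union> J) = (A - I) \<union> (B - J)" by blast
    ultimately show "basis_vec (?c I \<odot> ?c J, ?c (A - I) \<odot> ?c (B - J)) =
        basis_vec (?c (I \<union> J), ?c ((A \<union> B) - (I \<union> J)))"
      using class_mult_induced[OF K s] by simp
  qed
  also have "\<dots> = (\<Sum>(I, J)\<in>Pow A \<times> Pow B. basis_vec (?c (I \<union> J), ?c ((A \<union> B) - (I \<union> J))))"
    by (rule sum.cartesian_product)
  also have "\<dots> = (\<Sum>I\<in>Pow (A \<union> B). basis_vec (?c I, ?c ((A \<union> B) - I)))"
    by (rule sum.reindex_bij_witness[where i = "\<lambda>I. (I \<inter> A, I \<inter> B)" and j = "\<lambda>(I, J). I \<union> J"])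
      (use AB(4) in auto)
  also have "\<dots> = dgraph_Delta (dgraph_mult (basis_vec (g, h)))"
    by (simp add: dgraph_mult_class gh dgraph_Delta_class[OF K] AB(1))
  finally show ?thesis by simp
qed

lemma dgraph_mult_assoc:
  "dgraph_mult (tensor (dgraph_mult (basis_vec (g, h))) (basis_vec k)) =
     dgraph_mult (tensor (basis_vec g) (dgraph_mult (basis_vec (h, k))))"
  by (simp add: dgraph_mult_class class_mult_assoc)

lemma dgraph_mult_unit:
  "dgraph_mult (tensor dgraph_unit (basis_vec g)) = basis_vec g"
  "dgraph_mult (tensor (basis_vec g) dgraph_unit) = basis_vec g"
  using class_mult_empty[of g] class_mult_comm[of g]
  by (simp_all add: dgraph_unit_def dgraph_mult_class)

lemma dgraph_bialgebra_Delta: "bialgebra dgraph_unit dgraph_mult dgraph_Delta dgraph_eps"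
proof (rule bialgebraI_basis)
  show "dgraph_Delta dgraph_unit = tensor (dgraph_unit :: 'd dgraph_class qvec) dgraph_unit"
    by (simp add: dgraph_unit_def dgraph_Delta_class dinduced_def induced_empty)
  show "dgraph_eps (dgraph_unit :: 'd dgraph_class qvec) = 1"
    by (simp add: dgraph_unit_def dgraph_eps_class)
  fix g h :: "'d dgraph_class"
  obtain G H :: "(nat, 'd) dgraph" where "finite_graph (fst G)" "g = dgraph_class G"
    "finite_graph (fst H)" "h = dgraph_class H"
    using dgraph_class_cases by metis
  then show "dgraph_eps (dgraph_mult (basis_vec (g, h))) =
      dgraph_eps (basis_vec g) * dgraph_eps (basis_vec h)"
    by (auto simp: dgraph_mult_class class_mult_class dgraph_eps_class)
qed (simp_all add: dgraph_mult_assoc dgraph_mult_unit dgraph_Delta_coassoc dgraph_Delta_counit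
    dgraph_Delta_mult)

text \<open>
  The term \<open>I = V\<close> of the coproduct is \<open>g \<otimes> 1\<close>, and in all other terms the left factor has fewer
  vertices.
\<close>

lemma dgraph_antipode_exists:
  "\<exists>S. antipode (dgraph_unit :: 'd dgraph_class qvec) dgraph_mult dgraph_Delta dgraph_eps S"
proof (rule antipode_exists)
  let ?V = "\<lambda>g. verts (fst (dgraph_rep g))" and ?c = "\<lambda>g I. dgraph_class (dinduced (dgraph_rep g) I)"
  show "algebra (dgraph_unit :: 'd dgraph_class qvec) dgraph_mult"
    "coalgebra dgraph_Delta (dgraph_eps :: 'd dgraph_class qvec \<Rightarrow> rat)"
    using dgraph_bialgebra_Delta[where 'a = 'd] by (simp_all add: bialgebra_def)
  show "dgraph_mult (basis_vec (g, h)) = dgraph_mult (basis_vec (h, g))" for g h :: "'d dgraph_class"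
    by (simp add: dgraph_mult_class class_mult_comm)
  have \<Delta>: "dgraph_Delta (basis_vec g) = (\<Sum>I\<in>Pow (?V g). basis_vec (?c g I, ?c g (?V g - I)))"
    for g :: "'d dgraph_class"
    using dgraph_Delta_class[of "dgraph_rep g"] by simp
  show "lin_ext (\<lambda>(a, b). basis_vec (b, a)) (dgraph_Delta (basis_vec g)) = dgraph_Delta (basis_vec g)"
    for g :: "'d dgraph_class"
  proof -
    have "(\<Sum>I\<in>Pow (?V g). basis_vec (?c g (?V g - I), ?c g I)) =
        (\<Sum>I\<in>Pow (?V g). basis_vec (?c g I, ?c g (?V g - I)))"
      by (rule sum.reindex_bij_witness[where i = "\<lambda>I. ?V g - I" and j = "\<lambda>I. ?V g - I"])
        (auto simp: double_diff)
    then show ?thesis by (simp add: \<Delta>)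
  qed
  fix g :: "'d dgraph_class"
  have "?c g (?V g) = g" by (simp add: dinduced_def induced_verts)
  moreover have "?c g {} = empty_class" by (rule dgraph_class_empty) simp_all
  ultimately show "dgraph_Delta (basis_vec g) = tensor (basis_vec g) dgraph_unit +
      (\<Sum>I\<in>Pow (?V g) - {?V g}. basis_vec (?c g I, ?c g (?V g - I)))"
    unfolding \<Delta>
    by (subst sum.remove[of _ "?V g"]) (simp_all add: finite_verts dgraph_unit_def)
  fix I assume "I \<in> Pow (?V g) - {?V g}"
  then have I: "I \<subset> ?V g" by blast
  have fin: "finite_graph (fst (dinduced (dgraph_rep g) I))" using I by simp
  obtain f where f: "dgraph_iso f (dinduced (dgraph_rep g) I) (dgraph_rep (?c g I))"
    using dgraph_rep_class[OF fin] .
  have "card (?V (?c g I)) = card I"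
    using bij_betw_same_card[OF dgraph_isoD(1)[OF fin f]] by simp
  also have "\<dots> < card (?V g)" by (rule psubset_card_mono[OF finite_verts I]) simp
  finally show "card (?V (?c g I)) < card (?V g)" .
qed

section \<open>The bialgebra of the coproduct by contraction\<close>

lemma finite_dgraph [simp]:
  assumes "finite_graph (fst G)"
  shows "finite_graph (fst (dcut_blocks G P))"
    and "P \<in> connected_partitions (fst G) \<Longrightarrow> finite_graph (fst (dcontract_blocks G P))"
    and "I \<subseteq> verts (fst G) \<Longrightarrow> finite_graph (fst (dinduced G I))"
  using assms finite_block[OF assms] by simp_all

text \<open>
  The bijection sends \<open>(P, Q)\<close> to \<open>(T, P)\<close> with \<open>T = \<Union> ` Q\<close>; conversely \<open>Q\<close> groups the blocks of \<open>P\<close>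
  according to the block of \<open>T\<close> that contains them.
\<close>

lemma dgraph_delta_coassoc:
  fixes g :: "'d::ab_semigroup_add dgraph_class"
  shows "tensor_assoc (tensor_map dgraph_delta id (dgraph_delta (basis_vec g))) =
     tensor_map id dgraph_delta (dgraph_delta (basis_vec g))"
proof -
  obtain G :: "(nat, 'd) dgraph" where G: "finite_graph (fst G)" and g: "g = dgraph_class G"
    by (rule dgraph_class_cases)
  let ?C = "connected_partitions" and ?c = "dgraph_class"
  let ?blocks = "\<lambda>P t. {p \<in> P. p \<subseteq> t}"
  have "tensor_assoc (tensor_map dgraph_delta id (dgraph_delta (basis_vec g))) =
      (\<Sum>P\<in>?C (fst G). \<Sum>Q\<in>?C (contract_blocks (fst G) P).
         basis_vec (?c (dcontract_blocks (dcontract_blocks G P) Q),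
           (?c (dcut_blocks (dcontract_blocks G P) Q), ?c (dcut_blocks G P))))"
    by (simp add: g dgraph_delta_class[OF G], rule sum.cong)
      (simp_all add: dgraph_delta_class finite_dgraph[OF G] finite_block[OF G])
  also have "\<dots> = (\<Sum>(P, Q)\<in>Sigma (?C (fst G)) (\<lambda>P. ?C (contract_blocks (fst G) P)).
         basis_vec (?c (dcontract_blocks (dcontract_blocks G P) Q),
           (?c (dcut_blocks (dcontract_blocks G P) Q), ?c (dcut_blocks G P))))"
    by (rule sum.Sigma) (simp_all add: G finite_block[OF G])
  also have "\<dots> = (\<Sum>(T, P)\<in>Sigma (?C (fst G)) (\<lambda>T. ?C (cut_blocks (fst G) T)).
         basis_vec (?c (dcontract_blocks G T),
           (?c (dcontract_blocks (dcut_blocks G T) P), ?c (dcut_blocks (dcut_blocks G T) P))))"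
  proof (rule sum.reindex_bij_witness[where i = "\<lambda>(T, P). (P, ?blocks P ` T)"
        and j = "\<lambda>(P, Q). (Union ` Q, P)"])
    fix PQ assume "PQ \<in> Sigma (?C (fst G)) (\<lambda>P. ?C (contract_blocks (fst G) P))"
    then obtain P Q where PQ: "PQ = (P, Q)" and P: "P \<in> ?C (fst G)"
      and Q: "Q \<in> ?C (contract_blocks (fst G) P)" by blast
    note co = connected_partitions_coarsen[OF G P Q]
    show "(\<lambda>(T, P). (P, ?blocks P ` T)) ((\<lambda>(P, Q). (Union ` Q, P)) PQ) = PQ"
      by (simp only: PQ prod.case co(3))
    show "(\<lambda>(P, Q). (Union ` Q, P)) PQ \<in> Sigma (?C (fst G)) (\<lambda>T. ?C (cut_blocks (fst G) T))"
      by (simp only: PQ prod.case mem_Sigma_iff co(1,2))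
    have fin: "finite_graph (fst (dcontract_blocks (dcontract_blocks G P) Q))"
      using finite_block[OF finite_contract_blocks[OF finite_block[OF G P]] Q] by simp
    have "?c (dcontract_blocks G (Union ` Q)) = ?c (dcontract_blocks (dcontract_blocks G P) Q)"
      by (rule dgraph_class_eqI[OF fin dcontract_blocks_contract_blocks[OF G P Q], symmetric])
    moreover have "dcontract_blocks (dcut_blocks G (Union ` Q)) P =
        dcut_blocks (dcontract_blocks G P) Q"
      using cut_blocks_contract_blocks[OF G P Q] by (simp add: dcontract_blocks_def dcut_blocks_def)
    moreover have "\<forall>p\<in>P. \<exists>t\<in>Union ` Q. p \<subseteq> t"
      using co(2) connected_partitions_cut_blocks[OF G connected_partitionsD(1)[OF co(1)]] by blast
    then have "dcut_blocks (dcut_blocks G (Union ` Q)) P = dcut_blocks G P"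
      by (simp add: dcut_blocks_def cut_blocks_cut_blocks)
    ultimately show "(case (\<lambda>(P, Q). (Union ` Q, P)) PQ of (T, P) \<Rightarrow>
          basis_vec (?c (dcontract_blocks G T),
           (?c (dcontract_blocks (dcut_blocks G T) P), ?c (dcut_blocks (dcut_blocks G T) P)))) =
        (case PQ of (P, Q) \<Rightarrow> basis_vec (?c (dcontract_blocks (dcontract_blocks G P) Q),
           (?c (dcut_blocks (dcontract_blocks G P) Q), ?c (dcut_blocks G P))))"
      by (simp only: PQ prod.case)
  next
    fix TP assume "TP \<in> Sigma (?C (fst G)) (\<lambda>T. ?C (cut_blocks (fst G) T))"
    then obtain T P where TP: "TP = (T, P)" and T: "T \<in> ?C (fst G)"
      and P: "P \<in> ?C (cut_blocks (fst G) T)" by blast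
    note re = connected_partitions_refine[OF G T P]
    show "(\<lambda>(P, Q). (Union ` Q, P)) ((\<lambda>(T, P). (P, ?blocks P ` T)) TP) = TP"
      by (simp only: TP prod.case re(3))
    show "(\<lambda>(T, P). (P, ?blocks P ` T)) TP \<in>
        Sigma (?C (fst G)) (\<lambda>P. ?C (contract_blocks (fst G) P))"
      by (simp only: TP prod.case mem_Sigma_iff re(1,2))
  qed
  also have "\<dots> = (\<Sum>T\<in>?C (fst G). \<Sum>P\<in>?C (cut_blocks (fst G) T).
         basis_vec (?c (dcontract_blocks G T),
           (?c (dcontract_blocks (dcut_blocks G T) P), ?c (dcut_blocks (dcut_blocks G T) P))))"
    by (rule sum.Sigma[symmetric]) (simp_all add: G)
  also have "\<dots> = tensor_map id dgraph_delta (dgraph_delta (basis_vec g))"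
    by (simp add: g dgraph_delta_class[OF G], rule sum.cong)
      (simp_all add: dgraph_delta_class G)
  finally show ?thesis .
qed

text \<open>
  On the left only the partition into connected components survives, on the right only the partition
  into singletons.
\<close>

lemma dgraph_delta_counit:
  fixes g :: "'d::ab_semigroup_add dgraph_class"
  shows "form_left dgraph_eps' (dgraph_delta (basis_vec g)) = basis_vec g"
    and "form_right dgraph_eps' (dgraph_delta (basis_vec g)) = basis_vec g"
proof -
  obtain G :: "(nat, 'd) dgraph" where G: "finite_graph (fst G)" and g: "g = dgraph_class G"
    by (rule dgraph_class_cases)
  let ?C = "connected_partitions (fst G)"
  have fin: "finite ?C" using G by simp
  obtain D where D: "D \<in> ?C" "edges (contract_blocks (fst G) D) = {}"
    using components_exist[OF G] .
  have "form_left dgraph_eps' (dgraph_delta (basis_vec g)) =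
      (\<Sum>P\<in>?C. if P = D then basis_vec g else 0)"
    unfolding g dgraph_delta_class[OF G] structure_map_simps form_left_basis_vec
  proof (rule sum.cong[OF refl])
    fix P assume P: "P \<in> ?C"
    have "edges (contract_blocks (fst G) P) = {} \<longleftrightarrow> P = D"
      using components_unique[OF P _ D] D by blast
    moreover have "dcut_blocks G D = G"
      using cut_blocks_components[OF G D] by (simp add: dcut_blocks_def)
    ultimately show "qscale (dgraph_eps' (basis_vec (dgraph_class (dcontract_blocks G P))))
        (basis_vec (dgraph_class (dcut_blocks G P))) =
        (if P = D then basis_vec (dgraph_class G) else 0)"
      using dgraph_eps'_class[OF finite_dgraph(2)[OF G P]] by simp
  qed
  then show "form_left dgraph_eps' (dgraph_delta (basis_vec g)) = basis_vec g"
    by (simp add: sum.delta[OF fin] D(1))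
  let ?S = "(\<lambda>x. {x}) ` verts (fst G)"
  have S: "?S \<in> ?C" by (rule singletons_connected_partition)
  have "form_right dgraph_eps' (dgraph_delta (basis_vec g)) =
      (\<Sum>P\<in>?C. if P = ?S then basis_vec g else 0)"
    unfolding g dgraph_delta_class[OF G] structure_map_simps form_right_basis_vec
  proof (rule sum.cong[OF refl])
    fix P assume P: "P \<in> ?C"
    have "dgraph_class (dcontract_blocks G ?S) = dgraph_class G"
      by (rule dgraph_class_eqI[OF G dcontract_blocks_singletons[OF G], symmetric])
    then show "qscale (dgraph_eps' (basis_vec (dgraph_class (dcut_blocks G P))))
        (basis_vec (dgraph_class (dcontract_blocks G P))) =
        (if P = ?S then basis_vec (dgraph_class G) else 0)"
      using edges_cut_blocks_empty_iff[OF G P] dgraph_eps'_class[OF finite_dgraph(1)[OF G]] by simp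
  qed
  then show "form_right dgraph_eps' (dgraph_delta (basis_vec g)) = basis_vec g"
    by (simp add: sum.delta[OF fin] S)
qed

lemma dinduced_dcontract_blocks:
  assumes "finite R" "S \<subseteq> R"
  shows "dinduced (dcontract_blocks G R) S = dcontract_blocks (dinduced G (\<Union>S)) S"
  using induced_contract_blocks[OF assms] by (simp add: dinduced_def dcontract_blocks_def)

text \<open>No edge of the cut graph joins a block inside \<open>J\<close> to one outside \<open>J\<close>.\<close>

lemma class_mult_dcut_blocks:
  assumes G: "finite_graph (fst G)" and J: "J \<subseteq> verts (fst G)"
    and P: "P \<in> connected_partitions (induced (fst G) J)"
    and Q: "Q \<in> connected_partitions (induced (fst G) (verts (fst G) - J))"
  shows "dgraph_class (dcut_blocks (dinduced G J) P) \<odot>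
      dgraph_class (dcut_blocks (dinduced G (verts (fst G) - J)) Q) =
    dgraph_class (dcut_blocks G (P \<union> Q))"
proof -
  note u = connected_partitions_union[OF J P Q]
  have UQ: "\<Union>Q = verts (fst G) - J"
    using connected_partitionsD(2)[OF Q] by simp
  have "splits (fst (dcut_blocks G (P \<union> Q))) J (verts (fst G) - J)"
  proof -
    have "e \<subseteq> J \<or> e \<subseteq> verts (fst G) - J" if "p \<in> P \<union> Q" "e \<subseteq> p" for e p
      using that u(2) UQ by blast
    then show ?thesis using J by (auto simp: splits_def edges_cut_blocks)
  qed
  moreover have "dinduced (dcut_blocks G (P \<union> Q)) J = dcut_blocks (dinduced G J) P"
    using induced_cut_blocks[OF G u(1), of P] u(2) by (simp add: dinduced_def dcut_blocks_def)
  moreover have "dinduced (dcut_blocks G (P \<union> Q)) (verts (fst G) - J) =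
      dcut_blocks (dinduced G (verts (fst G) - J)) Q"
    using induced_cut_blocks[OF G u(1), of Q] UQ by (simp add: dinduced_def dcut_blocks_def)
  ultimately show ?thesis
    using class_mult_splits[of "dcut_blocks G (P \<union> Q)" J "verts (fst G) - J"] G by simp
qed

text \<open>
  No edge of the contracted graph joins \<open>P\<close> and \<open>Q\<close>, since none of the graph itself joins \<open>A\<close> and
  \<open>B\<close>.
\<close>

lemma class_mult_dcontract_blocks:
  assumes K: "finite_graph (fst K)" and s: "splits (fst K) A B"
    and P: "P \<in> connected_partitions (induced (fst K) A)"
    and Q: "Q \<in> connected_partitions (induced (fst K) B)"
  shows "dgraph_class (dcontract_blocks (dinduced K A) P) \<odot>
      dgraph_class (dcontract_blocks (dinduced K B) Q) =
    dgraph_class (dcontract_blocks K (P \<union> Q))"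
proof -
  have AB: "A \<subseteq> verts (fst K)" "B = verts (fst K) - A" using s by (auto simp: splits_def)
  note u = connected_partitions_union[OF AB(1) P Q[unfolded AB(2)]]
  have UQ: "\<Union>Q = B" using connected_partitionsD(2)[OF Q] by simp
  have fin: "finite (P \<union> Q)" by (rule finite_block[OF K u(1)])
  have "splits (fst (dcontract_blocks K (P \<union> Q))) P Q"
  proof -
    have "P \<inter> Q = {}" using u(3) by blast
    moreover have "e \<subseteq> P \<or> e \<subseteq> Q" if e: "e \<in> edges (contract_blocks (fst K) (P \<union> Q))" for e
    proof -
      obtain p q where pq: "e = {p, q}" "p \<in> P \<union> Q" "q \<in> P \<union> Q"
        using edge_cases[OF finite_contract_blocks[OF fin] e] by (metis verts_blocks(1))
      then obtain x y where xy: "x \<in> p" "y \<in> q" "{x, y} \<in> edges (fst K)"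
        using e by (auto simp: adjacent_contract_blocks)
      have "{x, y} \<subseteq> A \<or> {x, y} \<subseteq> B" using s xy(3) by (simp only: splits_def)
      moreover have "x \<notin> A" if "p \<in> Q" using that xy(1) UQ AB(2) by blast
      moreover have "x \<notin> B" if "p \<in> P" using that xy(1) u(2) AB(2) by blast
      moreover have "y \<notin> A" if "q \<in> Q" using that xy(2) UQ AB(2) by blast
      moreover have "y \<notin> B" if "q \<in> P" using that xy(2) u(2) AB(2) by blast
      ultimately show ?thesis using pq by auto
    qed
    ultimately show ?thesis by (simp add: splits_def)
  qed
  moreover have "dinduced (dcontract_blocks K (P \<union> Q)) P = dcontract_blocks (dinduced K A) P"
    using dinduced_dcontract_blocks[OF fin, of P K] u(2) by simp
  moreover have "dinduced (dcontract_blocks K (P \<union> Q)) Q = dcontract_blocks (dinduced K B) Q"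
    using dinduced_dcontract_blocks[OF fin, of Q K] UQ by simp
  ultimately show ?thesis
    using class_mult_splits[of "dcontract_blocks K (P \<union> Q)" P Q] fin by simp
qed

text \<open>A connected block that meets one part of a split graph lies in it.\<close>

lemma Union_blocks_splits:
  assumes s: "splits G A B" and R: "R \<in> connected_partitions G"
  shows "\<Union>{p \<in> R. p \<subseteq> A} = A"
proof -
  have AB: "A \<inter> B = {}" and V: "verts G = A \<union> B" using s by (auto simp: splits_def)
  have sub: "p \<subseteq> A" if p: "p \<in> R" "x \<in> p" "x \<in> A" for p x
  proof (rule connected_in_subset[OF connected_partitionsD(4)[OF R p(1)] p(2,3)])
    fix a b assume ab: "a \<in> A" "b \<in> p" "{a, b} \<in> edges G"
    have "{a, b} \<subseteq> A \<or> {a, b} \<subseteq> B" using s ab(3) by (simp only: splits_def)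
    then show "b \<in> A" using ab(1) AB by auto
  qed
  show ?thesis
  proof
    show "A \<subseteq> \<Union>{p \<in> R. p \<subseteq> A}"
    proof
      fix x assume x: "x \<in> A"
      then obtain p where p: "p \<in> R" "x \<in> p" using V connected_partitionsD(2)[OF R] by blast
      then show "x \<in> \<Union>{p \<in> R. p \<subseteq> A}" using sub[OF p x] by blast
    qed
  qed blast
qed

lemma dgraph_delta_mult:
  fixes g h :: "'d::ab_semigroup_add dgraph_class"
  shows "dgraph_delta (dgraph_mult (basis_vec (g, h))) =
     tensor_mult dgraph_mult (tensor (dgraph_delta (basis_vec g)) (dgraph_delta (basis_vec h)))"
proof -
  obtain K :: "(nat + nat, 'd) dgraph" and A B where K: "finite_graph (fst K)"
    and s: "splits (fst K) A B"
    and g: "g = dgraph_class (dinduced K A)" and h: "h = dgraph_class (dinduced K B)"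
    by (rule class_pair_cases)
  let ?C = "connected_partitions" and ?c = "dgraph_class"
  let ?S = "\<lambda>R. {p \<in> R. p \<subseteq> A}"
  have A: "A \<subseteq> verts (fst K)" and B: "B \<subseteq> verts (fst K)" "B = verts (fst K) - A"
    using s by (auto simp: splits_def)
  have gh: "g \<odot> h = ?c K" unfolding g h by (rule class_mult_splits[OF K s])
  have "tensor_mult dgraph_mult (tensor (dgraph_delta (basis_vec g)) (dgraph_delta (basis_vec h))) =
      (\<Sum>P\<in>?C (induced (fst K) A). \<Sum>Q\<in>?C (induced (fst K) B).
        basis_vec (?c (dcontract_blocks (dinduced K A) P) \<odot> ?c (dcontract_blocks (dinduced K B) Q),
          ?c (dcut_blocks (dinduced K A) P) \<odot> ?c (dcut_blocks (dinduced K B) Q)))"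
    by (simp add: g h dgraph_delta_class finite_dgraph(3)[OF K] K A B(1) dgraph_mult_class)
      (rule sum.swap)
  also have "\<dots> = (\<Sum>P\<in>?C (induced (fst K) A). \<Sum>Q\<in>?C (induced (fst K) B).
        basis_vec (?c (dcontract_blocks K (P \<union> Q)), ?c (dcut_blocks K (P \<union> Q))))"
  proof (intro sum.cong refl)
    fix P Q assume P: "P \<in> ?C (induced (fst K) A)" and Q: "Q \<in> ?C (induced (fst K) B)"
    show "basis_vec (?c (dcontract_blocks (dinduced K A) P) \<odot> ?c (dcontract_blocks (dinduced K B) Q),
          ?c (dcut_blocks (dinduced K A) P) \<odot> ?c (dcut_blocks (dinduced K B) Q)) =
        basis_vec (?c (dcontract_blocks K (P \<union> Q)), ?c (dcut_blocks K (P \<union> Q)))"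
      using class_mult_dcontract_blocks[OF K s P Q]
        class_mult_dcut_blocks[OF K A P Q[unfolded B(2)]] B(2) by simp
  qed
  also have "\<dots> = (\<Sum>(P, Q)\<in>?C (induced (fst K) A) \<times> ?C (induced (fst K) B).
        basis_vec (?c (dcontract_blocks K (P \<union> Q)), ?c (dcut_blocks K (P \<union> Q))))"
    by (rule sum.cartesian_product)
  also have "\<dots> = (\<Sum>R\<in>?C (fst K). basis_vec (?c (dcontract_blocks K R), ?c (dcut_blocks K R)))"
  proof (rule sum.reindex_bij_witness[where i = "\<lambda>R. (?S R, R - ?S R)" and j = "\<lambda>(P, Q). P \<union> Q"])
    fix PQ assume "PQ \<in> ?C (induced (fst K) A) \<times> ?C (induced (fst K) B)"
    then obtain P Q where PQ: "PQ = (P, Q)" and P: "P \<in> ?C (induced (fst K) A)"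
      and Q: "Q \<in> ?C (induced (fst K) (verts (fst K) - A))" using B(2) by blast
    note u = connected_partitions_union[OF A P Q]
    have "?S (P \<union> Q) = P"
      using blocks_in_Union[OF connected_partitionsD(1)[OF u(1)], of P] u(2) by simp
    then show "(?S ((\<lambda>(P, Q). P \<union> Q) PQ), (\<lambda>(P, Q). P \<union> Q) PQ - ?S ((\<lambda>(P, Q). P \<union> Q) PQ)) = PQ"
      by (simp only: PQ prod.case u(3))
    show "(\<lambda>(P, Q). P \<union> Q) PQ \<in> ?C (fst K)" by (simp only: PQ prod.case u(1))
    show "basis_vec (?c (dcontract_blocks K ((\<lambda>(P, Q). P \<union> Q) PQ)),
          ?c (dcut_blocks K ((\<lambda>(P, Q). P \<union> Q) PQ))) =
        (case PQ of (P, Q) \<Rightarrow> basis_vec (?c (dcontract_blocks K (P \<union> Q)), ?c (dcut_blocks K (P \<union> Q))))"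
      by (simp only: PQ prod.case)
  next
    fix R assume R: "R \<in> ?C (fst K)"
    have "?S R \<subseteq> R" by blast
    then show "(\<lambda>(P, Q). P \<union> Q) (?S R, R - ?S R) = R"
      by (simp only: prod.case) blast
    show "(?S R, R - ?S R) \<in> ?C (induced (fst K) A) \<times> ?C (induced (fst K) B)"
      using connected_partitions_sub(1,2)[OF R \<open>?S R \<subseteq> R\<close>]
      unfolding Union_blocks_splits[OF s R] B(2)[symmetric] by (rule SigmaI)
  qed
  also have "\<dots> = dgraph_delta (dgraph_mult (basis_vec (g, h)))"
    by (simp add: dgraph_mult_class gh dgraph_delta_class[OF K])
  finally show ?thesis by simp
qed

lemma connected_partitions_empty: "verts G = {} \<Longrightarrow> connected_partitions G = {{}}"
  by (auto simp: connected_partitions_def partition_on_empty)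

lemma dgraph_delta_unit:
  "dgraph_delta dgraph_unit = tensor (dgraph_unit :: 'd::ab_semigroup_add dgraph_class qvec) dgraph_unit"
proof -
  let ?E = "(empty_graph, \<lambda>_. undefined) :: (nat, 'd) dgraph"
  have "dgraph_class (dcontract_blocks ?E {}) = empty_class"
    "dgraph_class (dcut_blocks ?E {}) = empty_class"
    by (rule dgraph_class_empty; simp)+
  then show ?thesis
    by (simp add: dgraph_unit_def dgraph_delta_class connected_partitions_empty)
qed

lemma dgraph_bialgebra_delta:
  "bialgebra (dgraph_unit :: 'd::ab_semigroup_add dgraph_class qvec) dgraph_mult dgraph_delta dgraph_eps'"
proof (rule bialgebraI_basis)
  show "dgraph_eps' (dgraph_unit :: 'd dgraph_class qvec) = 1"
    by (simp add: dgraph_unit_def dgraph_eps'_class)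
  fix g h :: "'d dgraph_class"
  obtain G H :: "(nat, 'd) dgraph" where "finite_graph (fst G)" "g = dgraph_class G"
    "finite_graph (fst H)" "h = dgraph_class H"
    using dgraph_class_cases by metis
  moreover have "edges (disj_union (fst G) (fst H)) = {} \<longleftrightarrow> edges (fst G) = {} \<and> edges (fst H) = {}"
    by (simp add: disj_union_def)
  ultimately show "dgraph_eps' (dgraph_mult (basis_vec (g, h))) =
      dgraph_eps' (basis_vec g) * dgraph_eps' (basis_vec h)"
    by (simp add: dgraph_mult_class class_mult_class dgraph_eps'_class)
qed (simp_all add: dgraph_mult_assoc dgraph_mult_unit dgraph_delta_coassoc dgraph_delta_counit
    dgraph_delta_mult dgraph_delta_unit)

section \<open>Cointeraction\<close>

text \<open>
  The contracted graph is empty only if the graph is, so both sides vanish except on the empty graph.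
\<close>

lemma dgraph_cointeraction_counit:
  fixes g :: "'d::ab_semigroup_add dgraph_class"
  shows "form_left dgraph_eps (dgraph_delta (basis_vec g)) =
    qscale (dgraph_eps (basis_vec g)) dgraph_unit"
proof -
  obtain G :: "(nat, 'd) dgraph" where G: "finite_graph (fst G)" and g: "g = dgraph_class G"
    by (rule dgraph_class_cases)
  let ?t = "\<lambda>P. qscale (dgraph_eps (basis_vec (dgraph_class (dcontract_blocks G P))))
    (basis_vec (dgraph_class (dcut_blocks G P)))"
  have eps: "dgraph_eps (basis_vec (dgraph_class (dcontract_blocks G P))) = (if P = {} then 1 else 0)"
    if "P \<in> connected_partitions (fst G)" for P
    using dgraph_eps_class[OF finite_dgraph(2)[OF G that]] by simp
  have "form_left dgraph_eps (dgraph_delta (basis_vec g)) =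
      (\<Sum>P\<in>connected_partitions (fst G). ?t P)"
    by (simp add: g dgraph_delta_class[OF G])
  also have "\<dots> = qscale (dgraph_eps (basis_vec g)) dgraph_unit"
  proof (cases "verts (fst G) = {}")
    case True
    have "dgraph_class (dcut_blocks G {}) = empty_class"
      by (rule dgraph_class_empty) (simp_all add: True G)
    then show ?thesis
      using eps[of "{}"] dgraph_eps_class[OF G]
      by (simp add: True connected_partitions_empty g dgraph_unit_def)
  next
    case False
    have "?t P = 0" if P: "P \<in> connected_partitions (fst G)" for P
    proof -
      have "P \<noteq> {}" using connected_partitionsD(2)[OF P] False by auto
      then show ?thesis by (simp add: eps[OF P])
    qed
    then show ?thesis using False dgraph_eps_class[OF G] by (simp add: g)
  qed
  finally show ?thesis .
qed

text \<open>
  Both sides are indexed by a connected partition \<open>R\<close> of the graph together with a set \<open>S\<close> of its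
  blocks; on the left it appears as the vertex set \<open>\<Union>S\<close> with the partitions \<open>S\<close> of \<open>\<Union>S\<close> and \<open>R - S\<close>
  of its complement.
\<close>

lemma dgraph_cointeraction_basis:
  fixes g :: "'d::ab_semigroup_add dgraph_class"
  shows "m_1_3_24 dgraph_mult (tensor_map dgraph_delta dgraph_delta (dgraph_Delta (basis_vec g))) =
    tensor_map dgraph_Delta id (dgraph_delta (basis_vec g))"
proof -
  obtain G :: "(nat, 'd) dgraph" where G: "finite_graph (fst G)" and g: "g = dgraph_class G"
    by (rule dgraph_class_cases)
  let ?C = "connected_partitions" and ?c = "dgraph_class" and ?V = "verts (fst G)"
  let ?D = "\<lambda>J. ?C (induced (fst G) J) \<times> ?C (induced (fst G) (?V - J))"
  let ?l = "\<lambda>J (P, Q). basis_vec ((?c (dcontract_blocks (dinduced G J) P),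
          ?c (dcontract_blocks (dinduced G (?V - J)) Q)), ?c (dcut_blocks G (P \<union> Q)))"
  let ?r = "\<lambda>R S. basis_vec ((?c (dinduced (dcontract_blocks G R) S),
          ?c (dinduced (dcontract_blocks G R) (R - S))), ?c (dcut_blocks G R))"
  have fin: "finite ?V" by (rule finite_verts[OF G])
  have "tensor_map dgraph_Delta id (dgraph_delta (basis_vec g)) = (\<Sum>R\<in>?C (fst G). \<Sum>S\<in>Pow R. ?r R S)"
    by (simp add: g dgraph_delta_class[OF G], rule sum.cong)
      (simp_all add: dgraph_Delta_class finite_dgraph(2)[OF G] finite_block[OF G])
  also have "\<dots> = (\<Sum>(R, S)\<in>Sigma (?C (fst G)) Pow. ?r R S)"
    by (rule sum.Sigma) (simp_all add: G finite_block[OF G])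
  also have "\<dots> = (\<Sum>(J, PQ)\<in>Sigma (Pow ?V) ?D. ?l J PQ)"
  proof (rule sum.reindex_bij_witness[where i = "\<lambda>(J, (P, Q)). (P \<union> Q, P)"
        and j = "\<lambda>(R, S). (\<Union>S, (S, R - S))"])
    fix RS assume "RS \<in> Sigma (?C (fst G)) Pow"
    then obtain R S where RS: "RS = (R, S)" and R: "R \<in> ?C (fst G)" and S: "S \<subseteq> R" by blast
    note sub = connected_partitions_sub[OF R S]
    have U: "S \<union> (R - S) = R" using S by blast
    then show "(\<lambda>(J, (P, Q)). (P \<union> Q, P)) ((\<lambda>(R, S). (\<Union>S, (S, R - S))) RS) = RS"
      by (simp only: RS prod.case)
    have "\<Union>S \<subseteq> ?V" using S connected_partitionsD(2)[OF R] by blast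
    then show "(\<lambda>(R, S). (\<Union>S, (S, R - S))) RS \<in> Sigma (Pow ?V) ?D"
      using sub(1,2) by (simp only: RS prod.case mem_Sigma_iff Pow_iff)
    have finR: "finite R" by (rule finite_block[OF G R])
    show "(case (\<lambda>(R, S). (\<Union>S, (S, R - S))) RS of (J, PQ) \<Rightarrow> ?l J PQ) =
        (case RS of (R, S) \<Rightarrow> ?r R S)"
      using dinduced_dcontract_blocks[OF finR S, of G]
        dinduced_dcontract_blocks[OF finR, of "R - S" G] sub(3) U
      by (simp only: RS prod.case) simp
  next
    fix JPQ assume "JPQ \<in> Sigma (Pow ?V) ?D"
    then obtain J P Q where JPQ: "JPQ = (J, (P, Q))" and J: "J \<subseteq> ?V"
      and P: "P \<in> ?C (induced (fst G) J)" and Q: "Q \<in> ?C (induced (fst G) (?V - J))" by blast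
    note u = connected_partitions_union[OF J P Q]
    show "(\<lambda>(R, S). (\<Union>S, (S, R - S))) ((\<lambda>(J, (P, Q)). (P \<union> Q, P)) JPQ) = JPQ"
      by (simp only: JPQ prod.case u(2,3))
    show "(\<lambda>(J, (P, Q)). (P \<union> Q, P)) JPQ \<in> Sigma (?C (fst G)) Pow"
      using u(1) by (simp add: JPQ)
  qed
  also have "\<dots> = (\<Sum>J\<in>Pow ?V. \<Sum>PQ\<in>?D J. ?l J PQ)"
    by (rule sum.Sigma[symmetric]) (use fin G in simp_all)
  also have "\<dots> = m_1_3_24 dgraph_mult (tensor_map dgraph_delta dgraph_delta (dgraph_Delta (basis_vec g)))"
    unfolding g dgraph_Delta_class[OF G] tensor_map_simps structure_map_simps
  proof (rule sum.cong[OF refl])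
    fix J assume "J \<in> Pow ?V"
    then have J: "J \<subseteq> ?V" by simp
    have "m_1_3_24 dgraph_mult (tensor_map dgraph_delta dgraph_delta
          (basis_vec (?c (dinduced G J), ?c (dinduced G (?V - J))))) =
        (\<Sum>P\<in>?C (induced (fst G) J). \<Sum>Q\<in>?C (induced (fst G) (?V - J)).
          basis_vec ((?c (dcontract_blocks (dinduced G J) P),
            ?c (dcontract_blocks (dinduced G (?V - J)) Q)),
            ?c (dcut_blocks (dinduced G J) P) \<odot> ?c (dcut_blocks (dinduced G (?V - J)) Q)))"
      by (simp add: dgraph_delta_class finite_dgraph(3)[OF G] G J dgraph_mult_class) (rule sum.swap)
    also have "\<dots> = (\<Sum>P\<in>?C (induced (fst G) J). \<Sum>Q\<in>?C (induced (fst G) (?V - J)). ?l J (P, Q))"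
      by (intro sum.cong refl) (simp add: class_mult_dcut_blocks[OF G J])
    also have "\<dots> = (\<Sum>PQ\<in>?D J. ?l J PQ)"
      by (simp only: sum.cartesian_product) (simp only: split_def prod.collapse)
    finally show "(\<Sum>PQ\<in>?D J. ?l J PQ) = m_1_3_24 dgraph_mult (tensor_map dgraph_delta dgraph_delta
          (basis_vec (?c (dinduced G J), ?c (dinduced G (?V - J)))))" by simp
  qed
  finally show ?thesis by simp
qed

lemma dgraph_cointeraction:
  "cointeraction (dgraph_unit :: 'd::ab_semigroup_add dgraph_class qvec)
     dgraph_mult dgraph_Delta dgraph_eps dgraph_delta dgraph_eps'"
proof -
  have "form_left dgraph_eps (dgraph_delta x) = qscale (dgraph_eps x) dgraph_unit"
    for x :: "'d dgraph_class qvec"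
    by (induct x rule: qvec_induct) (simp_all add: dgraph_cointeraction_counit)
  moreover have "m_1_3_24 dgraph_mult (tensor_map dgraph_delta dgraph_delta (dgraph_Delta x)) =
      tensor_map dgraph_Delta id (dgraph_delta x)" for x :: "'d dgraph_class qvec"
    by (induct x rule: qvec_induct)
      (simp_all add: dgraph_cointeraction_basis dgraph_cointeraction_basis[unfolded id_def] id_def)
  ultimately show ?thesis
    using dgraph_bialgebra_Delta[where 'a = 'd] dgraph_bialgebra_delta[where 'd = 'd]
    unfolding cointeraction_def by (simp add: bialgebra_def)
qed

section \<open>Forgetting the decorations\<close>

lemma qlinear_graph [simp]:
  "qlinear graph_mult" "qlinear graph_Delta" "qlinear graph_delta"
  "qlinear_form graph_eps" "qlinear_form graph_eps'"
  by (simp_all add: graph_mult_def graph_Delta_def graph_delta_def graph_eps_def graph_eps'_def)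

lemmas graph_linear_simps [simp] =
  qlinear_simps[OF qlinear_graph(1)] qlinear_simps[OF qlinear_graph(2)]
  qlinear_simps[OF qlinear_graph(3)]
  qlinear_form_simps[OF qlinear_graph(4)] qlinear_form_simps[OF qlinear_graph(5)]

lemma forget_class:
  assumes G: "finite_graph (fst G)"
  shows "forget (basis_vec (dgraph_class G)) = basis_vec (graph_class (fst G))"
proof -
  obtain f where "dgraph_iso f G (dgraph_rep (dgraph_class G))" using dgraph_rep_class[OF G] .
  then have "graph_iso f (fst G) (fst (dgraph_rep (dgraph_class G)))" by (simp add: dgraph_iso_def)
  then show ?thesis by (simp add: forget_def graph_class_eqI[OF G])
qed

text \<open>
  A decorated isoclass contains a decoration of the chosen representative of the underlying
  isoclass.  For this member \<open>forget\<close> matches the defining sums of the two structures term by term.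
\<close>

lemma dgraph_class_over_rep:
  obtains g d where "a = dgraph_class (graph_rep g, d)" "forget (basis_vec a) = basis_vec g"
proof -
  obtain G :: "(nat, 'a) dgraph" where G: "finite_graph (fst G)" and a: "a = dgraph_class G"
    by (rule dgraph_class_cases)
  let ?g = "graph_class (fst G)"
  obtain f where f: "graph_iso f (fst G) (graph_rep ?g)" using graph_rep_class[OF G] .
  \<comment> \<open>the decoration of \<open>G\<close> transported to the representative\<close>
  let ?d = "\<lambda>x. snd G (inv_into (verts (fst G)) f x)"
  have "dgraph_iso f G (graph_rep ?g, ?d)"
    using f by (auto simp: dgraph_iso_def graph_iso_def bij_betw_def)
  then have "a = dgraph_class (graph_rep ?g, ?d)" unfolding a by (rule dgraph_class_eqI[OF G])
  then show thesis using that forget_class[OF G] a by metis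
qed

lemma forget_unit: "forget dgraph_unit = graph_unit"
  by (simp add: dgraph_unit_def graph_unit_def forget_class)

lemma forget_mult: "forget (dgraph_mult (tensor x y)) = graph_mult (tensor (forget x) (forget y))"
proof (induct x rule: qvec_induct)
  case (basis a)
  show ?case
  proof (induct y rule: qvec_induct)
    case (basis b)
    obtain g d where a: "a = dgraph_class (graph_rep g, d)" "forget (basis_vec a) = basis_vec g"
      by (rule dgraph_class_over_rep)
    obtain h d' where b: "b = dgraph_class (graph_rep h, d')" "forget (basis_vec b) = basis_vec h"
      by (rule dgraph_class_over_rep)
    have "forget (dgraph_mult (basis_vec (a, b))) =
        basis_vec (graph_class (disj_union (graph_rep g) (graph_rep h)))"
      unfolding a b by (simp add: dgraph_mult_class class_mult_class forget_class)
    then show ?case by (simp add: a(2) b(2) graph_mult_def)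
  qed simp_all
qed simp_all

lemma forget_Delta: "graph_Delta (forget x) = tensor_map forget forget (dgraph_Delta x)"
proof (induct x rule: qvec_induct)
  case (basis a)
  obtain g d where a: "a = dgraph_class (graph_rep g, d)" "forget (basis_vec a) = basis_vec g"
    by (rule dgraph_class_over_rep)
  have "tensor_map forget forget (dgraph_Delta (basis_vec a)) = (\<Sum>I\<in>Pow (verts (graph_rep g)).
      basis_vec (graph_class (induced (graph_rep g) I),
        graph_class (induced (graph_rep g) (verts (graph_rep g) - I))))"
    unfolding a by (simp add: dgraph_Delta_class, rule sum.cong) (simp_all add: forget_class)
  then show ?case by (simp add: a(2) graph_Delta_def Let_def)
qed simp_all

lemma graph_delta_rep:
  "graph_delta (basis_vec g) = (\<Sum>P\<in>connected_partitions (graph_rep g).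
     basis_vec (graph_class (contract_blocks (graph_rep g) P), graph_class (cut_blocks (graph_rep g) P)))"
proof -
  let ?R = "graph_rep g"
  let ?t = "\<lambda>P. basis_vec (graph_class (contract_blocks ?R P), graph_class (cut_blocks ?R P))"
  have "graph_delta (basis_vec g) = (\<Sum>r\<in>admissible ?R. ?t (verts ?R // r))"
    by (simp add: graph_delta_def Let_def contract_eq_contract_blocks, rule sum.cong)
      (simp_all add: cut_eq_cut_blocks)
  also have "\<dots> = (\<Sum>P\<in>connected_partitions ?R. ?t P)"
    by (rule sum.reindex_bij_betw[OF bij_betw_admissible])
  finally show ?thesis .
qed

lemma forget_delta:
  fixes x :: "'d::ab_semigroup_add dgraph_class qvec"
  shows "graph_delta (forget x) = tensor_map forget forget (dgraph_delta x)"
proof (induct x rule: qvec_induct)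
  case (basis a)
  obtain g d where a: "a = dgraph_class (graph_rep g, d)" "forget (basis_vec a) = basis_vec g"
    by (rule dgraph_class_over_rep)
  have "tensor_map forget forget (dgraph_delta (basis_vec a)) =
    (\<Sum>P\<in>connected_partitions (graph_rep g). basis_vec
      (graph_class (contract_blocks (graph_rep g) P), graph_class (cut_blocks (graph_rep g) P)))"
    unfolding a by (simp add: dgraph_delta_class, rule sum.cong)
      (simp_all add: forget_class finite_block[OF graph_rep(1)])
  then show ?case by (simp add: a(2) graph_delta_rep)
qed simp_all

lemma forget_eps: "graph_eps (forget x) = dgraph_eps x"
proof (induct x rule: qvec_induct)
  case (basis a)
  obtain g d where a: "a = dgraph_class (graph_rep g, d)" "forget (basis_vec a) = basis_vec g"
    by (rule dgraph_class_over_rep)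
  have "dgraph_eps (basis_vec a) = (if verts (graph_rep g) = {} then 1 else 0)"
    unfolding a by (simp add: dgraph_eps_class)
  then show ?case by (simp add: a(2) graph_eps_def)
qed simp_all

lemma forget_eps': "graph_eps' (forget x) = dgraph_eps' x"
proof (induct x rule: qvec_induct)
  case (basis a)
  obtain g d where a: "a = dgraph_class (graph_rep g, d)" "forget (basis_vec a) = basis_vec g"
    by (rule dgraph_class_over_rep)
  have "dgraph_eps' (basis_vec a) = (if edges (graph_rep g) = {} then 1 else 0)"
    unfolding a by (simp add: dgraph_eps'_class)
  then show ?case by (simp add: a(2) graph_eps'_def)
qed simp_all

text \<open>
  A section of \<open>forget\<close>.  Constant decorations are stable under passing to induced subgraphs, so it
  is compatible with \<open>\<Delta>\<close>.  It is not compatible with \<open>\<delta>\<close> in general, as contraction adds decorations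
  up.
\<close>

definition decorate :: "'d \<Rightarrow> graph_class qvec \<Rightarrow> 'd dgraph_class qvec" where
  "decorate d = lin_ext (\<lambda>g. basis_vec (dgraph_class (graph_rep g, \<lambda>_. d)))"

lemma qlinear_decorate [simp]: "qlinear (decorate d)"
  by (simp add: decorate_def)

lemmas decorate_simps [simp] = qlinear_simps[OF qlinear_decorate]

lemma decorate_class:
  assumes G: "finite_graph G"
  shows "decorate d (basis_vec (graph_class G)) = basis_vec (dgraph_class (G, \<lambda>_. d))"
proof -
  obtain f where f: "graph_iso f G (graph_rep (graph_class G))" using graph_rep_class[OF G] .
  have "dgraph_class (G, \<lambda>_. d) = dgraph_class (graph_rep (graph_class G), \<lambda>_. d)"
    by (rule dgraph_class_eqI[of _ f]) (simp_all add: G f dgraph_iso_const)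
  then show ?thesis by (simp add: decorate_def)
qed

lemma forget_decorate: "forget (decorate d x) = x"
  by (induct x rule: qvec_induct) (simp_all add: decorate_def forget_class)

lemma surj_forget: "surj forget"
  using forget_decorate by (metis surjI)

lemma decorate_Delta: "dgraph_Delta (decorate d x) = tensor_map (decorate d) (decorate d) (graph_Delta x)"
proof (induct x rule: qvec_induct)
  case (basis g)
  have "tensor_map (decorate d) (decorate d) (graph_Delta (basis_vec g)) =
    (\<Sum>I\<in>Pow (verts (graph_rep g)). basis_vec (dgraph_class (induced (graph_rep g) I, \<lambda>_. d),
        dgraph_class (induced (graph_rep g) (verts (graph_rep g) - I), \<lambda>_. d)))"
    by (simp add: graph_Delta_def Let_def, rule sum.cong) (simp_all add: decorate_class)
  then show ?case by (simp add: decorate_def dgraph_Delta_class dinduced_def)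
qed simp_all

lemma forget_bialgebra_morphism_Delta:
  "bialgebra_morphism dgraph_unit dgraph_mult dgraph_Delta dgraph_eps
     graph_unit graph_mult graph_Delta graph_eps forget"
  by (rule bialgebra_morphismI_surj[OF dgraph_bialgebra_Delta])
    (simp_all add: surj_forget forget_unit forget_mult forget_Delta forget_eps)

lemma forget_bialgebra_morphism_delta:
  "bialgebra_morphism (dgraph_unit :: 'd::ab_semigroup_add dgraph_class qvec)
     dgraph_mult dgraph_delta dgraph_eps' graph_unit graph_mult graph_delta graph_eps' forget"
  by (rule bialgebra_morphismI_surj[OF dgraph_bialgebra_delta])
    (simp_all add: surj_forget forget_unit forget_mult forget_delta forget_eps')

lemma forget_hopf_algebra_morphism:
  "hopf_algebra_morphism dgraph_unit dgraph_mult dgraph_Delta dgraph_eps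
     graph_unit graph_mult graph_Delta graph_eps (forget :: 'd dgraph_class qvec \<Rightarrow> graph_class qvec)"
proof -
  note F = forget_bialgebra_morphism_Delta[where 'a = 'd]
  obtain S :: "'d dgraph_class qvec \<Rightarrow> 'd dgraph_class qvec"
    where S: "antipode dgraph_unit dgraph_mult dgraph_Delta dgraph_eps S"
    using dgraph_antipode_exists by blast
  have "\<exists>S'. antipode graph_unit graph_mult graph_Delta graph_eps S'"
    using antipode_retract[OF F S qlinear_decorate forget_decorate decorate_Delta] by blast
  moreover have "bialgebra dgraph_unit dgraph_mult dgraph_Delta (dgraph_eps :: 'd dgraph_class qvec \<Rightarrow> rat)"
    "bialgebra graph_unit graph_mult graph_Delta graph_eps"
    using F by (simp_all add: bialgebra_morphism_def)
  ultimately show ?thesis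
    unfolding hopf_algebra_morphism_def hopf_algebra_def
    using S F bialgebra_morphism_antipode[OF F] by blast
qed

theorem theorem1p9:
  "cointeraction (dgraph_unit :: 'd::ab_semigroup_add dgraph_class qvec)
     dgraph_mult dgraph_Delta dgraph_eps dgraph_delta dgraph_eps' \<and>
   surj (forget :: 'd dgraph_class qvec \<Rightarrow> graph_class qvec) \<and>
   hopf_algebra_morphism
     dgraph_unit dgraph_mult dgraph_Delta dgraph_eps
     graph_unit graph_mult graph_Delta graph_eps
     (forget :: 'd dgraph_class qvec \<Rightarrow> graph_class qvec) \<and>
   bialgebra_morphism
     dgraph_unit dgraph_mult dgraph_delta dgraph_eps'
     graph_unit graph_mult graph_delta graph_eps'
     (forget :: 'd dgraph_class qvec \<Rightarrow> graph_class qvec)"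
  by (intro conjI dgraph_cointeraction surj_forget forget_hopf_algebra_morphism
      forget_bialgebra_morphism_delta)

end
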